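(* For any $(c,\kappa)\in\tilde{\mathcal{D}}\cup\mathcal{C}$, there exists a negative constant $A<1-1/(2\kappa)$ such that, if $\eta_0\in(-\infty,A)$, then there exists a weak solution $u\in\mathcal{X}(\mathbb{R})$ to $\mathrm{TW}(c,\kappa)$, unique up to multiplication by a constant phase, satisfying $$\mathcal{Z}(u)=\{0\}\quad\text{and}\quad 1-|u(0)|^2=\eta_0.$$ Also, $u\in\mathcal{N}\mathcal{X}(\mathbb{R})$, $\eta_0$ is the global minimum of $\eta=1-|u|^2$, and $\operatorname{card}(\mathcal{N}(u))=2$. In addition, if $(c,\kappa)\in\tilde{\mathcal{D}}$, then $\Gamma(u)=\mathcal{N}(u)$, whereas if $(c,\kappa)\in\mathcal{C}$, then $\eta$ is compactly supported (i.e. $u$ is a compacton).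
   Context: For $z_1,z_2\in\mathbb{C}$, $\langle z_1,z_2\rangle=\operatorname{Re}(z_1\overline{z_2})$. Energy space: $\mathcal{X}(\mathbb{R})=\{v\in H^1_{\mathrm{loc}}(\mathbb{R};\mathbb{C}): 1-|v|^2\in L^2(\mathbb{R}),\ v'\in L^2(\mathbb{R})\}$ (its elements are continuous); $\mathcal{N}\mathcal{X}(\mathbb{R})=\{v\in\mathcal{X}(\mathbb{R}):\inf_{\mathbb{R}}|v|>0\}$. $\mathrm{TW}(c,\kappa)$ is the equation $icu'+u''+u(1-|u|^2)+\kappa u(1-|u|^2)''=0$. A function $u\in\mathcal{X}(\mathbb{R})$ is a weak solution if for all $\phi\in C_0^\infty(\mathbb{R};\mathbb{C})$, $$\int_{\mathbb{R}}\langle icu'+u(1-|u|^2),\phi\rangle-\langle u',\phi'\rangle+2\kappa\langle u,u'\rangle\langle u,\phi\rangle'=0.$$ $\Gamma(u)=\{x\in\mathbb{R}:|u(x)|^2=1/(2\kappa)\}$; $\mathcal{Z}(u)=\{x\in\mathbb{R}\setminus\Gamma(u): x\text{ is a local extremum of }1-|u|^2\}$; $\mathcal{N}(u)$ is the set of points where $u$ is not differentiable in the classical sense. Parameter sets: $\tilde{\mathcal{D}}=\mathcal{D}_1\cup\mathcal{D}_3\cup\mathcal{B}_-\cup\mathcal{B}_+$ with $\mathcal{D}_1=\{0\le c<\sqrt2,\ 0<\kappa<1/2\}$, $\mathcal{D}_3=\{c>\sqrt2,\ \kappa>1/2\}$, $\mathcal{B}_-=\{c=\sqrt2,\ 0<\kappa<1/2\}$,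 $\mathcal{B}_+=\{c=\sqrt2,\ \kappa>1/2\}$; and $\mathcal{C}=\{c\ge0,\ \kappa=1/2\}$. *)

theory Defs
  imports "HOL-Analysis.Analysis"
begin

text \<open>The real inner product \<open>\<bullet>\<close> on \<open>complex\<close> is \<open>\<langle>z\<^sub>1, z\<^sub>2\<rangle> = Re (z\<^sub>1 * cnj z\<^sub>2)\<close>.\<close>

lemma inner_complex_eq_Re: "z\<^sub>1 \<bullet> z\<^sub>2 = Re (z\<^sub>1 * cnj z\<^sub>2)"
  by (simp add: inner_complex_def)

definition compactly_supported :: "(real \<Rightarrow> 'a::zero) \<Rightarrow> bool" where
  "compactly_supported f \<longleftrightarrow> compact (closure {x. f x \<noteq> 0})"

definition smooth :: "(real \<Rightarrow> 'a::real_normed_vector) \<Rightarrow> bool" where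
  "smooth f \<longleftrightarrow>
    (\<forall>n x. ((\<lambda>g y. vector_derivative g (at y)) ^^ n) f differentiable (at x))"

definition test_functions :: "(real \<Rightarrow> 'a::real_normed_vector) set" where
  "test_functions = {\<phi>. smooth \<phi> \<and> compactly_supported \<phi>}"

definition L2 :: "(real \<Rightarrow> 'a::{banach, second_countable_topology}) set" where
  "L2 = {f \<in> borel_measurable lborel. integrable lborel (\<lambda>x. (norm (f x))\<^sup>2)}"

definition L2_loc :: "(real \<Rightarrow> 'a::{banach, second_countable_topology}) set" where
  "L2_loc = {f \<in> borel_measurable lborel.
     \<forall>K. compact K \<longrightarrow> set_integrable lborel K (\<lambda>x. (norm (f x))\<^sup>2)}"

definition L1_loc :: "(real \<Rightarrow> 'a::{banach, second_countable_topology}) set" where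
  "L1_loc = {f \<in> borel_measurable lborel. \<forall>K. compact K \<longrightarrow> set_integrable lborel K f}"

definition has_weak_derivative ::
    "(real \<Rightarrow> 'a::{banach, second_countable_topology}) \<Rightarrow> (real \<Rightarrow> 'a) \<Rightarrow> bool" where
  "has_weak_derivative f g \<longleftrightarrow> f \<in> L1_loc \<and> g \<in> L1_loc \<and>
    (\<forall>\<phi> \<in> (test_functions :: (real \<Rightarrow> real) set).
       (LINT x|lborel. vector_derivative \<phi> (at x) *\<^sub>R f x) = - (LINT x|lborel. \<phi> x *\<^sub>R g x))"

text \<open>A representative of the weak derivative, which is unique only up to null sets; it is
  unspecified if there is no weak derivative.\<close>

definition weak_deriv ::
    "(real \<Rightarrow> 'a::{banach, second_countable_topology}) \<Rightarrow> real \<Rightarrow> 'a" where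
  "weak_deriv f = (SOME g. has_weak_derivative f g)"

definition H1_loc :: "(real \<Rightarrow> 'a::{banach, second_countable_topology}) set" where
  "H1_loc = {f \<in> L2_loc. \<exists>g \<in> L2_loc. has_weak_derivative f g}"

text \<open>Elements of \<open>H\<^sup>1\<^sub>l\<^sub>o\<^sub>c\<close> are identified with their continuous representatives, so the energy
  space consists of genuine continuous functions and pointwise conditions make sense.\<close>

definition energy_space :: "(real \<Rightarrow> complex) set" where
  "energy_space = {v \<in> H1_loc. continuous_on UNIV v \<and>
     (\<lambda>x. 1 - (cmod (v x))\<^sup>2) \<in> L2 \<and> weak_deriv v \<in> L2}"

definition nonvanishing_energy_space :: "(real \<Rightarrow> complex) set" where
  "nonvanishing_energy_space = {v \<in> energy_space. (INF x. cmod (v x)) > 0}"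

text \<open>Weak form of \<open>\<i> c u' + u'' + u (1 - \<bar>u\<bar>\<^sup>2) + \<kappa> u (1 - \<bar>u\<bar>\<^sup>2)'' = 0\<close>. For \<open>u\<close> in the energy
  space the integrand is integrable for every test function.\<close>

definition TW_weak_solution :: "real \<Rightarrow> real \<Rightarrow> (real \<Rightarrow> complex) \<Rightarrow> bool" where
  "TW_weak_solution c \<kappa> u \<longleftrightarrow> u \<in> energy_space \<and>
    (\<forall>\<phi> \<in> test_functions.
      (LINT x|lborel.
          (\<i> * complex_of_real c * weak_deriv u x
             + u x * complex_of_real (1 - (cmod (u x))\<^sup>2)) \<bullet> \<phi> x
        - weak_deriv u x \<bullet> vector_derivative \<phi> (at x)
        + 2 * \<kappa> * (u x \<bullet> weak_deriv u x) * weak_deriv (\<lambda>y. u y \<bullet> \<phi> y) x) = 0)"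

definition \<eta> :: "(real \<Rightarrow> complex) \<Rightarrow> real \<Rightarrow> real" where
  "\<eta> u x = 1 - (cmod (u x))\<^sup>2"

definition \<Gamma> :: "real \<Rightarrow> (real \<Rightarrow> complex) \<Rightarrow> real set" where
  "\<Gamma> \<kappa> u = {x. (cmod (u x))\<^sup>2 = 1 / (2 * \<kappa>)}"

definition local_extremum :: "(real \<Rightarrow> real) \<Rightarrow> real \<Rightarrow> bool" where
  "local_extremum f x \<longleftrightarrow>
    (\<forall>\<^sub>F y in nhds x. f y \<le> f x) \<or> (\<forall>\<^sub>F y in nhds x. f x \<le> f y)"

definition \<Z> :: "real \<Rightarrow> (real \<Rightarrow> complex) \<Rightarrow> real set" where
  "\<Z> \<kappa> u = {x. x \<notin> \<Gamma> \<kappa> u \<and> local_extremum (\<eta> u) x}"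

definition \<N> :: "(real \<Rightarrow> complex) \<Rightarrow> real set" where
  "\<N> u = {x. \<not> u differentiable (at x)}"

definition \<D>\<^sub>1 :: "(real \<times> real) set" where
  "\<D>\<^sub>1 = {(c, \<kappa>). 0 \<le> c \<and> c < sqrt 2 \<and> 0 < \<kappa> \<and> \<kappa> < 1/2}"

definition \<D>\<^sub>3 :: "(real \<times> real) set" where
  "\<D>\<^sub>3 = {(c, \<kappa>). c > sqrt 2 \<and> \<kappa> > 1/2}"

definition \<B>_minus :: "(real \<times> real) set" where
  "\<B>_minus = {(c, \<kappa>). c = sqrt 2 \<and> 0 < \<kappa> \<and> \<kappa> < 1/2}"

definition \<B>_plus :: "(real \<times> real) set" where
  "\<B>_plus = {(c, \<kappa>). c = sqrt 2 \<and> \<kappa> > 1/2}"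

definition \<D>_tilde :: "(real \<times> real) set" where
  "\<D>_tilde = \<D>\<^sub>1 \<union> \<D>\<^sub>3 \<union> \<B>_minus \<union> \<B>_plus"

definition \<C> :: "(real \<times> real) set" where
  "\<C> = {(c, \<kappa>). 0 \<le> c \<and> \<kappa> = 1/2}"

end

theory Submission
  imports Defs
begin

text \<open>
  Write \<open>y = 1 - \<bar>u\<bar>\<^sup>2\<close>. The flux \<open>u' - 2\<kappa>\<langle>u, u'\<rangle>u\<close> of a weak solution is absolutely continuous, but it
  only controls the part of \<open>u'\<close> orthogonal to \<open>u\<close> where \<open>\<bar>u\<bar>\<^sup>2 = 1/(2\<kappa>)\<close>. Conservation of momentum, with
  vanishing constant because of the finite energy, gives \<open>\<langle>\<i>u, u'\<rangle> = c y/2\<close>, and on each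
  component of the complement of \<open>\<Gamma> \<kappa> u\<close> there is a first integral
  \<open>(1 - 2\<kappa>(1 - y)) y'\<^sup>2 = y\<^sup>2 (2 - c\<^sup>2 - 2y) + K (1 - y)\<close>, whose constant \<open>K\<close> may jump across
  \<open>\<Gamma> \<kappa> u\<close>. Decay at infinity forces \<open>K = 0\<close> on unbounded components, whereas on the core, the component of the
  origin, \<open>y'(0) = 0\<close> forces \<open>K < 0\<close> if \<open>\<eta>\<^sub>0\<close> is very negative. So the core is bounded,
  both pieces are determined by quadrature, and so are their length and the phase of \<open>u\<close>. At the two ends of the
  core \<open>y'\<close> blows up; for \<open>\<kappa> = 1/2\<close> these are the points where \<open>y\<close> reaches \<open>0\<close>, and it stays there.
\<close>


section \<open>Smooth functions and test functions\<close>

text \<open>As y' is infinite at both ends of the core, the profile cannot be continued in x by an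
  initial value problem. In the parameter t the functions y, dx/dt and m = (1 - 2\<kappa>(1 - y)) y'
  are explicit and continuous, and the blow-up becomes a zero of dx/dt. Existence is then a
  verification of algebraic identities; uniqueness reads the same quadrature backwards, for x \<ge>
  0 and by reflection for x < 0. The quadrature needs monotonicity. Away from the origin, turning
  points and constant stretches off the level of \<open>\<Gamma>\<close> are excluded by the
  condition on \<open>\<Z>\<close>, but a plateau on that level is not. There the equations reduce
  to 4d^2 = c^2(d + 1) with d = 1/(2\<kappa>), which is impossible in \<open>\<D>_tilde\<close>. For
  \<kappa> = 1/2 the plateau is the state y = 0 itself. Besides making K negative, a very negative
  \<open>\<eta>\<^sub>0\<close> keeps the cofactor \<open>Q\<close> positive up to
  \<open>edge\<close>, so y rises there without a turning point. \<open>weak_deriv\<close> is an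
  arbitrary choice, so equations are carried by \<open>has_ac_derivative\<close>, which ignores null
  sets.\<close>

lemma smooth_coinduct:
  assumes "f \<in> F"
    and step: "\<And>f. f \<in> F \<Longrightarrow> \<exists>g\<in>F. \<forall>x. (f has_vector_derivative g x) (at x)"
  shows "smooth f"
proof -
  \<comment> \<open>Vector derivatives are unique, so the function produced by
    \<open>vector_derivative\<close> is the member of \<open>F\<close> that \<open>step\<close>
    supplies, and every iterate stays in \<open>F\<close>.\<close>
  have "((\<lambda>g y. vector_derivative g (at y)) ^^ n) f \<in> F" for n
  proof (induction n)
    case 0
    show ?case using assms by simp
  next
    case (Suc n)
    let ?h = "((\<lambda>g y. vector_derivative g (at y)) ^^ n) f"
    obtain g where g: "g \<in> F" "\<forall>x. (?h has_vector_derivative g x) (at x)" using step[OF Suc] by blast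
    have "(\<lambda>y. vector_derivative ?h (at y)) = g" using g vector_derivative_at by blast
    then show ?case using g by simp
  qed
  then show ?thesis
    unfolding smooth_def using step by (blast intro: differentiableI_vector)
qed

lemma smooth_has_vector_derivative:
  assumes "smooth f"
  shows "(f has_vector_derivative vector_derivative f (at x)) (at x)"
proof -
  have "((\<lambda>g y. vector_derivative g (at y)) ^^ 0) f differentiable at x"
    using assms unfolding smooth_def by blast
  then show ?thesis by (simp add: vector_derivative_works[symmetric])
qed

lemma smooth_vector_derivative:
  assumes "smooth f"
  shows "smooth (\<lambda>x. vector_derivative f (at x))"
  unfolding smooth_def
proof (intro allI)
  fix n x
  have "((\<lambda>g y. vector_derivative g (at y)) ^^ Suc n) f differentiable at x"
    using assms unfolding smooth_def by blast
  then show "((\<lambda>g y. vector_derivative g (at y)) ^^ n) (\<lambda>x. vector_derivative f (at x)) differentiable at x"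
    by (simp only: funpow_Suc_right o_def)
qed

lemma smooth_continuous_on: "smooth f \<Longrightarrow> continuous_on S f"
  by (intro continuous_on_vector_derivative[OF has_vector_derivative_at_within[OF smooth_has_vector_derivative]])

lemma smooth_measurable [measurable_dest]:
  "smooth f \<Longrightarrow> f \<in> borel_measurable borel"
  by (intro borel_measurable_continuous_onI smooth_continuous_on)

lemma smooth_antiderivative:
  assumes "\<And>x. (f has_vector_derivative g x) (at x)" "smooth g"
  shows "smooth f"
proof (rule smooth_coinduct[of f "insert f (Collect smooth)"])
  fix h assume "h \<in> insert f (Collect smooth)"
  then show "\<exists>g\<in>insert f (Collect smooth). \<forall>x. (h has_vector_derivative g x) (at x)"
    using assms smooth_has_vector_derivative[of h] smooth_vector_derivative[of h] by auto
qed simp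

lemma smooth_scaleR_left: 
  fixes f :: "real \<Rightarrow> real"
  assumes "smooth f"
  shows "smooth (\<lambda>x. f x *\<^sub>R z)"
proof (rule smooth_coinduct[of _ "{\<lambda>x. f x *\<^sub>R z | f. smooth f}"])
  fix h assume "h \<in> {\<lambda>x. f x *\<^sub>R z | f. smooth f}"
  then obtain f where f: "smooth f" "h = (\<lambda>x. f x *\<^sub>R z)" by blast
  have "\<forall>x. (h has_vector_derivative vector_derivative f (at x) *\<^sub>R z) (at x)"
    using smooth_has_vector_derivative[OF f(1)] unfolding f(2)
    by (auto intro!: derivative_eq_intros simp: has_real_derivative_iff_has_vector_derivative)
  then show "\<exists>g\<in>{\<lambda>x. f x *\<^sub>R z | f. smooth f}. \<forall>x. (h has_vector_derivative g x) (at x)"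
    using smooth_vector_derivative[OF f(1)]
    by (intro bexI[of _ "\<lambda>x. vector_derivative f (at x) *\<^sub>R z"] CollectI
      exI[of _ "\<lambda>x. vector_derivative f (at x)"] conjI refl)
qed (use assms in auto)

text \<open>The derivative of a product is a sum of two products, so the coinduction runs over all
  finite sums of products of smooth functions, represented by lists of pairs.\<close>

lemma smooth_mult:
  fixes f g :: "real \<Rightarrow> real"
  assumes "smooth f" "smooth g"
  shows "smooth (\<lambda>x. f x * g x)"
proof -
  define F where "F = {\<lambda>x. \<Sum>(a, b)\<leftarrow>L. a x * b x | L :: ((real \<Rightarrow> real) \<times> (real \<Rightarrow> real)) list.
     \<forall>(a, b)\<in>set L. smooth a \<and> smooth b}"
  let ?D = "\<lambda>a x. vector_derivative a (at x) :: real"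
  have "\<exists>L'. (\<forall>(a, b)\<in>set L'. smooth a \<and> smooth b) \<and>
      (\<forall>x. ((\<lambda>x. \<Sum>(a, b)\<leftarrow>L. a x * b x) has_vector_derivative (\<Sum>(a, b)\<leftarrow>L'. a x * b x)) (at x))"
    if "\<forall>(a, b)\<in>set L. smooth a \<and> smooth b" for L :: "((real \<Rightarrow> real) \<times> (real \<Rightarrow> real)) list"
    using that
  proof (induction L)
    case Nil
    then show ?case by (intro exI[of _ "[]"]) auto
  next
    case (Cons p L)
    obtain a b where p: "p = (a, b)" by (cases p)
    have s: "smooth a" "smooth b" using Cons.prems p by auto
    obtain L' where L': "\<forall>(a, b)\<in>set L'. smooth a \<and> smooth b"
      "\<And>x. ((\<lambda>x. \<Sum>(a, b)\<leftarrow>L. a x * b x) has_vector_derivative (\<Sum>(a, b)\<leftarrow>L'. a x * b x)) (at x)"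
      using Cons by auto
    have d: "((\<lambda>x. a x * b x) has_vector_derivative (a x * ?D b x + ?D a x * b x)) (at x)" for x
      using s by (intro has_vector_derivative_mult smooth_has_vector_derivative)
    show ?case
    \<comment> \<open>Leibniz rule: every pair of the list is replaced by two.\<close>
    proof (intro exI[of _ "(a, ?D b) # (?D a, b) # L'"] conjI allI)
      fix x
      show "((\<lambda>x. \<Sum>(a, b)\<leftarrow>p # L. a x * b x) has_vector_derivative
              (\<Sum>(a, b)\<leftarrow>(a, ?D b) # (?D a, b) # L'. a x * b x)) (at x)"
        using has_vector_derivative_add[OF d L'(2)] by (simp add: p add.assoc)
    qed (use L'(1) s smooth_vector_derivative[OF s(1)] smooth_vector_derivative[OF s(2)] in auto)
  qed
  note deriv = this
  have "\<exists>g\<in>F. \<forall>x. (h has_vector_derivative g x) (at x)" if "h \<in> F" for h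
  proof -
    obtain L where L: "h = (\<lambda>x. \<Sum>(a, b)\<leftarrow>L. a x * b x)" "\<forall>(a, b)\<in>set L. smooth a \<and> smooth b"
      using \<open>h \<in> F\<close> unfolding F_def mem_Collect_eq by (elim exE conjE)
    obtain L' where L': "\<forall>(a, b)\<in>set L'. smooth a \<and> smooth b"
      "\<forall>x. (h has_vector_derivative (\<Sum>(a, b)\<leftarrow>L'. a x * b x)) (at x)"
      using deriv[OF L(2)] unfolding L(1) by (elim exE conjE)
    show ?thesis
      unfolding F_def using L'
      by (intro bexI[of _ "\<lambda>x. \<Sum>(a, b)\<leftarrow>L'. a x * b x"] CollectI exI[of _ L'] conjI refl)
  qed
  moreover have "(\<lambda>x. f x * g x) \<in> F"
    unfolding F_def using assms by (intro CollectI exI[of _ "[(f, g)]"]) auto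
  ultimately show ?thesis by (rule smooth_coinduct[rotated])
qed

text \<open>The scalar k in the invariant class absorbs the factor a that each use of the chain rule
  produces.\<close>

lemma smooth_affine:
  fixes f :: "real \<Rightarrow> real"
  assumes "smooth f"
  shows "smooth (\<lambda>x. f (a * x + b))"
proof (rule smooth_coinduct[of _ "{\<lambda>x. k * f (a * x + b) | f (k::real). smooth f}"])
  fix h assume "h \<in> {\<lambda>x. k * f (a * x + b) | f (k::real). smooth f}"
  then obtain f k where f: "smooth f" "h = (\<lambda>x. k * f (a * x + b))" by blast
  have "\<forall>x. (h has_vector_derivative (k * a) * vector_derivative f (at (a * x + b))) (at x)"
  proof
    fix x
    have "(f has_real_derivative vector_derivative f (at (a * x + b))) (at (a * x + b))"
      using smooth_has_vector_derivative[OF f(1)] by (simp add: has_real_derivative_iff_has_vector_derivative)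
    moreover have "((\<lambda>x. a * x + b) has_real_derivative a) (at x)"
      by (auto intro!: derivative_eq_intros)
    ultimately have "((\<lambda>x. f (a * x + b)) has_real_derivative vector_derivative f (at (a * x + b)) * a) (at x)"
      by (rule DERIV_chain2)
    from DERIV_cmult[OF this, of k]
    show "(h has_vector_derivative (k * a) * vector_derivative f (at (a * x + b))) (at x)"
      by (simp add: f has_real_derivative_iff_has_vector_derivative[symmetric] ac_simps)
  qed
  then show "\<exists>g\<in>{\<lambda>x. k * f (a * x + b) | f (k::real). smooth f}. \<forall>x. (h has_vector_derivative g x) (at x)"
    using smooth_vector_derivative[OF f(1)] by (intro bexI[of _ "\<lambda>x. (k*a) * vector_derivative f (at (a * x + b))"] CollectI
      exI[of _ "\<lambda>x. vector_derivative f (at x)"] exI[of _ "k * a"] conjI refl)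
next
  show "(\<lambda>x. f (a * x + b)) \<in> {\<lambda>x. k * f (a * x + b) | f (k::real). smooth f}"
    using assms by (auto intro!: exI[of _ f] exI[of _ 1])
qed

text \<open>Peeling off the constant coefficient leaves y times the remaining polynomial, so the
  induction needs one more power of y; hence the general k.\<close>

lemma poly_times_exp_tendsto_0:
  assumes "\<epsilon> > (0::real)"
  shows "((\<lambda>y. y ^ k * poly p y * exp (- \<epsilon> * y)) \<longlongrightarrow> 0) at_top"
proof (induction p arbitrary: k)
  case 0
  show ?case by simp
next
  case (pCons a p)
  have "filterlim (\<lambda>y. \<epsilon> * y) at_top at_top"
    using assms by (intro filterlim_tendsto_pos_mult_at_top[OF tendsto_const]) (auto simp: filterlim_ident)
  from filterlim_compose[OF tendsto_power_div_exp_0 this, of k]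
  have "((\<lambda>y. (a / \<epsilon> ^ k) * ((\<epsilon> * y) ^ k / exp (\<epsilon> * y))) \<longlongrightarrow> (a / \<epsilon> ^ k) * 0) at_top"
    by (intro tendsto_mult tendsto_const)
  then have "((\<lambda>y. a * y ^ k * exp (- \<epsilon> * y)) \<longlongrightarrow> 0) at_top"
    using assms by (simp add: power_mult_distrib exp_minus field_simps)
  from tendsto_add[OF this pCons.IH[of "Suc k"]]
  show ?case by (simp add: algebra_simps)
qed

text \<open>The invariant class consists of the functions p(1/x) exp(-\<epsilon>/x), extended by 0
  to x \<le> 0, with p a polynomial. At 0 the exponential beats every polynomial in 1/x.\<close>

lemma smooth_exp_neg_inverse:
  assumes "\<epsilon> > (0::real)"
  shows "smooth (\<lambda>x. if x > 0 then exp (- \<epsilon> / x) else 0)"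
proof -
  let ?f = "\<lambda>(p::real poly) (x::real). if x > 0 then poly p (1 / x) * exp (- \<epsilon> / x) else 0"
  define F where "F = range ?f"
  have "\<exists>g\<in>F. \<forall>x. (h has_vector_derivative g x) (at x)" if "h \<in> F" for h
  proof -
    obtain p where h: "h = ?f p" using \<open>h \<in> F\<close> unfolding F_def by (elim rangeE)
    \<comment> \<open>With z = 1/x, differentiation in x is -z^2 times differentiation in z, so p(z)
      exp(-\<epsilon> z) turns into z^2 (\<epsilon> p(z) - p'(z)) exp(-\<epsilon> z).\<close>
    define q where "q = [:0, 0, 1:] * (smult \<epsilon> p - pderiv p)"
    have "(h has_real_derivative ?f q x) (at x)" for x :: real
    proof -
      consider "x > 0" | "x < 0" | "x = 0" by linarith
      then show ?thesis
      proof cases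
        case 1
        have inv: "((\<lambda>x. 1 / x) has_real_derivative - (1 / x\<^sup>2)) (at x)"
          using 1 by (auto intro!: derivative_eq_intros simp: power2_eq_square)
        have "((\<lambda>x. poly p (1 / x)) has_real_derivative poly (pderiv p) (1 / x) * - (1 / x\<^sup>2)) (at x)"
          by (rule DERIV_chain2[OF poly_DERIV inv])
        moreover have "((\<lambda>x. exp (- \<epsilon> / x)) has_real_derivative exp (- \<epsilon> / x) * (\<epsilon> / x\<^sup>2)) (at x)"
          using 1 by (auto intro!: derivative_eq_intros simp: power2_eq_square)
        ultimately have "((\<lambda>x. poly p (1 / x) * exp (- \<epsilon> / x)) has_real_derivative
           poly (pderiv p) (1 / x) * - (1 / x\<^sup>2) * exp (- \<epsilon> / x) + exp (- \<epsilon> / x) * (\<epsilon> / x\<^sup>2) * poly p (1 / x)) (at x)"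
          by (rule DERIV_mult)
        moreover have "poly (pderiv p) (1 / x) * - (1 / x\<^sup>2) * exp (- \<epsilon> / x) + exp (- \<epsilon> / x) * (\<epsilon> / x\<^sup>2) * poly p (1 / x) = ?f q x"
          using 1 by (simp add: q_def field_simps power2_eq_square)
        ultimately have "((\<lambda>x. poly p (1 / x) * exp (- \<epsilon> / x)) has_real_derivative ?f q x) (at x)"
          by simp
        then show ?thesis
          unfolding h by (rule has_field_derivative_transform_within_open[of _ _ _ "{0<..}"]) (use 1 in auto)
      next
        case 2
        have "((\<lambda>x. 0) has_real_derivative ?f q x) (at x)" using 2 by simp
        then show ?thesis
          unfolding h by (rule has_field_derivative_transform_within_open[of _ _ _ "{..<0}"]) (use 2 in auto)
      next
        case 3
        \<comment> \<open>The difference quotient at 0 carries one extra factor 1/y, which is the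
          power k = 1 here.\<close>
        have "((\<lambda>y. (1 / y) ^ 1 * poly p (1 / y) * exp (- \<epsilon> * (1 / y))) \<longlongrightarrow> 0) (at_right 0)"
          using filterlim_compose[OF poly_times_exp_tendsto_0[OF assms, of 1 p] filterlim_inverse_at_top_right]
          by (simp add: inverse_eq_divide)
        then have "((\<lambda>y. (?f p y - ?f p 0) / (y - 0)) \<longlongrightarrow> 0) (at_right 0)"
          by (rule Lim_transform_eventually) (auto simp: eventually_at_filter field_simps)
        moreover have "((\<lambda>y. (?f p y - ?f p 0) / (y - 0)) \<longlongrightarrow> 0) (at_left 0)"
          by (rule Lim_transform_eventually[OF tendsto_const]) (auto simp: eventually_at_filter)
        ultimately have "((\<lambda>y. (?f p y - ?f p 0) / (y - 0)) \<longlongrightarrow> 0) (at 0)"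
          by (rule filterlim_split_at[rotated])
        then show ?thesis unfolding has_field_derivative_iff h 3 by simp
      qed
    qed
    then show ?thesis
      unfolding F_def by (intro bexI[of _ "?f q"]) (auto simp: has_real_derivative_iff_has_vector_derivative[symmetric])
  qed
  moreover have "(\<lambda>x. if x > 0 then exp (- \<epsilon> / x) else 0) \<in> F"
    unfolding F_def by (intro image_eqI[of _ _ 1]) auto
  ultimately show ?thesis by (rule smooth_coinduct[rotated])
qed

text \<open>As \<open>\<epsilon> \<rightarrow> 0\<close> this converges to the indicator function of \<open>(a, b)\<close>.\<close>

definition bump :: "real \<Rightarrow> real \<Rightarrow> real \<Rightarrow> real \<Rightarrow> real" where
  "bump \<epsilon> a b x = (if a < x \<and> x < b then exp (- \<epsilon> / (x - a)) * exp (- \<epsilon> / (b - x)) else 0)"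

lemma smooth_bump:
  assumes "\<epsilon> > 0"
  shows "smooth (bump \<epsilon> a b)"
proof -
  let ?f = "\<lambda>x::real. if x > 0 then exp (- \<epsilon> / x) else 0"
  have "bump \<epsilon> a b = (\<lambda>x. ?f (1 * x + - a) * ?f ((-1) * x + b))"
    by (auto simp: bump_def fun_eq_iff)
  moreover have "smooth (\<lambda>x. ?f (1 * x + - a) * ?f ((-1) * x + b))"
    by (rule smooth_mult[OF smooth_affine smooth_affine]; rule smooth_exp_neg_inverse[OF assms])
  ultimately show ?thesis by simp
qed

lemma compactly_supportedI:
  assumes "\<And>x. x \<notin> {a..b} \<Longrightarrow> f x = 0"
  shows "compactly_supported f"
proof -
  have "closure {x. f x \<noteq> 0} \<subseteq> {a..b}"
    using assms by (intro closure_minimal subsetI) (auto intro: ccontr)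
  then show ?thesis
    unfolding compactly_supported_def
    by (meson bounded_closed_interval bounded_subset closed_closure compact_eq_bounded_closed)
qed

lemma compactly_supportedE:
  assumes "compactly_supported f"
  obtains M where "M > 0" "\<And>x. \<bar>x\<bar> \<ge> M \<Longrightarrow> f x = 0"
proof -
  have "bounded (closure {x. f x \<noteq> 0})"
    using assms compact_imp_bounded unfolding compactly_supported_def by blast
  then obtain M where M: "\<forall>x\<in>closure {x. f x \<noteq> 0}. \<bar>x\<bar> \<le> M"
    unfolding bounded_iff by auto
  then have "f x = 0" if "\<bar>x\<bar> \<ge> \<bar>M\<bar> + 1" for x
    using that closure_subset[of "{x. f x \<noteq> 0}"] by force
  then show ?thesis by (intro that[of "\<bar>M\<bar> + 1"]) auto
qed

lemma bump_test_function: "\<epsilon> > 0 \<Longrightarrow> bump \<epsilon> a b \<in> test_functions"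
  unfolding test_functions_def
  by (auto intro!: smooth_bump compactly_supportedI[of a b] simp: bump_def)

lemma bump_bounds:
  assumes "\<epsilon> > 0"
  shows "0 \<le> bump \<epsilon> a b x" "bump \<epsilon> a b x \<le> indicator {a<..<b} x"
  using assms by (auto simp: bump_def indicator_def intro!: mult_le_one)

lemma bump_tendsto:
  "(\<lambda>n. bump (1 / real (Suc n)) a b x) \<longlonglongrightarrow> indicator {a<..<b} x"
proof (cases "a < x \<and> x < b")
  case True
  have "(\<lambda>n. - (1 / real (Suc n)) / d) \<longlonglongrightarrow> - 0 / d" if "d > 0" for d :: real
    using that by (intro tendsto_divide tendsto_minus LIMSEQ_Suc[OF lim_1_over_n] tendsto_const) auto
  from tendsto_mult[OF tendsto_exp[OF this[of "x - a"]] tendsto_exp[OF this[of "b - x"]]]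
  show ?thesis using True by (simp add: bump_def)
qed (auto simp: bump_def)


section \<open>The fundamental lemma of the calculus of variations\<close>

lemma L1_locI:
  assumes "f \<in> borel_measurable borel" "\<And>a b. a \<le> b \<Longrightarrow> set_integrable lborel {a..b} f"
  shows "f \<in> L1_loc"
  unfolding L1_loc_def
proof (intro CollectI conjI allI impI)
  fix K :: "real set" assume K: "compact K"
  then obtain M where M: "\<forall>x\<in>K. \<bar>x\<bar> \<le> M" using compact_imp_bounded[OF K] by (auto simp: bounded_iff)
  have "set_integrable lborel {-\<bar>M\<bar>..\<bar>M\<bar>} f" using assms by simp
  then show "set_integrable lborel K f"
    by (rule set_integrable_subset) (use K M in \<open>force simp: borel_compact abs_le_iff\<close>)+
qed (use assms in simp)

lemma L1_locD:
  assumes "f \<in> L1_loc"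
  shows "f \<in> borel_measurable borel" "set_integrable lborel {a..b::real} f"
  using assms by (auto simp: L1_loc_def)

lemma L1_loc_continuous:
  fixes f :: "real \<Rightarrow> 'a::euclidean_space"
  assumes "continuous_on UNIV f" shows "f \<in> L1_loc"
proof (rule L1_locI)
  show "f \<in> borel_measurable borel" using assms by (rule borel_measurable_continuous_onI)
  show "set_integrable lborel {a..b} f" for a b
    unfolding set_integrable_def using assms
    by (intro borel_integrable_compact compact_Icc) (rule continuous_on_subset, auto)
qed

lemma L1_loc_add: "f \<in> L1_loc \<Longrightarrow> g \<in> L1_loc \<Longrightarrow> (\<lambda>x. f x + g x) \<in> L1_loc"
  by (rule L1_locI) (auto dest: L1_locD intro: borel_measurable_add)

lemma L1_loc_bounded_linear:
  assumes "bounded_linear T" "f \<in> L1_loc"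
  shows "(\<lambda>x. T (f x)) \<in> L1_loc"
proof (rule L1_locI)
  interpret bounded_linear T by fact
  have [measurable]: "T \<in> borel_measurable borel"
    by (intro borel_measurable_continuous_onI linear_continuous_on) fact
  have [measurable]: "f \<in> borel_measurable borel" using L1_locD assms by blast
  show "(\<lambda>x. T (f x)) \<in> borel_measurable borel" by measurable
  show "set_integrable lborel {a..b} (\<lambda>x. T (f x))" for a b
    using integrable_bounded_linear[OF assms(1), of lborel "\<lambda>x. indicator {a..b} x *\<^sub>R f x"]
      L1_locD(2)[OF assms(2), of a b]
    by (simp add: set_integrable_def scaleR)
qed

lemma L1_loc_minus: "f \<in> L1_loc \<Longrightarrow> (\<lambda>x. - f x) \<in> L1_loc"
  by (rule L1_loc_bounded_linear[OF bounded_linear_minus[OF bounded_linear_ident]])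

lemma L1_loc_diff: "f \<in> L1_loc \<Longrightarrow> g \<in> L1_loc \<Longrightarrow> (\<lambda>x. f x - g x) \<in> L1_loc"
  using L1_loc_add[OF _ L1_loc_minus, of f g] by simp

lemma L1_loc_bound:
  fixes f :: "real \<Rightarrow> 'a::{banach, second_countable_topology}"
    and g :: "real \<Rightarrow> 'b::{banach, second_countable_topology}"
  assumes "f \<in> L1_loc" "g \<in> borel_measurable borel"
    "\<And>a b. a \<le> b \<Longrightarrow> \<exists>C. \<forall>x\<in>{a..b}. norm (g x) \<le> C * norm (f x)"
  shows "g \<in> L1_loc"
proof (rule L1_locI)
  fix a b :: real assume "a \<le> b"
  then obtain C where C: "\<forall>x\<in>{a..b}. norm (g x) \<le> C * norm (f x)" using assms(3) by blast
  have [measurable]: "g \<in> borel_measurable borel" by fact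
  show "set_integrable lborel {a..b} g"
  proof (rule set_integrable_bound)
    show "set_integrable lborel {a..b} (\<lambda>x. C *\<^sub>R f x)"
      using L1_locD(2)[OF assms(1)] by auto
    show "AE x in lborel. x \<in> {a..b} \<longrightarrow> norm (g x) \<le> norm (C *\<^sub>R f x)"
    proof (intro AE_I2 impI)
      fix x assume "x \<in> {a..b}"
      then have "norm (g x) \<le> C * norm (f x)" using C by blast
      also have "\<dots> \<le> norm (C *\<^sub>R f x)" by (simp add: mult_right_mono)
      finally show "norm (g x) \<le> norm (C *\<^sub>R f x)" .
    qed
  qed (simp add: set_borel_measurable_def)
qed fact


text \<open>Inside a window [-n, n] the Borel sets over which f has integral zero contain the
  intervals and are closed under complements and countable disjoint unions, so they are all Borel
  sets. A density whose integrals all vanish is zero almost everywhere.\<close>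

lemma AE_zero_intervals:
  fixes f :: "real \<Rightarrow> 'a::{banach, second_countable_topology}"
  assumes f: "f \<in> L1_loc" and zero: "\<And>a b. a \<le> b \<Longrightarrow> (LINT x:{a..b}|lborel. f x) = 0"
  shows "AE x in lborel. f x = 0"
proof -
  have "AE x in lborel. indicator {- real n..real n} x *\<^sub>R f x = 0" for n
  proof (rule sigma_finite_measure.density_zero[OF sigma_finite_lborel])
    let ?f = "\<lambda>x. indicator {- real n..real n} x *\<^sub>R f x"
    show int: "integrable lborel ?f"
      using L1_locD(2)[OF f] by (simp add: set_integrable_def)
    have tot: "integral\<^sup>L lborel ?f = 0"
      using zero[of "- real n" "real n"] by (simp add: set_lebesgue_integral_def)
    fix A :: "real set" assume "A \<in> sets lborel"
    then have "A \<in> sets borel" by simp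
    then show "set_lebesgue_integral lborel A ?f = 0"
    proof (induction rule: borel_set_induct)
      case empty
      show ?case by (simp add: set_lebesgue_integral_def)
    next
      case (interval a b)
      have eq: "(\<lambda>x. indicator {a..b} x *\<^sub>R ?f x) =
          (\<lambda>x. indicator {max a (- real n)..min b (real n)} x *\<^sub>R f x)"
        by (auto simp: indicator_def fun_eq_iff)
      show ?case
      proof (cases "max a (- real n) \<le> min b (real n)")
        case True
        then show ?thesis
          using zero[OF True] unfolding set_lebesgue_integral_def eq by blast
      next
        case False
        then have "{max a (- real n)..min b (real n)} = {}" by auto
        then show ?thesis unfolding set_lebesgue_integral_def eq by simp
      qed
    next
      case (compl A)
      have iA: "set_integrable lborel A ?f"
        unfolding set_integrable_def using integrable_mult_indicator[OF _ int] compl by simp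
      have "(\<lambda>x. indicator (- A) x *\<^sub>R ?f x) = (\<lambda>x. ?f x - indicator A x *\<^sub>R ?f x)"
        by (auto simp: indicator_def fun_eq_iff)
      then have "set_lebesgue_integral lborel (-A) ?f = integral\<^sup>L lborel ?f - set_lebesgue_integral lborel A ?f"
        unfolding set_lebesgue_integral_def
        by (simp only:) (rule Bochner_Integration.integral_diff[OF int iA[unfolded set_integrable_def]])
      then show ?case using tot compl by simp
    next
      case (union F)
      have "set_lebesgue_integral lborel (\<Union>i. F i) ?f = (\<Sum>i. set_lebesgue_integral lborel (F i) ?f)"
      proof (rule lebesgue_integral_countable_add)
        show "set_integrable lborel (\<Union> (range F)) ?f"
          unfolding set_integrable_def using integrable_mult_indicator[OF _ int] union by simp
      qed (use union in \<open>auto simp: disjoint_family_on_def\<close>)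
      then show ?case using union by simp
    qed
  qed
  then have "AE x in lborel. \<forall>n. indicator {- real n..real n} x *\<^sub>R f x = 0"
    unfolding AE_all_countable by blast
  then show ?thesis
  proof eventually_elim
    case (elim x)
    obtain n where "\<bar>x\<bar> \<le> real n" using real_arch_simple by blast
    then show ?case using elim[rule_format, of n] by (auto simp: indicator_def abs_le_iff split: if_splits)
  qed
qed

text \<open>Bumps converge to the indicator of an open interval and are dominated by it, so the
  integrals of f over intervals are limits of zeros.\<close>

lemma L1_loc_eq_zero:
  fixes f :: "real \<Rightarrow> 'a::{banach, second_countable_topology}"
  assumes f: "f \<in> L1_loc"
    and zero: "\<And>\<psi>. \<psi> \<in> (test_functions :: (real \<Rightarrow> real) set) \<Longrightarrow> (LINT x|lborel. \<psi> x *\<^sub>R f x) = 0"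
  shows "AE x in lborel. f x = 0"
proof (rule AE_zero_intervals[OF f])
  fix a b :: real
  have [measurable]: "f \<in> borel_measurable borel" using L1_locD[OF f] by blast
  have bm[measurable]: "bump e a b \<in> borel_measurable borel" if "e > 0" for e
    using smooth_measurable[OF smooth_bump[OF that]] .
  have lim: "(\<lambda>n. LINT x|lborel. bump (1 / real (Suc n)) a b x *\<^sub>R f x) \<longlonglongrightarrow>
      (LINT x|lborel. indicator {a<..<b} x *\<^sub>R f x)"
  proof (rule integral_dominated_convergence)
    show "integrable lborel (\<lambda>x. norm (indicator {a..b} x *\<^sub>R f x))"
      using L1_locD(2)[OF f, of a b] unfolding set_integrable_def by (rule integrable_norm)
    show "AE x in lborel. (\<lambda>i. bump (1 / real (Suc i)) a b x *\<^sub>R f x) \<longlonglongrightarrow> indicator {a<..<b} x *\<^sub>R f x"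
      using bump_tendsto by (intro AE_I2 tendsto_scaleR tendsto_const)
    show "AE x in lborel. norm (bump (1 / real (Suc i)) a b x *\<^sub>R f x) \<le> norm (indicator {a..b} x *\<^sub>R f x)" for i
    proof (intro AE_I2)
      fix x
      have "bump (1 / real (Suc i)) a b x \<le> indicator {a..b} x" "0 \<le> bump (1 / real (Suc i)) a b x"
        using bump_bounds[of "1 / real (Suc i)" a b x]
        by (auto intro: order_trans simp del: of_nat_Suc simp: indicator_def of_bool_def split: if_splits)
      then show "norm (bump (1 / real (Suc i)) a b x *\<^sub>R f x) \<le> norm (indicator {a..b} x *\<^sub>R f x)"
        by (simp add: mult_right_mono)
    qed
  qed (use bm in auto)
  have "(LINT x|lborel. bump (1 / real (Suc n)) a b x *\<^sub>R f x) = 0" for n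
    by (rule zero[OF bump_test_function]) simp
  with lim have "(LINT x|lborel. indicator {a<..<b} x *\<^sub>R f x) = 0"
    by (simp only: LIMSEQ_const_iff)
  moreover have "(LINT x|lborel. indicator {a<..<b} x *\<^sub>R f x) = (LINT x|lborel. indicator {a..b} x *\<^sub>R f x)"
  proof (rule integral_cong_AE)
    show "AE x in lborel. indicator {a<..<b} x *\<^sub>R f x = indicator {a..b} x *\<^sub>R f x"
      using AE_lborel_singleton[of a] AE_lborel_singleton[of b]
      by eventually_elim (auto simp: indicator_def)
  qed auto
  ultimately show "(LINT x:{a..b}|lborel. f x) = 0" by (simp add: set_lebesgue_integral_def)
qed

section \<open>Absolutely continuous functions\<close>

text \<open>Local absolute continuity, in the form of the fundamental theorem of calculus. The
  derivative is fixed only up to null sets, the same freedom that \<open>weak_deriv\<close>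
  has.\<close>

definition has_ac_derivative ::
    "(real \<Rightarrow> 'a::{banach, second_countable_topology}) \<Rightarrow> (real \<Rightarrow> 'a) \<Rightarrow> bool" where
  "has_ac_derivative f f' \<longleftrightarrow>
     f' \<in> L1_loc \<and> (\<forall>a b. a \<le> b \<longrightarrow> (LINT x:{a..b}|lborel. f' x) = f b - f a)"

lemma has_ac_derivativeD:
  assumes "has_ac_derivative f f'"
  shows "f' \<in> L1_loc" "a \<le> b \<Longrightarrow> (LINT x:{a..b}|lborel. f' x) = f b - f a"
  using assms by (auto simp: has_ac_derivative_def)

lemma set_integral_Icc_combine:
  fixes f :: "real \<Rightarrow> 'a::{banach, second_countable_topology}"
  assumes "f \<in> L1_loc" "a \<le> b" "b \<le> c"
  shows "(LINT x:{a..c}|lborel. f x) = (LINT x:{a..b}|lborel. f x) + (LINT x:{b..c}|lborel. f x)"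
proof -
  have "{a..c} = {a..b} \<union> {b..c}" using assms by auto
  moreover have "(LINT x:{a..b} \<union> {b..c}|lborel. f x) = (LINT x:{a..b}|lborel. f x) + (LINT x:{b..c}|lborel. f x)"
  proof (rule set_integral_Un_AE)
    show "AE x in lborel. \<not> (x \<in> {a..b} \<and> x \<in> {b..c})"
      using AE_lborel_singleton[of b] by eventually_elim auto
  qed (use L1_locD(2)[OF assms(1)] in auto)
  ultimately show ?thesis by simp
qed

lemma L1_loc_antiderivative:
  fixes f :: "real \<Rightarrow> 'a::{banach, second_countable_topology}"
  assumes "f \<in> L1_loc"
  obtains F where "has_ac_derivative F f"
proof -
  define F where "F x = (if 0 \<le> x then LINT t:{0..x}|lborel. f t else - (LINT t:{x..0}|lborel. f t))" for x
  have s: "(LINT t:{0..0}|lborel. f t) = 0"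
    using set_integral_Icc_combine[OF assms, of 0 0 0] by simp
  have "(LINT x:{a..b}|lborel. f x) = F b - F a" if "a \<le> b" for a b
  proof -
    consider "0 \<le> a" | "a < 0" "0 \<le> b" | "b < 0" using that by linarith
    then show ?thesis
    proof cases
      case 1
      then show ?thesis using set_integral_Icc_combine[OF assms, of 0 a b] that by (simp add: F_def)
    next
      case 2
      then show ?thesis using set_integral_Icc_combine[OF assms, of a 0 b] by (simp add: F_def)
    next
      case 3
      then show ?thesis using set_integral_Icc_combine[OF assms, of a b 0] that by (simp add: F_def)
    qed
  qed
  then show ?thesis using that assms by (auto simp: has_ac_derivative_def)
qed

lemma has_ac_derivative_unique:
  assumes "has_ac_derivative f g" "has_ac_derivative f h"
  shows "AE x in lborel. g x = h x"
proof -
  have "AE x in lborel. g x - h x = 0"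
  proof (rule AE_zero_intervals)
    show "(\<lambda>x. g x - h x) \<in> L1_loc" using assms has_ac_derivativeD L1_loc_diff by blast
    show "(LINT x:{a..b}|lborel. g x - h x) = 0" if "a \<le> b" for a b
      using that has_ac_derivativeD(2)[OF assms(1) that] has_ac_derivativeD(2)[OF assms(2) that]
        L1_locD(2)[OF has_ac_derivativeD(1)[OF assms(1)]] L1_locD(2)[OF has_ac_derivativeD(1)[OF assms(2)]]
      by (subst set_integral_diff) auto
  qed
  then show ?thesis by simp
qed

lemma has_ac_derivative_cong_AE:
  assumes "has_ac_derivative f g" "h \<in> borel_measurable borel" "AE x in lborel. g x = h x"
  shows "has_ac_derivative f h"
proof -
  have [measurable]: "g \<in> borel_measurable borel" "h \<in> borel_measurable borel"
    using L1_locD(1)[OF has_ac_derivativeD(1)[OF assms(1)]] assms by auto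
  have ae: "AE x\<in>{a..b} in lborel. g x = h x" for a b using assms(3) by eventually_elim simp
  have "h \<in> L1_loc"
  proof (rule L1_locI)
    show "set_integrable lborel {a..b} h" for a b
      using L1_locD(2)[OF has_ac_derivativeD(1)[OF assms(1)], of a b]
      by (subst set_integrable_cong_AE[of h _ g]) (use ae[of a b] in \<open>auto elim: eventually_mono\<close>)
  qed simp
  moreover have "(LINT x:{a..b}|lborel. h x) = (LINT x:{a..b}|lborel. g x)" for a b
    by (rule set_lebesgue_integral_cong_AE) (use ae[of a b] in \<open>auto elim: eventually_mono\<close>)
  ultimately show ?thesis using assms(1) by (auto simp: has_ac_derivative_def)
qed

lemma has_ac_derivative_add:
  assumes "has_ac_derivative f f'" "has_ac_derivative g g'"
  shows "has_ac_derivative (\<lambda>x. f x + g x) (\<lambda>x. f' x + g' x)"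
  unfolding has_ac_derivative_def
proof (intro conjI allI impI)
  fix a b :: real assume ab: "a \<le> b"
  then show "(LINT x:{a..b}|lborel. f' x + g' x) = f b + g b - (f a + g a)"
    using has_ac_derivativeD(2)[OF assms(1) ab] has_ac_derivativeD(2)[OF assms(2) ab]
        L1_locD(2)[OF has_ac_derivativeD(1)[OF assms(1)]] L1_locD(2)[OF has_ac_derivativeD(1)[OF assms(2)]]
    by (subst set_integral_add) auto
qed (use assms has_ac_derivativeD L1_loc_add in blast)

lemma has_ac_derivative_bounded_linear:
  assumes T: "bounded_linear T" and f: "has_ac_derivative f f'"
  shows "has_ac_derivative (\<lambda>x. T (f x)) (\<lambda>x. T (f' x))"
  unfolding has_ac_derivative_def
proof (intro conjI allI impI)
  interpret bounded_linear T by fact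
  show "(\<lambda>x. T (f' x)) \<in> L1_loc" using L1_loc_bounded_linear[OF T] has_ac_derivativeD(1)[OF f] .
  fix a b :: real assume "a \<le> b"
  then show "(LINT x:{a..b}|lborel. T (f' x)) = T (f b) - T (f a)"
    using has_ac_derivativeD(2)[OF f, of a b] L1_locD(2)[OF has_ac_derivativeD(1)[OF f], of a b]
      integral_bounded_linear[OF T, of lborel "\<lambda>x. indicator {a..b} x *\<^sub>R f' x"]
    by (simp add: set_lebesgue_integral_def set_integrable_def scaleR diff)
qed

lemma has_ac_derivative_diff:
  assumes "has_ac_derivative f f'" "has_ac_derivative g g'"
  shows "has_ac_derivative (\<lambda>x. f x - g x) (\<lambda>x. f' x - g' x)"
  using has_ac_derivative_add[OF assms(1)
      has_ac_derivative_bounded_linear[OF bounded_linear_minus[OF bounded_linear_ident] assms(2)]] by simp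

lemma has_ac_derivative_const: "has_ac_derivative (\<lambda>x. c) (\<lambda>x. 0)"
  unfolding has_ac_derivative_def by (auto simp: L1_loc_def set_lebesgue_integral_def set_integrable_def)

lemma has_ac_derivative_continuous_on:
  fixes f :: "real \<Rightarrow> 'a::euclidean_space"
  assumes f: "has_ac_derivative f f'"
  shows "continuous_on S f"
proof -
  have "isCont f x" for x
  proof -
    have i: "set_integrable lborel {a..b} f'" for a b using L1_locD(2)[OF has_ac_derivativeD(1)[OF f]] .
    have "continuous_on {x-1..x+1} (\<lambda>y. f (x-1) + integral {x-1..y} f')"
      using set_borel_integral_eq_integral(1)[OF i]
      by (intro continuous_intros indefinite_integral_continuous_1)
    then have "continuous_on {x-1..x+1} f"
    proof (rule continuous_on_eq)
      show "f (x-1) + integral {x-1..y} f' = f y" if "y \<in> {x-1..x+1}" for y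
        using set_borel_integral_eq_integral(2)[OF i, of "x-1" y] has_ac_derivativeD(2)[OF f, of "x-1" y] that by simp
    qed
    then have "continuous_on {x-1<..<x+1} f" by (rule continuous_on_subset) auto
    then show ?thesis by (subst (asm) continuous_on_eq_continuous_at) auto
  qed
  then show ?thesis by (simp add: continuous_at_imp_continuous_on)
qed

text \<open>The passage from equations that hold almost everywhere to classical derivatives: where
  the derivative agrees almost everywhere with a continuous h, the function is a classical primitive
  of h.\<close>

lemma has_ac_derivative_has_vector_derivative:
  fixes f :: "real \<Rightarrow> 'a::euclidean_space"
  assumes f: "has_ac_derivative f f'"
    and S: "open S" "x \<in> S" "continuous_on S h" "AE y in lborel. y \<in> S \<longrightarrow> f' y = h y"
  shows "(f has_vector_derivative h x) (at x)"
proof -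
  obtain d where d: "d > 0" "cball x d \<subseteq> S" using S open_contains_cball by blast
  then have sub: "{x-d..x+d} \<subseteq> S" by (auto simp: cball_eq_atLeastAtMost)
  have hc: "continuous_on {x-d..x+d} h" using S(3) sub continuous_on_subset by blast
  have [measurable]: "f' \<in> borel_measurable borel" using L1_locD(1)[OF has_ac_derivativeD(1)[OF f]] .
  have "((\<lambda>y. f (x-d) + integral {x-d..y} h) has_vector_derivative 0 + h x) (at x within {x-d..x+d})"
    using d by (intro has_vector_derivative_add has_vector_derivative_const integral_has_vector_derivative hc) auto
  then have "((\<lambda>y. f (x-d) + integral {x-d..y} h) has_vector_derivative h x) (at x)"
    using d by (simp add: at_within_Icc_at)
  then show ?thesis
  proof (rule has_vector_derivative_transform_within_open[of _ _ _ "{x-d<..<x+d}"])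
    fix y assume y: "y \<in> {x-d<..<x+d}"
    have hi: "set_integrable lborel {x-d..y} h"
      unfolding set_integrable_def using y hc
      by (intro borel_integrable_compact compact_Icc) (auto elim: continuous_on_subset)
    have "f y - f (x-d) = (LINT t:{x-d..y}|lborel. f' t)" using has_ac_derivativeD(2)[OF f] y by simp
    also have "\<dots> = (LINT t:{x-d..y}|lborel. h t)"
      unfolding set_lebesgue_integral_def
    proof (rule integral_cong_AE)
      show "AE t in lborel. indicator {x-d..y} t *\<^sub>R f' t = indicator {x-d..y} t *\<^sub>R h t"
        using S(4) by eventually_elim (use sub y in \<open>force simp: indicator_def\<close>)
    qed (use hi in \<open>auto simp: set_integrable_def\<close>)
    also have "\<dots> = integral {x-d..y} h" by (rule set_borel_integral_eq_integral(2)[OF hi])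
    finally show "f (x-d) + integral {x-d..y} h = f y" by (simp add: algebra_simps)
  qed (use d in auto)
qed

lemma continuous_antiderivative:
  fixes f :: "real \<Rightarrow> 'a::euclidean_space"
  assumes "continuous_on UNIV f"
  obtains F where "\<And>x. (F has_vector_derivative f x) (at x)"
proof -
  obtain F where F: "has_ac_derivative F f"
    using L1_loc_antiderivative[OF L1_loc_continuous[OF assms]] by blast
  have "(F has_vector_derivative f x) (at x)" for x
    by (rule has_ac_derivative_has_vector_derivative[OF F open_UNIV UNIV_I assms]) simp
  then show ?thesis by (rule that)
qed

text \<open>At the finitely many points of S the derivative may fail to exist, as long as f' stays
  locally integrable. This is the form used at the two ends of the core.\<close>

lemma has_ac_derivativeI:
  fixes f :: "real \<Rightarrow> 'a::euclidean_space"
  assumes "finite S" "continuous_on UNIV f" "\<And>x. x \<notin> S \<Longrightarrow> (f has_vector_derivative f' x) (at x)"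
    "f' \<in> L1_loc"
  shows "has_ac_derivative f f'"
  unfolding has_ac_derivative_def
proof (intro conjI allI impI)
  fix a b :: real assume "a \<le> b"
  have "(f' has_integral (f b - f a)) {a..b}"
    by (rule fundamental_theorem_of_calculus_strong[OF assms(1) \<open>a \<le> b\<close>])
      (use assms(3) continuous_on_subset[OF assms(2)] in auto)
  then show "(LINT x:{a..b}|lborel. f' x) = f b - f a"
    by (simp add: set_borel_integral_eq_integral(2)[OF L1_locD(2)[OF assms(4)]] integral_unique)
qed fact

lemma test_function_has_ac_derivative:
  fixes \<phi> :: "real \<Rightarrow> 'a::euclidean_space"
  assumes "\<phi> \<in> test_functions"
  shows "has_ac_derivative \<phi> (\<lambda>x. vector_derivative \<phi> (at x))"
  using assms unfolding test_functions_def
  by (intro has_ac_derivativeI[of "{}"] L1_loc_continuous smooth_continuous_on smooth_vector_derivative smooth_has_vector_derivative) auto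


section \<open>Bilinear expressions and the product rule\<close>

lemma continuous_on_Icc_bounded:
  fixes f :: "real \<Rightarrow> 'a::real_normed_vector"
  assumes "continuous_on {a..b} f"
  obtains C where "\<And>x. x \<in> {a..b} \<Longrightarrow> norm (f x) \<le> C"
proof -
  have "bounded (f ` {a..b})"
    by (intro compact_imp_bounded compact_continuous_image assms compact_Icc)
  then obtain C where "\<forall>y\<in>f ` {a..b}. norm y \<le> C" unfolding bounded_iff by blast
  then show ?thesis by (intro that[of C]) simp
qed

lemma bounded_bilinear_measurable:
  fixes B :: "'a::{banach, second_countable_topology} \<Rightarrow> 'b::{banach, second_countable_topology} \<Rightarrow>
    'c::{banach, second_countable_topology}"
  assumes "bounded_bilinear B" "f \<in> borel_measurable M" "g \<in> borel_measurable M"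
  shows "(\<lambda>x. B (f x) (g x)) \<in> borel_measurable M"
  using assms(2,3)
  by (rule borel_measurable_continuous_Pair)
    (intro bounded_bilinear.continuous_on[OF assms(1)] continuous_intros)

lemma L1_loc_bilinear:
  fixes B :: "'a::euclidean_space \<Rightarrow> 'b::euclidean_space \<Rightarrow> 'c::euclidean_space"
  assumes B: "bounded_bilinear B" and f: "continuous_on UNIV f" and g: "g \<in> L1_loc"
  shows "(\<lambda>x. B (f x) (g x)) \<in> L1_loc"
proof (rule L1_loc_bound[OF g])
  show "(\<lambda>x. B (f x) (g x)) \<in> borel_measurable borel"
    by (intro bounded_bilinear_measurable[OF B] borel_measurable_continuous_onI f L1_locD(1)[OF g])
  fix a b :: real
  obtain K where K: "K \<ge> 0" "\<And>x y. norm (B x y) \<le> norm x * norm y * K"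
    using bounded_bilinear.nonneg_bounded[OF B] by blast
  obtain C where C: "\<And>x. x \<in> {a..b} \<Longrightarrow> norm (f x) \<le> C"
    using continuous_on_Icc_bounded[OF continuous_on_subset[OF f subset_UNIV]] by blast
  have "norm (B (f x) (g x)) \<le> (C * K) * norm (g x)" if "x \<in> {a..b}" for x
  proof -
    have "norm (B (f x) (g x)) \<le> norm (f x) * norm (g x) * K" by (rule K)
    also have "\<dots> \<le> C * norm (g x) * K" using C that K by (intro mult_right_mono) auto
    finally show ?thesis by (simp add: ac_simps)
  qed
  then show "\<exists>C. \<forall>x\<in>{a..b}. norm (B (f x) (g x)) \<le> C * norm (g x)" by blast
qed

text \<open>Split the square \<open>[a, b]\<^sup>2\<close> along its diagonal and exchange the order of integration on one
  of the two triangles.\<close>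

lemma has_ac_derivative_bilinear:
  fixes B :: "'a::euclidean_space \<Rightarrow> 'b::euclidean_space \<Rightarrow> 'c::euclidean_space"
  assumes B: "bounded_bilinear B" and f: "has_ac_derivative f f'" and g: "has_ac_derivative g g'"
  shows "has_ac_derivative (\<lambda>x. B (f x) (g x)) (\<lambda>x. B (f x) (g' x) + B (f' x) (g x))"
  unfolding has_ac_derivative_def
proof (intro conjI allI impI)
  interpret B: bounded_bilinear B by fact
  have fL: "f' \<in> L1_loc" and gL: "g' \<in> L1_loc" using has_ac_derivativeD(1) f g by auto
  have [measurable]: "f' \<in> borel_measurable borel" "g' \<in> borel_measurable borel"
    using L1_locD(1) fL gL by auto
  have cf: "continuous_on UNIV f" and cg: "continuous_on UNIV g"
    using has_ac_derivative_continuous_on f g by auto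
  show L: "(\<lambda>x. B (f x) (g' x) + B (f' x) (g x)) \<in> L1_loc"
    using L1_loc_bilinear[OF B cf gL] L1_loc_bilinear[OF B.flip cg fL] by (rule L1_loc_add)
  fix a b :: real assume ab: "a \<le> b"
  define F G where "F = (\<lambda>t. indicator {a..b} t *\<^sub>R f' t)" and "G = (\<lambda>t. indicator {a..b} t *\<^sub>R g' t)"
  have iF: "integrable lborel F" and iG: "integrable lborel G"
    using L1_locD(2)[OF fL] L1_locD(2)[OF gL] by (simp_all add: F_def G_def set_integrable_def)
  have [measurable]: "F \<in> borel_measurable borel" "G \<in> borel_measurable borel"
    using iF iG by auto
  have BM[measurable]: "(\<lambda>(x, y). B (F (u x y)) (G (v x y))) \<in> borel_measurable (lborel \<Otimes>\<^sub>M lborel)"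
    if "(\<lambda>(x, y). u x y) \<in> borel_measurable (lborel \<Otimes>\<^sub>M lborel)"
      "(\<lambda>(x, y). v x y) \<in> borel_measurable (lborel \<Otimes>\<^sub>M lborel)" for u v :: "real \<Rightarrow> real \<Rightarrow> real"
    unfolding split_beta
    by (intro bounded_bilinear_measurable[OF B])
      (use that in \<open>auto simp: split_beta intro: measurable_compose\<close>)
  obtain K where K: "K \<ge> 0" "\<And>x y. norm (B x y) \<le> norm x * norm y * K"
    using B.nonneg_bounded by blast
  have dom: "integrable (lborel \<Otimes>\<^sub>M lborel) (\<lambda>(x::real, t::real). norm (F t) * norm (G x) * K)"
  proof (rule lborel_pair.Fubini_integrable)
    show "integrable lborel (\<lambda>x. LINT t|lborel. norm (case (x, t) of (x, t) \<Rightarrow> norm (F t) * norm (G x) * K))"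
      using iG iF K(1) by (simp add: abs_mult)
    show "AE x in lborel. integrable lborel (\<lambda>t. case (x, t) of (x, t) \<Rightarrow> norm (F t) * norm (G x) * K)"
      using iF by auto
  qed measurable
  have int: "integrable (lborel \<Otimes>\<^sub>M lborel) (\<lambda>(x, t). B (F t) (G x))"
  proof (rule Bochner_Integration.integrable_bound[OF dom])
    show "AE p in lborel \<Otimes>\<^sub>M lborel. norm (case p of (x, t) \<Rightarrow> B (F t) (G x))
      \<le> norm (case p of (x, t) \<Rightarrow> norm (F t) * norm (G x) * K)"
      using K by (intro AE_I2) (auto simp: split_beta abs_mult intro: order_trans[OF K(2)])
  qed (rule BM; measurable)
  have int1: "integrable (lborel \<Otimes>\<^sub>M lborel) (\<lambda>(x, t). indicator {..x} t *\<^sub>R B (F t) (G x))"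
  proof (rule Bochner_Integration.integrable_bound[OF int])
    show "(\<lambda>(x, t). indicator {..x} t *\<^sub>R B (F t) (G x)) \<in> borel_measurable (lborel \<Otimes>\<^sub>M lborel)"
      using borel_measurable_integrable[OF int] by (simp add: split_beta indicator_def)
  qed (auto intro!: AE_I2 simp: indicator_def)
  have int2: "integrable (lborel \<Otimes>\<^sub>M lborel) (\<lambda>(x, t). indicator {x..} t *\<^sub>R B (F t) (G x))"
  proof (rule Bochner_Integration.integrable_bound[OF int])
    show "(\<lambda>(x, t). indicator {x..} t *\<^sub>R B (F t) (G x)) \<in> borel_measurable (lborel \<Otimes>\<^sub>M lborel)"
      using borel_measurable_integrable[OF int] by (simp add: split_beta indicator_def)
  qed (auto intro!: AE_I2 simp: indicator_def)
  have Fi: "integrable lborel (\<lambda>t. indicator A t *\<^sub>R F t)" and Gi: "integrable lborel (\<lambda>t. indicator A t *\<^sub>R G t)"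
    if "A \<in> sets borel" for A
    using iF iG that by (auto intro: integrable_mult_indicator)
  have Fx: "(LINT t|lborel. indicator {..x} t *\<^sub>R F t) = f x - f a" and
      Gx: "(LINT t|lborel. indicator {..x} t *\<^sub>R G t) = g x - g a" if "x \<in> {a..b}" for x
  proof -
    have e: "(\<lambda>t. indicator {..x} t *\<^sub>R F t) = (\<lambda>t. indicator {a..x} t *\<^sub>R f' t)"
      "(\<lambda>t. indicator {..x} t *\<^sub>R G t) = (\<lambda>t. indicator {a..x} t *\<^sub>R g' t)"
      using that by (auto simp: F_def G_def indicator_def fun_eq_iff)
    show "(LINT t|lborel. indicator {..x} t *\<^sub>R F t) = f x - f a"
      "(LINT t|lborel. indicator {..x} t *\<^sub>R G t) = g x - g a"
      unfolding e using has_ac_derivativeD(2)[OF f, of a x] has_ac_derivativeD(2)[OF g, of a x] that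
      by (simp_all add: set_lebesgue_integral_def)
  qed
  have zero: "F x = 0" "G x = 0" if "x \<notin> {a..b}" for x using that by (auto simp: F_def G_def)
  have BF: "(LINT t|lborel. B (h t) z) = B (LINT t|lborel. h t) z" if "integrable lborel h" for h z
    using integral_bounded_linear[OF B.bounded_linear_left that] .
  have BG: "(LINT t|lborel. B w (k t)) = B w (LINT t|lborel. k t)" if "integrable lborel k" for k w
    using integral_bounded_linear[OF B.bounded_linear_right that] .
  have A1: "(LINT t|lborel. indicator {..x} t *\<^sub>R B (F t) (G x)) = B (f x - f a) (G x)" for x
  proof (cases "x \<in> {a..b}")
    case True
    have "(LINT t|lborel. indicator {..x} t *\<^sub>R B (F t) (G x)) = (LINT t|lborel. B (indicator {..x} t *\<^sub>R F t) (G x))"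
      by (simp add: B.scaleR_left)
    also have "\<dots> = B (LINT t|lborel. indicator {..x} t *\<^sub>R F t) (G x)"
      by (intro BF Fi) auto
    finally show ?thesis using Fx[OF True] by simp
  qed (simp add: zero B.zero_right)
  have A2: "(LINT t|lborel. indicator {..x} t *\<^sub>R B (F x) (G t)) = B (F x) (g x - g a)" for x
  proof (cases "x \<in> {a..b}")
    case True
    have "(LINT t|lborel. indicator {..x} t *\<^sub>R B (F x) (G t)) = (LINT t|lborel. B (F x) (indicator {..x} t *\<^sub>R G t))"
      by (simp add: B.scaleR_right)
    also have "\<dots> = B (F x) (LINT t|lborel. indicator {..x} t *\<^sub>R G t)"
      by (intro BG Gi) auto
    finally show ?thesis using Gx[OF True] by simp
  qed (simp add: zero B.zero_left)
  have i1: "integrable lborel (\<lambda>x. B (f x - f a) (G x))"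
    using lborel_pair.integrable_fst[OF int1] by (simp add: A1)
  have swap: "(LINT x|lborel. LINT t|lborel. indicator {x..} t *\<^sub>R B (F t) (G x))
    = (LINT x|lborel. B (F x) (g x - g a))"
  proof -
    have "(LINT x|lborel. LINT t|lborel. indicator {x..} t *\<^sub>R B (F t) (G x))
      = (LINT t|lborel. LINT x|lborel. indicator {x..} t *\<^sub>R B (F t) (G x))"
      using lborel_pair.Fubini_integral[OF int2] by simp
    also have "\<dots> = (LINT t|lborel. LINT x|lborel. indicator {..t} x *\<^sub>R B (F t) (G x))"
      by (simp add: indicator_def)
    finally show ?thesis by (simp add: A2)
  qed
  have i2: "integrable lborel (\<lambda>x. B (F x) (g x - g a))"
  proof -
    have "integrable lborel (\<lambda>t. LINT x|lborel. indicator {x..} t *\<^sub>R B (F t) (G x))"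
      using lborel_pair.integrable_snd[OF int2] by simp
    moreover have "(LINT x|lborel. indicator {x..} t *\<^sub>R B (F t) (G x)) = B (F t) (g t - g a)" for t
      using A2[of t] by (simp add: indicator_def)
    ultimately show ?thesis by simp
  qed
  have "(LINT x|lborel. B (f x - f a) (G x)) + (LINT x|lborel. B (F x) (g x - g a))
     = (LINT x|lborel. LINT t|lborel. indicator {..x} t *\<^sub>R B (F t) (G x)) +
       (LINT x|lborel. LINT t|lborel. indicator {x..} t *\<^sub>R B (F t) (G x))"
    by (simp only: A1 swap)
  also have "\<dots> = (LINT x|lborel. (LINT t|lborel. indicator {..x} t *\<^sub>R B (F t) (G x)) +
       (LINT t|lborel. indicator {x..} t *\<^sub>R B (F t) (G x)))"
    using lborel_pair.integrable_fst[OF int1] lborel_pair.integrable_fst[OF int2]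
    by (intro Bochner_Integration.integral_add[symmetric]) simp_all
  also have "\<dots> = (LINT x|lborel. B (f b - f a) (G x))"
  proof (rule Bochner_Integration.integral_cong[OF refl])
    fix x
    have iB: "integrable lborel (\<lambda>t. B (F t) (G x))"
      using iF by (rule integrable_bounded_linear[OF B.bounded_linear_left])
    have "(LINT t|lborel. indicator {..x} t *\<^sub>R B (F t) (G x)) +
       (LINT t|lborel. indicator {x..} t *\<^sub>R B (F t) (G x)) =
       (LINT t|lborel. indicator {..x} t *\<^sub>R B (F t) (G x) + indicator {x..} t *\<^sub>R B (F t) (G x))"
      by (intro Bochner_Integration.integral_add[symmetric] integrable_mult_indicator iB) auto
    also have "\<dots> = (LINT t|lborel. B (F t) (G x))"
    proof (rule integral_cong_AE)
      show "AE t in lborel. indicator {..x} t *\<^sub>R B (F t) (G x) + indicator {x..} t *\<^sub>R B (F t) (G x) = B (F t) (G x)"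
        using AE_lborel_singleton[of x] by eventually_elim (auto simp: indicator_def)
    qed (use borel_measurable_integrable[OF iB] in auto)
    also have "\<dots> = B (LINT t|lborel. F t) (G x)" by (intro BF iF)
    also have "(LINT t|lborel. F t) = f b - f a"
      using has_ac_derivativeD(2)[OF f ab] by (simp add: F_def set_lebesgue_integral_def)
    finally show "(LINT t|lborel. indicator {..x} t *\<^sub>R B (F t) (G x)) +
       (LINT t|lborel. indicator {x..} t *\<^sub>R B (F t) (G x)) = B (f b - f a) (G x)" .
  qed
  also have "\<dots> = B (f b - f a) (LINT x|lborel. G x)" by (intro BG iG)
  also have iGv: "(LINT x|lborel. G x) = g b - g a"
    using has_ac_derivativeD(2)[OF g ab] by (simp add: G_def set_lebesgue_integral_def)
  finally have main: "(LINT x|lborel. B (f x - f a) (G x)) + (LINT x|lborel. B (F x) (g x - g a)) =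
    B (f b - f a) (g b - g a)" .
  have iFv: "(LINT x|lborel. F x) = f b - f a"
    using has_ac_derivativeD(2)[OF f ab] by (simp add: F_def set_lebesgue_integral_def)
  have i3: "integrable lborel (\<lambda>x. B (f a) (G x))" "integrable lborel (\<lambda>x. B (F x) (g a))"
    using integrable_bounded_linear[OF B.bounded_linear_right iG] integrable_bounded_linear[OF B.bounded_linear_left iF]
    by auto
  \<comment> \<open>The identity so far concerns increments from a. The terms with the constants
    \<open>f a\<close> and \<open>g a\<close> are now added back by bilinearity.\<close>
  have "(LINT x:{a..b}|lborel. B (f x) (g' x) + B (f' x) (g x)) =
    (LINT x|lborel. (B (f x - f a) (G x) + B (F x) (g x - g a)) + (B (f a) (G x) + B (F x) (g a)))"
    unfolding set_lebesgue_integral_def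
    by (intro Bochner_Integration.integral_cong refl)
      (simp add: F_def G_def B.scaleR_left B.scaleR_right B.diff_left B.diff_right B.zero_right B.zero_left indicator_def)
  also have "\<dots> = (LINT x|lborel. B (f x - f a) (G x)) + (LINT x|lborel. B (F x) (g x - g a)) +
     ((LINT x|lborel. B (f a) (G x)) + (LINT x|lborel. B (F x) (g a)))"
    using i1 i2 i3 by simp
  also have "\<dots> = B (f b - f a) (g b - g a) + (B (f a) (g b - g a) + B (f b - f a) (g a))"
    unfolding main by (simp add: BF[OF iF] BG[OF iG] iFv iGv)
  also have "\<dots> = B (f b) (g b) - B (f a) (g a)"
    by (simp add: B.diff_left B.diff_right)
  finally show "(LINT x:{a..b}|lborel. B (f x) (g' x) + B (f' x) (g x)) = B (f b) (g b) - B (f a) (g a)" .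
qed

lemmas has_ac_derivative_mult = has_ac_derivative_bilinear[OF bounded_bilinear_mult]
lemmas has_ac_derivative_inner = has_ac_derivative_bilinear[OF bounded_bilinear_inner]
lemmas has_ac_derivative_scaleR = has_ac_derivative_bilinear[OF bounded_bilinear_scaleR]

section \<open>Integration against test functions; weak and absolutely continuous
  derivatives\<close>

lemma has_ac_derivative_integral_zero:
  assumes F: "has_ac_derivative F F'" and M: "M > 0" "\<And>x. \<bar>x\<bar> \<ge> M \<Longrightarrow> F x = 0" "\<And>x. \<bar>x\<bar> \<ge> M \<Longrightarrow> F' x = 0"
  shows "integrable lborel F'" "(LINT x|lborel. F' x) = 0"
proof -
  have e: "F' = (\<lambda>x. indicator {-M..M} x *\<^sub>R F' x)"
    using M(3) by (force simp: fun_eq_iff indicator_def)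
  show "integrable lborel F'"
    using L1_locD(2)[OF has_ac_derivativeD(1)[OF F], of "-M" M] e by (simp add: set_integrable_def)
  have "(LINT x:{-M..M}|lborel. F' x) = 0"
    using has_ac_derivativeD(2)[OF F, of "-M" M] M by simp
  then show "(LINT x|lborel. F' x) = 0"
    using e by (simp add: set_lebesgue_integral_def)
qed

lemma L1_loc_integrable:
  assumes "f \<in> L1_loc" "\<And>x. \<bar>x\<bar> \<ge> M \<Longrightarrow> f x = 0"
  shows "integrable lborel f"
proof -
  have "f = (\<lambda>x. indicator {-M..M} x *\<^sub>R f x)"
    using assms(2) by (force simp: fun_eq_iff indicator_def)
  then show ?thesis
    using L1_locD(2)[OF assms(1), of "-M" M] by (simp add: set_integrable_def)
qed

lemma test_functionsE:
  fixes \<phi> :: "real \<Rightarrow> 'a::euclidean_space"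
  assumes "\<phi> \<in> test_functions"
  obtains M where "M > 0" "\<And>x. \<bar>x\<bar> \<ge> M \<Longrightarrow> \<phi> x = 0" "\<And>x. \<bar>x\<bar> \<ge> M \<Longrightarrow> vector_derivative \<phi> (at x) = 0"
    "smooth \<phi>" "continuous_on UNIV \<phi>" "continuous_on UNIV (\<lambda>x. vector_derivative \<phi> (at x))"
proof -
  have s: "smooth \<phi>" and c: "compactly_supported \<phi>" using assms by (auto simp: test_functions_def)
  obtain M where M: "M > 0" "\<And>x. \<bar>x\<bar> \<ge> M \<Longrightarrow> \<phi> x = 0" using compactly_supportedE[OF c] by blast
  have "vector_derivative \<phi> (at x) = 0" if "\<bar>x\<bar> \<ge> M + 1" for x
  proof -
    have "((\<lambda>x. 0) has_vector_derivative vector_derivative \<phi> (at x)) (at x)"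
    proof (rule has_vector_derivative_transform_within_open[OF smooth_has_vector_derivative[OF s]])
      show "open (ball x 1)" "x \<in> ball x 1" by auto
      show "\<phi> y = 0" if "y \<in> ball x 1" for y
        using that \<open>\<bar>x\<bar> \<ge> M + 1\<close> by (intro M(2)) (auto simp: dist_real_def)
    qed
    then show ?thesis using vector_derivative_unique_at has_vector_derivative_const by blast
  qed
  then show ?thesis
    using M s by (intro that[of "M + 1"] smooth_continuous_on smooth_vector_derivative) auto
qed

lemma test_function_integrable:
  fixes \<phi> :: "real \<Rightarrow> real" and f :: "real \<Rightarrow> 'a::euclidean_space"
  assumes \<phi>: "\<phi> \<in> test_functions"
  shows "integrable lborel \<phi>"
    and "f \<in> L1_loc \<Longrightarrow> integrable lborel (\<lambda>x. \<phi> x *\<^sub>R f x)"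
    and "f \<in> L1_loc \<Longrightarrow> integrable lborel (\<lambda>x. vector_derivative \<phi> (at x) *\<^sub>R f x)"
proof -
  obtain M where M: "M > 0" "\<And>x. \<bar>x\<bar> \<ge> M \<Longrightarrow> \<phi> x = 0" "\<And>x. \<bar>x\<bar> \<ge> M \<Longrightarrow> vector_derivative \<phi> (at x) = 0"
    "smooth \<phi>" and c: "continuous_on UNIV \<phi>" "continuous_on UNIV (\<lambda>x. vector_derivative \<phi> (at x))"
    by (rule test_functionsE[OF \<phi>]) (rule that; assumption)
  show "integrable lborel \<phi>"
    using M(2) by (rule L1_loc_integrable[OF L1_loc_continuous[OF c(1)]])
  show "integrable lborel (\<lambda>x. \<phi> x *\<^sub>R f x)" if "f \<in> L1_loc"
    by (rule L1_loc_integrable[OF L1_loc_bilinear[OF bounded_bilinear_scaleR c(1) that], of M]) (simp add: M)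
  show "integrable lborel (\<lambda>x. vector_derivative \<phi> (at x) *\<^sub>R f x)" if "f \<in> L1_loc"
    by (rule L1_loc_integrable[OF L1_loc_bilinear[OF bounded_bilinear_scaleR c(2) that], of M]) (simp add: M)
qed

lemma has_ac_imp_has_weak_derivative:
  fixes f :: "real \<Rightarrow> 'a::euclidean_space"
  assumes f: "has_ac_derivative f f'"
  shows "has_weak_derivative f f'"
  unfolding has_weak_derivative_def
proof (intro conjI ballI)
  have cf: "continuous_on UNIV f" using has_ac_derivative_continuous_on[OF f] .
  then show "f \<in> L1_loc" by (rule L1_loc_continuous)
  show fL: "f' \<in> L1_loc" using has_ac_derivativeD(1)[OF f] .
  fix \<phi> :: "real \<Rightarrow> real" assume \<phi>: "\<phi> \<in> test_functions"
  obtain M where M: "M > 0" "\<And>x. \<bar>x\<bar> \<ge> M \<Longrightarrow> \<phi> x = 0" "\<And>x. \<bar>x\<bar> \<ge> M \<Longrightarrow> vector_derivative \<phi> (at x) = 0"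
    and s: "smooth \<phi>" and c: "continuous_on UNIV \<phi>" "continuous_on UNIV (\<lambda>x. vector_derivative \<phi> (at x))"
    by (rule test_functionsE[OF \<phi>]) (rule that; assumption)
  note ac = has_ac_derivative_scaleR[OF test_function_has_ac_derivative[OF \<phi>] f]
  note i = test_function_integrable(2)[OF \<phi> fL] and i' = test_function_integrable(3)[OF \<phi> L1_loc_continuous[OF cf]]
  have "(LINT x|lborel. \<phi> x *\<^sub>R f' x + vector_derivative \<phi> (at x) *\<^sub>R f x) = 0"
    by (rule has_ac_derivative_integral_zero[OF ac M(1)]) (use M in auto)
  then show "(LINT x|lborel. vector_derivative \<phi> (at x) *\<^sub>R f x) = - (LINT x|lborel. \<phi> x *\<^sub>R f' x)"
    using i i' by (simp add: add_eq_0_iff)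
qed

text \<open>A test function of mean zero is the derivative of a test function. Subtracting a
  multiple of a fixed bump from an arbitrary \<psi> makes its mean zero, so h minus a suitable
  constant annihilates every test function.\<close>

lemma du_Bois_Reymond:
  fixes h :: "real \<Rightarrow> 'a::euclidean_space"
  assumes h: "h \<in> L1_loc"
    and zero: "\<And>\<phi>. \<phi> \<in> (test_functions :: (real \<Rightarrow> real) set) \<Longrightarrow>
      (LINT x|lborel. vector_derivative \<phi> (at x) *\<^sub>R h x) = 0"
  obtains C where "AE x in lborel. h x = C"
proof -
  define b where "b = bump 1 0 1"
  have b: "b \<in> test_functions" unfolding b_def by (rule bump_test_function) simp
  note bi = test_function_integrable(1) and hi = test_function_integrable(2)[OF _ h]
  define k where "k = (LINT x|lborel. b x)"
  have "k \<noteq> 0"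
  proof
    assume "k = 0"
    then have "AE x in lborel. b x = 0"
      using bump_bounds(1)[of 1 0 1] bi[OF b] integral_nonneg_eq_0_iff_AE[of lborel b]
      by (auto simp: k_def b_def)
    then have "AE x in lborel. x \<notin> {0<..<1::real}"
      by eventually_elim (auto simp: b_def bump_def split: if_splits)
    then have "{0<..<1::real} \<in> null_sets lborel"
      by (subst AE_iff_null_sets) auto
    then show False by (auto simp: null_sets_def)
  qed
  \<comment> \<open>The average of h with weight b: \<psi> and \<open>m * b\<close> have the same
    mean, so replacing one by the other produces exactly this constant.\<close>
  define C where "C = (1 / k) *\<^sub>R (LINT x|lborel. b x *\<^sub>R h x)"
  have "AE x in lborel. h x - C = 0"
  proof (rule L1_loc_eq_zero)
    show "(\<lambda>x. h x - C) \<in> L1_loc"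
      by (intro L1_loc_diff[OF h] L1_loc_continuous continuous_on_const)
    fix \<psi> :: "real \<Rightarrow> real" assume \<psi>: "\<psi> \<in> test_functions"
    define m where "m = (LINT x|lborel. \<psi> x) / k"
    define X where "X = (\<lambda>x. \<psi> x - m * b x)"
    obtain M1 where M1: "M1 > 0" "\<And>x. \<bar>x\<bar> \<ge> M1 \<Longrightarrow> \<psi> x = 0"
      "\<And>x. \<bar>x\<bar> \<ge> M1 \<Longrightarrow> vector_derivative \<psi> (at x) = 0" "smooth \<psi>" "continuous_on UNIV \<psi>"
      "continuous_on UNIV (\<lambda>x. vector_derivative \<psi> (at x))"
      by (rule test_functionsE[OF \<psi>]) (rule that; assumption)
    obtain M2 where M2: "M2 > 0" "\<And>x. \<bar>x\<bar> \<ge> M2 \<Longrightarrow> b x = 0"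
      "\<And>x. \<bar>x\<bar> \<ge> M2 \<Longrightarrow> vector_derivative b (at x) = 0" "smooth b" "continuous_on UNIV b"
      "continuous_on UNIV (\<lambda>x. vector_derivative b (at x))"
      by (rule test_functionsE[OF b]) (rule that; assumption)
    define M where "M = max M1 M2"
    have X0: "X x = 0" if "\<bar>x\<bar> \<ge> M" for x using M1(2) M2(2) that by (auto simp: X_def M_def)
    have M0: "M > 0" using M1 by (simp add: M_def)
    have cX: "continuous_on UNIV X" unfolding X_def by (intro continuous_intros M1 M2)
    have "smooth (\<lambda>x. \<psi> x + - (b x *\<^sub>R m))"
    proof (rule smooth_coinduct[of _ "{\<lambda>x. u x + - (v x *\<^sub>R m) | u v :: real \<Rightarrow> real. smooth u \<and> smooth v}"])
      fix f assume "f \<in> {\<lambda>x. u x + - (v x *\<^sub>R m) | u v :: real \<Rightarrow> real. smooth u \<and> smooth v}"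
      then obtain u v :: "real \<Rightarrow> real" where uv: "f = (\<lambda>x. u x + - (v x *\<^sub>R m))" "smooth u" "smooth v"
        unfolding mem_Collect_eq by (elim exE conjE)
      have "(f has_vector_derivative vector_derivative u (at x) + - (vector_derivative v (at x) *\<^sub>R m)) (at x)" for x
        unfolding uv(1)
        using has_vector_derivative_add[OF smooth_has_vector_derivative[OF uv(2)]
            has_vector_derivative_minus[OF bounded_linear.has_vector_derivative[OF bounded_linear_scaleR_left
            smooth_has_vector_derivative[OF uv(3)]]]] by simp
      then show "\<exists>g\<in>{\<lambda>x. u x + - (v x *\<^sub>R m) | u v :: real \<Rightarrow> real. smooth u \<and> smooth v}. \<forall>x. (f has_vector_derivative g x) (at x)"
        using smooth_vector_derivative[OF uv(2)] smooth_vector_derivative[OF uv(3)]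
        by (intro bexI[of _ "\<lambda>x. vector_derivative u (at x) + - (vector_derivative v (at x) *\<^sub>R m)"] allI CollectI
            exI[of _ "\<lambda>x. vector_derivative u (at x)"] exI[of _ "\<lambda>x. vector_derivative v (at x)"] conjI refl)
    next
      show "(\<lambda>x. \<psi> x + - (b x *\<^sub>R m)) \<in> {\<lambda>x. u x + - (v x *\<^sub>R m) | u v :: real \<Rightarrow> real. smooth u \<and> smooth v}"
        using M1 M2 by (intro CollectI exI[of _ \<psi>] exI[of _ b] conjI refl)
    qed
    then have sX: "smooth X" by (simp add: X_def mult.commute)
    have intX: "(LINT x|lborel. X x) = 0"
      using bi[OF \<psi>] bi[OF b] \<open>k \<noteq> 0\<close> by (simp add: X_def m_def k_def)
    obtain \<Phi> where \<Phi>: "has_ac_derivative \<Phi> X"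
      using L1_loc_antiderivative[OF L1_loc_continuous[OF cX]] by blast
    define \<phi> where "\<phi> = (\<lambda>x. \<Phi> x - \<Phi> (-M))"
    have d: "(\<phi> has_vector_derivative X x) (at x)" for x
    proof -
      have "(\<Phi> has_vector_derivative X x) (at x)"
        by (rule has_ac_derivative_has_vector_derivative[OF \<Phi> open_UNIV UNIV_I cX]) auto
      from has_vector_derivative_diff[OF this has_vector_derivative_const[of "\<Phi> (-M)"]]
      show ?thesis by (simp add: \<phi>_def)
    qed
    have iX: "(LINT x:{p..q}|lborel. X x) = \<Phi> q - \<Phi> p" if "p \<le> q" for p q
      using has_ac_derivativeD(2)[OF \<Phi> that] .
    \<comment> \<open>To the left of -M nothing of X is integrated; to the right of M all of X is,
      and its integral is zero.\<close>
    have \<phi>0: "\<phi> x = 0" if "x \<notin> {-M..M}" for x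
    proof -
      consider "x < -M" | "x > M" using \<open>x \<notin> {-M..M}\<close> by fastforce
      then show ?thesis
      proof cases
        case 1
        have "(\<lambda>t. indicator {x..-M} t *\<^sub>R X t) = (\<lambda>t. 0)"
          using X0 M0 by (auto simp: indicator_def fun_eq_iff)
        then show ?thesis using iX[of x "-M"] 1 by (simp add: \<phi>_def set_lebesgue_integral_def)
      next
        case 2
        have "(\<lambda>t. indicator {-M..x} t *\<^sub>R X t) = X"
          using X0 M0 2 by (force simp: indicator_def fun_eq_iff)
        then show ?thesis using iX[of "-M" x] intX 2 M0 by (simp add: \<phi>_def set_lebesgue_integral_def)
      qed
    qed
    have "\<phi> \<in> test_functions"
      unfolding test_functions_def
      using smooth_antiderivative[OF d sX] compactly_supportedI[OF \<phi>0] by auto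
    from zero[OF this] have "(LINT x|lborel. X x *\<^sub>R h x) = 0"
      using vector_derivative_at[OF d] by simp
    moreover have "(LINT x|lborel. X x *\<^sub>R h x) = (LINT x|lborel. \<psi> x *\<^sub>R h x) - m *\<^sub>R (LINT x|lborel. b x *\<^sub>R h x)"
      using hi[OF \<psi>] hi[OF b] by (simp add: X_def scaleR_diff_left flip: scaleR_scaleR)
    moreover have "(LINT x|lborel. \<psi> x *\<^sub>R (h x - C)) = (LINT x|lborel. \<psi> x *\<^sub>R h x) - (LINT x|lborel. \<psi> x) *\<^sub>R C"
      using hi[OF \<psi>] bi[OF \<psi>] by (simp add: scaleR_diff_right)
    ultimately show "(LINT x|lborel. \<psi> x *\<^sub>R (h x - C)) = 0"
      by (simp add: m_def C_def)
  qed
  then show ?thesis using that[of C] by simp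
qed

text \<open>For a primitive G of g, the difference f - G has weak derivative zero and is therefore
  constant almost everywhere.\<close>

lemma has_weak_imp_has_ac_derivative:
  fixes f :: "real \<Rightarrow> 'a::euclidean_space"
  assumes "has_weak_derivative f g"
  obtains F where "has_ac_derivative F g" "AE x in lborel. f x = F x"
proof -
  have fL: "f \<in> L1_loc" and gL: "g \<in> L1_loc"
    and w: "\<And>\<phi>. \<phi> \<in> (test_functions :: (real \<Rightarrow> real) set) \<Longrightarrow>
       (LINT x|lborel. vector_derivative \<phi> (at x) *\<^sub>R f x) = - (LINT x|lborel. \<phi> x *\<^sub>R g x)"
    using assms by (auto simp: has_weak_derivative_def)
  obtain G where G: "has_ac_derivative G g" using L1_loc_antiderivative[OF gL] by blast
  have GL: "G \<in> L1_loc" using L1_loc_continuous[OF has_ac_derivative_continuous_on[OF G]] .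
  obtain C where C: "AE x in lborel. f x - G x = C"
  proof (rule du_Bois_Reymond)
    show "(\<lambda>x. f x - G x) \<in> L1_loc" by (intro L1_loc_diff fL GL)
    fix \<phi> :: "real \<Rightarrow> real" assume \<phi>: "\<phi> \<in> test_functions"
    note i = test_function_integrable(3)[OF \<phi>]
    show "(LINT x|lborel. vector_derivative \<phi> (at x) *\<^sub>R (f x - G x)) = 0"
      using w[OF \<phi>] has_ac_imp_has_weak_derivative[OF G] \<phi> i[OF fL] i[OF GL]
      by (simp add: has_weak_derivative_def scaleR_diff_right)
  qed
  show ?thesis
  proof (rule that)
    show "has_ac_derivative (\<lambda>x. G x + C) g"
      using has_ac_derivative_add[OF G has_ac_derivative_const] by simp
    show "AE x in lborel. f x = G x + C" using C by eventually_elim (simp add: algebra_simps)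
  qed
qed

text \<open>The points of S where f and g differ form an open set, and a nonempty open set has
  positive measure.\<close>

lemma continuous_AE_eq_on:
  fixes f g :: "real \<Rightarrow> 'a::euclidean_space"
  assumes "open S" "x \<in> S" "continuous_on UNIV f" "continuous_on UNIV g"
    "AE x in lborel. x \<in> S \<longrightarrow> f x = g x"
  shows "f x = g x"
proof (rule ccontr)
  assume ne: "f x \<noteq> g x"
  have "open (S \<inter> {x. f x \<noteq> g x})"
    using assms by (intro open_Int open_Collect_neq)
  then obtain e where e: "e > 0" "ball x e \<subseteq> S \<inter> {x. f x \<noteq> g x}"
    using ne assms(2) by (auto elim!: openE)
  have "AE y in lborel. y \<notin> ball x e" using assms(5) by eventually_elim (use e in auto)
  then have "ball x e \<in> null_sets lborel"
    by (subst AE_iff_null_sets) auto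
  then have "emeasure lborel {x - e<..<x + e} = 0" by (simp add: null_sets_def ball_eq_greaterThanLessThan)
  then show False using e by simp
qed

lemma continuous_has_weak_imp_has_ac_derivative:
  fixes f :: "real \<Rightarrow> 'a::euclidean_space"
  assumes "has_weak_derivative f g" "continuous_on UNIV f"
  shows "has_ac_derivative f g"
proof -
  obtain F where F: "has_ac_derivative F g" "AE x in lborel. f x = F x"
    using has_weak_imp_has_ac_derivative[OF assms(1)] by blast
  have "f x = F x" for x
    by (rule continuous_AE_eq_on[OF open_UNIV UNIV_I assms(2) has_ac_derivative_continuous_on[OF F(1)]])
      (use F(2) in simp)
  then have "f = F" by blast
  then show ?thesis using F by simp
qed

lemma has_weak_derivative_weak_deriv:
  assumes "has_weak_derivative f g" shows "has_weak_derivative f (weak_deriv f)"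
  unfolding weak_deriv_def using assms by (rule someI[of "has_weak_derivative f"])

text \<open>\<open>weak_deriv\<close> is an unspecified choice. As soon as one absolutely continuous
  derivative is exhibited, the choice is determined almost everywhere, which is all that the
  integrals in the weak formulation see.\<close>

lemma has_ac_derivative_weak_deriv:
  fixes f :: "real \<Rightarrow> 'a::euclidean_space"
  assumes "has_ac_derivative f g"
  shows "has_ac_derivative f (weak_deriv f)" "AE x in lborel. weak_deriv f x = g x"
proof -
  have "has_weak_derivative f (weak_deriv f)"
    by (rule has_weak_derivative_weak_deriv[OF has_ac_imp_has_weak_derivative[OF assms]])
  then show a: "has_ac_derivative f (weak_deriv f)"
    by (rule continuous_has_weak_imp_has_ac_derivative) (rule has_ac_derivative_continuous_on[OF assms])
  show "AE x in lborel. weak_deriv f x = g x"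
    by (rule has_ac_derivative_unique[OF a assms])
qed


section \<open>The weak formulation as a first order system\<close>

text \<open>Along a weak solution \<open>u\<close> with derivative \<open>p\<close>, the flux \<open>p - 2\<kappa>\<langle>u, p\<rangle>u\<close> is absolutely continuous.
  It is insensitive to jumps of the radial part of \<open>p\<close> where \<open>\<bar>u\<bar>\<^sup>2 = 1/(2\<kappa>)\<close>, which is
  why singular solutions exist.\<close>

definition TW_flux :: "real \<Rightarrow> complex \<Rightarrow> complex \<Rightarrow> complex" where
  "TW_flux \<kappa> z p = p - (2 * \<kappa> * (z \<bullet> p)) *\<^sub>R z"

text \<open>Collects what is paired with the undifferentiated test function, including the part of
  \<langle>u, \<phi>\<rangle>' in which the derivative falls on u. The equation then says that the
  derivative of the flux is minus the source.\<close>

definition TW_source :: "real \<Rightarrow> real \<Rightarrow> complex \<Rightarrow> complex \<Rightarrow> complex" where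
  "TW_source c \<kappa> z p = \<i> * complex_of_real c * p + z * complex_of_real (1 - (cmod z)\<^sup>2) + (2 * \<kappa> * (z \<bullet> p)) *\<^sub>R p"

lemma TW_pointwise:
  "(\<i> * complex_of_real c * p + z * complex_of_real (1 - (cmod z)\<^sup>2)) \<bullet> w - p \<bullet> w'
     + 2 * \<kappa> * (z \<bullet> p) * (z \<bullet> w' + p \<bullet> w) = TW_source c \<kappa> z p \<bullet> w - TW_flux \<kappa> z p \<bullet> w'"
  by (simp add: TW_source_def TW_flux_def inner_add_left inner_diff_left algebra_simps)

lemma integrable_imp_L1_loc: "integrable lborel f \<Longrightarrow> f \<in> L1_loc"
  by (rule L1_locI) (auto simp: set_integrable_def intro: integrable_mult_indicator)

lemma TW_L1_loc:
  fixes v p :: "real \<Rightarrow> complex"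
  assumes v: "continuous_on UNIV v" and p: "p \<in> L1_loc" and p2: "integrable lborel (\<lambda>x. (cmod (p x))\<^sup>2)"
  shows "(\<lambda>x. TW_flux \<kappa> (v x) (p x)) \<in> L1_loc" "(\<lambda>x. TW_source c \<kappa> (v x) (p x)) \<in> L1_loc"
proof -
  have [measurable]: "v \<in> borel_measurable borel" "p \<in> borel_measurable borel"
    using borel_measurable_continuous_onI[OF v] L1_locD(1)[OF p] by auto
  have sc: "continuous_on UNIV (\<lambda>x. (2 * \<kappa>) *\<^sub>R v x)" by (intro continuous_intros v)
  have ip: "(\<lambda>x. 2 * \<kappa> * (v x \<bullet> p x)) \<in> L1_loc"
    using L1_loc_bilinear[OF bounded_bilinear_inner sc p] by simp
  have "(\<lambda>x. (2 * \<kappa> * (v x \<bullet> p x)) *\<^sub>R v x) \<in> L1_loc"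
    by (rule L1_loc_bilinear[OF bounded_bilinear.flip[OF bounded_bilinear_scaleR] v ip])
  then show "(\<lambda>x. TW_flux \<kappa> (v x) (p x)) \<in> L1_loc"
    unfolding TW_flux_def by (intro L1_loc_diff p)
  \<comment> \<open>The only term quadratic in p; square integrability of p enters here.\<close>
  have "(\<lambda>x. (2 * \<kappa> * (v x \<bullet> p x)) *\<^sub>R p x) \<in> L1_loc"
  proof (rule L1_loc_bound[OF integrable_imp_L1_loc[OF p2]])
    fix a b :: real
    obtain C where C: "\<And>x. x \<in> {a..b} \<Longrightarrow> norm (v x) \<le> C"
      using continuous_on_Icc_bounded[OF continuous_on_subset[OF v subset_UNIV]] by blast
    have "norm ((2 * \<kappa> * (v x \<bullet> p x)) *\<^sub>R p x) \<le> (2 * \<bar>\<kappa>\<bar> * C) * norm ((cmod (p x))\<^sup>2)" if "x \<in> {a..b}" for x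
    proof -
      have "\<bar>v x \<bullet> p x\<bar> \<le> norm (v x) * norm (p x)" by (rule Cauchy_Schwarz_ineq2)
      also have "\<dots> \<le> C * norm (p x)" using C that by (intro mult_right_mono) auto
      finally have "2 * \<bar>\<kappa>\<bar> * \<bar>v x \<bullet> p x\<bar> * norm (p x) \<le> 2 * \<bar>\<kappa>\<bar> * (C * norm (p x)) * norm (p x)"
        by (intro mult_right_mono mult_left_mono) auto
      then show ?thesis by (simp add: abs_mult power2_eq_square ac_simps)
    qed
    then show "\<exists>C. \<forall>x\<in>{a..b}. norm ((2 * \<kappa> * (v x \<bullet> p x)) *\<^sub>R p x) \<le> C * norm ((cmod (p x))\<^sup>2)" by blast
  qed simp
  moreover have "(\<lambda>x. \<i> * complex_of_real c * p x) \<in> L1_loc"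
    by (rule L1_loc_bounded_linear[OF bounded_linear_mult_right p])
  moreover have "(\<lambda>x. v x * complex_of_real (1 - (cmod (v x))\<^sup>2)) \<in> L1_loc"
    by (intro L1_loc_continuous continuous_intros v)
  ultimately show "(\<lambda>x. TW_source c \<kappa> (v x) (p x)) \<in> L1_loc"
    unfolding TW_source_def by (intro L1_loc_add)
qed

section \<open>Energy space and weak solutions through absolutely continuous derivatives\<close>

lemma energy_spaceD:
  assumes "v \<in> energy_space"
  shows "continuous_on UNIV v" "has_ac_derivative v (weak_deriv v)"
    "integrable lborel (\<lambda>x. (cmod (weak_deriv v x))\<^sup>2)" "integrable lborel (\<lambda>x. (1 - (cmod (v x))\<^sup>2)\<^sup>2)"
proof -
  show c: "continuous_on UNIV v" using assms by (simp add: energy_space_def)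
  obtain g where "has_weak_derivative v g" using assms by (auto simp: energy_space_def H1_loc_def)
  then show "has_ac_derivative v (weak_deriv v)"
    by (intro continuous_has_weak_imp_has_ac_derivative[OF _ c] has_weak_derivative_weak_deriv)
  show "integrable lborel (\<lambda>x. (cmod (weak_deriv v x))\<^sup>2)" "integrable lborel (\<lambda>x. (1 - (cmod (v x))\<^sup>2)\<^sup>2)"
    using assms by (auto simp: energy_space_def L2_def)
qed

lemma energy_spaceI:
  assumes v: "has_ac_derivative v p" and p2: "integrable lborel (\<lambda>x. (cmod (p x))\<^sup>2)"
    and e2: "integrable lborel (\<lambda>x. (1 - (cmod (v x))\<^sup>2)\<^sup>2)"
  shows "v \<in> energy_space"
proof -
  have c: "continuous_on UNIV v" using has_ac_derivative_continuous_on[OF v] .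
  have [measurable]: "v \<in> borel_measurable borel" "p \<in> borel_measurable borel"
    using borel_measurable_continuous_onI[OF c] L1_locD(1)[OF has_ac_derivativeD(1)[OF v]] by auto
  have [measurable]: "weak_deriv v \<in> borel_measurable borel"
    using L1_locD(1)[OF has_ac_derivativeD(1)[OF has_ac_derivative_weak_deriv(1)[OF v]]] .
  have "(\<lambda>x. (norm (v x))\<^sup>2) \<in> L1_loc" by (intro L1_loc_continuous continuous_intros c)
  then have "v \<in> L2_loc" by (simp add: L2_loc_def L1_loc_def)
  moreover have "p \<in> L2_loc" using integrable_imp_L1_loc[OF p2] by (simp add: L2_loc_def L1_loc_def)
  ultimately have "v \<in> H1_loc" unfolding H1_loc_def using has_ac_imp_has_weak_derivative[OF v] by blast
  moreover have "integrable lborel (\<lambda>x. (cmod (weak_deriv v x))\<^sup>2)"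
  proof (rule integrable_cong_AE_imp[OF p2])
    show "AE x in lborel. (cmod (p x))\<^sup>2 = (cmod (weak_deriv v x))\<^sup>2"
      using has_ac_derivative_weak_deriv(2)[OF v] by eventually_elim simp
  qed simp
  ultimately show ?thesis using c e2 by (simp add: energy_space_def L2_def)
qed

text \<open>Testing with \<psi> z, for a real test function \<psi> and a fixed complex z, reduces
  the weak form to a weak derivative identity for the flux. W is the continuous representative of
  the flux.\<close>

lemma TW_weak_solutionD:
  assumes TW: "TW_weak_solution c \<kappa> v"
  obtains p W where "has_ac_derivative v p"
    "integrable lborel (\<lambda>x. (cmod (p x))\<^sup>2)" "integrable lborel (\<lambda>x. (1 - (cmod (v x))\<^sup>2)\<^sup>2)"
    "has_ac_derivative W (\<lambda>x. - TW_source c \<kappa> (v x) (p x))"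
    "AE x in lborel. W x = TW_flux \<kappa> (v x) (p x)"
proof -
  have v: "v \<in> energy_space" using TW by (simp add: TW_weak_solution_def)
  define p where "p = weak_deriv v"
  note vc = energy_spaceD(1)[OF v] and vp = energy_spaceD(2)[OF v, folded p_def]
    and p2 = energy_spaceD(3)[OF v, folded p_def] and e2 = energy_spaceD(4)[OF v]
  note pL = has_ac_derivativeD(1)[OF vp]
  note L = TW_L1_loc[OF vc pL p2]
  have [measurable]: "v \<in> borel_measurable borel" "p \<in> borel_measurable borel"
    using borel_measurable_continuous_onI[OF vc] L1_locD(1)[OF pL] by auto
  have key: "(LINT x|lborel. \<psi> x *\<^sub>R TW_source c \<kappa> (v x) (p x)) \<bullet> z =
      (LINT x|lborel. vector_derivative \<psi> (at x) *\<^sub>R TW_flux \<kappa> (v x) (p x)) \<bullet> z"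
    if \<psi>: "\<psi> \<in> test_functions" for \<psi> :: "real \<Rightarrow> real" and z :: complex
  proof -
    define \<phi> where "\<phi> = (\<lambda>x. \<psi> x *\<^sub>R z)"
    have s\<psi>: "smooth \<psi>" and c\<psi>: "compactly_supported \<psi>" using \<psi> by (auto simp: test_functions_def)
    obtain M where M: "\<And>x. \<bar>x\<bar> \<ge> M \<Longrightarrow> \<psi> x = 0" by (rule compactly_supportedE[OF c\<psi>]) (rule that; assumption)
    have \<phi>: "\<phi> \<in> test_functions"
      unfolding test_functions_def \<phi>_def
      by (auto intro!: smooth_scaleR_left s\<psi> compactly_supportedI[of "-M" M] M)
    have d\<phi>: "vector_derivative \<phi> (at x) = vector_derivative \<psi> (at x) *\<^sub>R z" for x
      unfolding \<phi>_def
      by (intro vector_derivative_at bounded_linear.has_vector_derivative[OF bounded_linear_scaleR_left]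
        smooth_has_vector_derivative s\<psi>)
    note ac\<phi> = test_function_has_ac_derivative[OF \<phi>]
    note acv\<phi> = has_ac_derivative_inner[OF vp ac\<phi>]
    have [measurable]: "\<phi> \<in> borel_measurable borel" "(\<lambda>x. vector_derivative \<phi> (at x)) \<in> borel_measurable borel"
      using borel_measurable_continuous_onI[OF has_ac_derivative_continuous_on[OF ac\<phi>]]
        L1_locD(1)[OF has_ac_derivativeD(1)[OF ac\<phi>]] by auto
    have [measurable]: "weak_deriv (\<lambda>y. v y \<bullet> \<phi> y) \<in> borel_measurable borel"
      using L1_locD(1)[OF has_ac_derivativeD(1)[OF has_ac_derivative_weak_deriv(1)[OF acv\<phi>]]] .
    have [measurable]: "(\<lambda>x. TW_source c \<kappa> (v x) (p x)) \<in> borel_measurable borel"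
      "(\<lambda>x. TW_flux \<kappa> (v x) (p x)) \<in> borel_measurable borel" using L1_locD(1) L by auto
    have "0 = (LINT x|lborel. (\<i> * complex_of_real c * p x
             + v x * complex_of_real (1 - (cmod (v x))\<^sup>2)) \<bullet> \<phi> x
        - p x \<bullet> vector_derivative \<phi> (at x)
        + 2 * \<kappa> * (v x \<bullet> p x) * weak_deriv (\<lambda>y. v y \<bullet> \<phi> y) x)"
      using TW \<phi> by (simp add: TW_weak_solution_def p_def)
    also have "\<dots> = (LINT x|lborel. TW_source c \<kappa> (v x) (p x) \<bullet> \<phi> x - TW_flux \<kappa> (v x) (p x) \<bullet> vector_derivative \<phi> (at x))"
    proof (rule integral_cong_AE)
      show "AE x in lborel. (\<i> * complex_of_real c * p x
             + v x * complex_of_real (1 - (cmod (v x))\<^sup>2)) \<bullet> \<phi> x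
        - p x \<bullet> vector_derivative \<phi> (at x)
        + 2 * \<kappa> * (v x \<bullet> p x) * weak_deriv (\<lambda>y. v y \<bullet> \<phi> y) x =
        TW_source c \<kappa> (v x) (p x) \<bullet> \<phi> x - TW_flux \<kappa> (v x) (p x) \<bullet> vector_derivative \<phi> (at x)"
        using has_ac_derivative_weak_deriv(2)[OF acv\<phi>] by eventually_elim (simp only: TW_pointwise)
    qed measurable
    also have "\<dots> = (LINT x|lborel. (\<psi> x *\<^sub>R TW_source c \<kappa> (v x) (p x)) \<bullet> z
       - (vector_derivative \<psi> (at x) *\<^sub>R TW_flux \<kappa> (v x) (p x)) \<bullet> z)"
      by (simp only: d\<phi>) (simp add: \<phi>_def)
    also have "\<dots> = (LINT x|lborel. \<psi> x *\<^sub>R TW_source c \<kappa> (v x) (p x)) \<bullet> z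
       - (LINT x|lborel. vector_derivative \<psi> (at x) *\<^sub>R TW_flux \<kappa> (v x) (p x)) \<bullet> z"
      using test_function_integrable(2)[OF \<psi> L(2)] test_function_integrable(3)[OF \<psi> L(1)]
      by (simp del: inner_scaleR_left)
    finally show ?thesis by simp
  qed
  have "has_weak_derivative (\<lambda>x. TW_flux \<kappa> (v x) (p x)) (\<lambda>x. - TW_source c \<kappa> (v x) (p x))"
    unfolding has_weak_derivative_def
  proof (intro conjI ballI L L1_loc_minus)
    fix \<psi> :: "real \<Rightarrow> real" assume \<psi>: "\<psi> \<in> test_functions"
    let ?a = "LINT x|lborel. \<psi> x *\<^sub>R TW_source c \<kappa> (v x) (p x)"
    let ?b = "LINT x|lborel. vector_derivative \<psi> (at x) *\<^sub>R TW_flux \<kappa> (v x) (p x)"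
    \<comment> \<open>Both vectors have the same inner product with every z; here z is their
      difference.\<close>
    have "(?a - ?b) \<bullet> (?a - ?b) = 0" using key[OF \<psi>] by (simp add: inner_diff_left)
    then have "?b = ?a" by simp
    then show "?b = - (LINT x|lborel. \<psi> x *\<^sub>R - TW_source c \<kappa> (v x) (p x))" by simp
  qed
  then obtain W where W: "has_ac_derivative W (\<lambda>x. - TW_source c \<kappa> (v x) (p x))"
    "AE x in lborel. TW_flux \<kappa> (v x) (p x) = W x"
    using has_weak_imp_has_ac_derivative by blast
  have "AE x in lborel. W x = TW_flux \<kappa> (v x) (p x)" using W(2) by eventually_elim simp
  then show ?thesis using that[OF vp p2 e2 W(1)] by blast
qed

text \<open>By \<open>TW_pointwise\<close> the integrand is, almost everywhere, minus the derivative
  of \<langle>W, \<phi>\<rangle>, which has compact support and therefore integral zero.\<close>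

lemma TW_weak_solutionI:
  assumes vp: "has_ac_derivative v p"
    and p2: "integrable lborel (\<lambda>x. (cmod (p x))\<^sup>2)" and e2: "integrable lborel (\<lambda>x. (1 - (cmod (v x))\<^sup>2)\<^sup>2)"
    and W: "has_ac_derivative W (\<lambda>x. - TW_source c \<kappa> (v x) (p x))"
    and Wp: "AE x in lborel. W x = TW_flux \<kappa> (v x) (p x)"
  shows "TW_weak_solution c \<kappa> v"
  unfolding TW_weak_solution_def
proof (intro conjI ballI energy_spaceI[OF vp p2 e2])
  fix \<phi> :: "real \<Rightarrow> complex" assume \<phi>: "\<phi> \<in> test_functions"
  have vc: "continuous_on UNIV v" using has_ac_derivative_continuous_on[OF vp] .
  note pL = has_ac_derivativeD(1)[OF vp]
  note L = TW_L1_loc[OF vc pL p2]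
  note ac\<phi> = test_function_has_ac_derivative[OF \<phi>]
  note acv\<phi> = has_ac_derivative_inner[OF vp ac\<phi>]
  note acW = has_ac_derivative_inner[OF W ac\<phi>]
  obtain M where M: "M > 0" "\<And>x. \<bar>x\<bar> \<ge> M \<Longrightarrow> \<phi> x = 0" "\<And>x. \<bar>x\<bar> \<ge> M \<Longrightarrow> vector_derivative \<phi> (at x) = 0"
    "smooth \<phi>" "continuous_on UNIV \<phi>" "continuous_on UNIV (\<lambda>x. vector_derivative \<phi> (at x))"
    by (rule test_functionsE[OF \<phi>]) (rule that; assumption)
  have Wz: "(LINT x|lborel. W x \<bullet> vector_derivative \<phi> (at x) + - TW_source c \<kappa> (v x) (p x) \<bullet> \<phi> x) = 0"
    by (rule has_ac_derivative_integral_zero[OF acW M(1)]) (simp_all add: M)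
  have [measurable]: "v \<in> borel_measurable borel" "p \<in> borel_measurable borel"
    using borel_measurable_continuous_onI[OF vc] L1_locD(1)[OF pL] by auto
  have [measurable]: "W \<in> borel_measurable borel"
    using borel_measurable_continuous_onI[OF has_ac_derivative_continuous_on[OF W]] .
  have [measurable]: "\<phi> \<in> borel_measurable borel" "(\<lambda>x. vector_derivative \<phi> (at x)) \<in> borel_measurable borel"
    using borel_measurable_continuous_onI[OF has_ac_derivative_continuous_on[OF ac\<phi>]]
      L1_locD(1)[OF has_ac_derivativeD(1)[OF ac\<phi>]] by auto
  have [measurable]: "weak_deriv (\<lambda>y. v y \<bullet> \<phi> y) \<in> borel_measurable borel" "weak_deriv v \<in> borel_measurable borel"
    using L1_locD(1)[OF has_ac_derivativeD(1)[OF has_ac_derivative_weak_deriv(1)[OF acv\<phi>]]]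
      L1_locD(1)[OF has_ac_derivativeD(1)[OF has_ac_derivative_weak_deriv(1)[OF vp]]] .
  have [measurable]: "(\<lambda>x. TW_source c \<kappa> (v x) (p x)) \<in> borel_measurable borel" using L1_locD(1) L by auto
  have "(LINT x|lborel. (\<i> * complex_of_real c * weak_deriv v x
             + v x * complex_of_real (1 - (cmod (v x))\<^sup>2)) \<bullet> \<phi> x
        - weak_deriv v x \<bullet> vector_derivative \<phi> (at x)
        + 2 * \<kappa> * (v x \<bullet> weak_deriv v x) * weak_deriv (\<lambda>y. v y \<bullet> \<phi> y) x) =
      (LINT x|lborel. - (W x \<bullet> vector_derivative \<phi> (at x) + - TW_source c \<kappa> (v x) (p x) \<bullet> \<phi> x))"
  proof (rule integral_cong_AE)
    show "AE x in lborel. (\<i> * complex_of_real c * weak_deriv v x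
             + v x * complex_of_real (1 - (cmod (v x))\<^sup>2)) \<bullet> \<phi> x
        - weak_deriv v x \<bullet> vector_derivative \<phi> (at x)
        + 2 * \<kappa> * (v x \<bullet> weak_deriv v x) * weak_deriv (\<lambda>y. v y \<bullet> \<phi> y) x =
        - (W x \<bullet> vector_derivative \<phi> (at x) + - TW_source c \<kappa> (v x) (p x) \<bullet> \<phi> x)"
      using has_ac_derivative_weak_deriv(2)[OF acv\<phi>] has_ac_derivative_weak_deriv(2)[OF vp] Wp
    proof eventually_elim
      case (elim x)
      show ?case unfolding elim TW_pointwise by simp
    qed
  qed measurable
  also have "\<dots> = 0" using Wz by (simp only: integral_minus minus_zero)
  finally show "(LINT x|lborel. (\<i> * complex_of_real c * weak_deriv v x
             + v x * complex_of_real (1 - (cmod (v x))\<^sup>2)) \<bullet> \<phi> x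
        - weak_deriv v x \<bullet> vector_derivative \<phi> (at x)
        + 2 * \<kappa> * (v x \<bullet> weak_deriv v x) * weak_deriv (\<lambda>y. v y \<bullet> \<phi> y) x) = 0" .
qed


section \<open>Parametrisation of the profile\<close>

text \<open>The majorant has integral \<Psi>(n) - \<Psi>(-n) \<le> 2B over [-n, n], so monotone
  convergence applies. It serves for a majorant that is infinite at the ends of the core but has an
  explicit bounded primitive.\<close>

lemma integrable_of_bounded_antiderivative:
  fixes f \<psi> \<Psi> :: "real \<Rightarrow> real"
  assumes S: "finite S" and [measurable]: "f \<in> borel_measurable borel" "\<psi> \<in> borel_measurable borel"
    and \<Psi>: "continuous_on UNIV \<Psi>" "\<And>x. x \<notin> S \<Longrightarrow> (\<Psi> has_real_derivative \<psi> x) (at x)"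
    and le: "\<And>x. x \<notin> S \<Longrightarrow> \<bar>f x\<bar> \<le> \<psi> x" and B: "\<And>x. \<bar>\<Psi> x\<bar> \<le> B"
  shows "integrable lborel f"
proof -
  \<comment> \<open>Nothing is assumed about \<psi> on S; the value 0 there makes g nonnegative
    everywhere.\<close>
  define g where "g x = (if x \<in> S then 0 else \<psi> x)" for x
  have Sb: "S \<in> sets borel" using S by (simp add: borel_closed finite_imp_closed)
  then have [measurable]: "g \<in> borel_measurable borel" unfolding g_def by measurable
  have g0: "0 \<le> g x" for x using le[of x] by (auto simp: g_def)
  have hi: "(g has_integral (\<Psi> b - \<Psi> a)) {a..b}" if "a \<le> b" for a b
    by (rule fundamental_theorem_of_calculus_strong[OF S that])
      (use \<Psi>(2) continuous_on_subset[OF \<Psi>(1)] in \<open>auto simp: g_def has_real_derivative_iff_has_vector_derivative\<close>)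
  have bi: "has_bochner_integral lborel (\<lambda>x. indicator {a..b} x * g x) (\<Psi> b - \<Psi> a)" if "a \<le> b" for a b
  proof -
    have ind: "(\<lambda>x. indicator {a..b} x * g x) = (\<lambda>x. if x \<in> {a..b} then g x else 0)"
      by (auto simp: fun_eq_iff)
    have "((\<lambda>x. indicator {a..b} x * g x) has_integral (\<Psi> b - \<Psi> a)) UNIV"
      unfolding ind has_integral_restrict_UNIV by (rule hi[OF that])
    then have "integral\<^sup>N lborel (\<lambda>x. ennreal (indicator {a..b} x * g x)) = ennreal (\<Psi> b - \<Psi> a)"
      by (intro nn_integral_has_integral_lborel) (auto simp: g0)
    moreover have "0 \<le> \<Psi> b - \<Psi> a" using has_integral_nonneg[OF hi[OF that]] g0 by simp
    ultimately show ?thesis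
      by (intro has_bochner_integral_nn_integral) (auto simp: g0)
  qed
  have "integrable lborel g"
  proof -
    let ?f = "\<lambda>(n::nat) x. indicator {- real n..real n} x * g x"
    have eq: "integral\<^sup>L lborel (?f n) = \<Psi> (real n) - \<Psi> (- real n)" for n
      using bi[of "- real n" "real n"] by (auto simp: has_bochner_integral_iff)
    have "\<exists>L. (\<lambda>n. \<Psi> (real n) - \<Psi> (- real n)) \<longlonglongrightarrow> L"
    proof (rule Bseq_mono_convergent[unfolded convergent_def])
      show "Bseq (\<lambda>n. \<Psi> (real n) - \<Psi> (- real n))"
      proof (rule BseqI'[of _ "2 * B"])
        show "norm (\<Psi> (real n) - \<Psi> (- real n)) \<le> 2 * B" for n
          using B[of "real n"] B[of "- real n"] by simp
      qed
      have m: "\<Psi> a \<le> \<Psi> b" if "a \<le> b" for a b using has_integral_nonneg[OF hi[OF that]] g0 by simp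
      show "\<forall>n k. n \<le> k \<longrightarrow> \<Psi> (real n) - \<Psi> (- real n) \<le> \<Psi> (real k) - \<Psi> (- real k)"
        by (intro allI impI diff_mono m) auto
    qed
    then obtain L where "(\<lambda>n. integral\<^sup>L lborel (?f n)) \<longlonglongrightarrow> L" unfolding eq by blast
    show ?thesis
    proof (rule integrable_monotone_convergence)
      show "(\<lambda>n. integral\<^sup>L lborel (?f n)) \<longlonglongrightarrow> L" by fact
      show "integrable lborel (?f n)" for n using bi[of "- real n" "real n"] by (auto simp: has_bochner_integral_iff)
      show "AE x in lborel. mono (\<lambda>n. ?f n x)"
        by (intro AE_I2 monoI mult_right_mono g0) (auto simp: indicator_def)
      show "AE x in lborel. (\<lambda>n. ?f n x) \<longlonglongrightarrow> g x"
      proof (intro AE_I2)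
        fix x
        obtain N where N: "\<bar>x\<bar> \<le> real N" using real_arch_simple by blast
        have "?f n x = g x" if "n \<ge> N" for n using N that by (auto simp: indicator_def)
        then show "(\<lambda>n. ?f n x) \<longlonglongrightarrow> g x"
          by (intro tendsto_eventually) (auto simp: eventually_sequentially)
      qed
    qed simp
  qed
  then show ?thesis
  proof (rule Bochner_Integration.integrable_bound)
    have "AE x in lborel. x \<notin> S" using S finite_imp_null_set_lborel AE_not_in by blast
    then show "AE x in lborel. norm (f x) \<le> norm (g x)"
      by eventually_elim (use le in \<open>force simp: g_def\<close>)
  qed simp
qed

text \<open>The derivative of m = (1 - 2\<kappa>(1 - y)) y' along a solution, with e = y'. The
  fraction is -2\<bar>u'\<bar>^2, where \<bar>u'\<bar>^2 has been eliminated by means of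
  \<langle>\<i>u, u'\<rangle> = c y/2.\<close>

definition TW_rhs :: "real \<Rightarrow> real \<Rightarrow> real \<Rightarrow> real \<Rightarrow> real" where
  "TW_rhs c \<kappa> y e = - (e\<^sup>2 + c\<^sup>2 * y\<^sup>2) / (2 * (1 - y)) + 2 * \<kappa> * e\<^sup>2 - c\<^sup>2 * y + 2 * (1 - y) * y"

text \<open>In the locale below \<open>edge\<close> is the value of \<open>1 - \<bar>u\<bar>\<^sup>2\<close> on \<open>\<Gamma> \<kappa> u\<close>. The first
  integral \<open>(1 - 2\<kappa>(1 - y)) y'\<^sup>2 = y\<^sup>2 (2 - c\<^sup>2 - 2y) + K (1 - y)\<close> has \<open>K = 0\<close> outside the
  core and \<open>K = K\<^sub>0\<close>, making the right-hand side \<open>-(y - \<eta>\<^sub>0) Q y\<close>, inside. The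
  parameter is \<open>t = \<plusminus>sqrt (y - \<eta>\<^sub>0)\<close> in the core, and outside it \<open>\<bar>t\<bar> - radius = - ln (y / edge)\<close>;
  \<open>speed\<close> is \<open>dx/dt\<close>. For \<open>\<kappa> = 1/2\<close> we have \<open>edge = 0\<close>, the ratio is \<open>x / 0 = 0\<close>, and the outer part is trivial.\<close>

locale TW_profile =
  fixes c \<kappa> \<eta>\<^sub>0 :: real
  assumes \<kappa>_pos: "0 < \<kappa>" and ratio_nonneg: "0 \<le> (2 - c\<^sup>2) / (1 - 2 * \<kappa>)"
    and \<eta>\<^sub>0_less: "\<eta>\<^sub>0 < - (1 + 2 * \<kappa> + c\<^sup>2 + 1 / (2 * \<kappa>))"
begin

definition "edge = 1 - 1 / (2 * \<kappa>)"
definition "radius = sqrt (edge - \<eta>\<^sub>0)"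
definition "K\<^sub>0 = - (\<eta>\<^sub>0\<^sup>2 * (2 - c\<^sup>2 - 2 * \<eta>\<^sub>0)) / (1 - \<eta>\<^sub>0)"
definition "Q y = - (2 - c\<^sup>2) * (y + \<eta>\<^sub>0) + 2 * (y\<^sup>2 + y * \<eta>\<^sub>0 + \<eta>\<^sub>0\<^sup>2) + K\<^sub>0"
definition "Q' y = - (2 - c\<^sup>2) + 2 * (2 * y + \<eta>\<^sub>0)"
text \<open>The argument is the ratio of the profile to \<open>edge\<close>, that is, the value of
  \<open>tail\<close>. For \<kappa> \<noteq> 1/2 this is (2 - c^2 - 2 edge y)/(1 - 2\<kappa>),
  arranged so that it is positive for y > 0 at \<kappa> = 1/2 as well.\<close>

definition "r y = (2 - c\<^sup>2) / (1 - 2 * \<kappa>) + y / \<kappa>"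
text \<open>With clamped parameters \<open>E\<close>, \<open>speed\<close> and \<open>mom\<close>
  are single closed formulas on the whole line in which the inactive parts are constant, so
  continuity across \<bar>t\<bar> = radius follows from the usual rules.\<close>

definition "clip t = max (- radius) (min t radius)"
definition "tail t = exp (- (max t radius - radius))"
definition "E t = \<eta>\<^sub>0 + (clip t)\<^sup>2 + edge * (tail t - 1) + edge * (tail (- t) - 1)"
definition "E' t = (if \<bar>t\<bar> < radius then 2 * t else 0) - (if t > radius then edge * tail t else 0)
   + (if t < - radius then edge * tail (- t) else 0)"
text \<open>This is (dy/dt)/(dy/dx), with dy/dx from the first integral and the common factor t,
  respectively \<open>edge * tail t\<close>, cancelled. The zeros at \<bar>t\<bar> = radius encode
  the blow-up of y'.\<close>

definition "speed t = 2 * sqrt (2 * \<kappa> * (radius\<^sup>2 - (clip t)\<^sup>2) / Q (\<eta>\<^sub>0 + (clip t)\<^sup>2))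
   + sqrt ((1 - tail t) / r (tail t)) + sqrt ((1 - tail (- t)) / r (tail (- t)))"
text \<open>The product (1 - 2\<kappa>(1 - y)) y' of \<open>mom_eq\<close>, with the zero of the
  weight at \<bar>t\<bar> = radius already cancelled against the infinite slope, so that continuity
  is visible.\<close>

definition "mom t = - (clip t * sqrt (2 * \<kappa> * (radius\<^sup>2 - (clip t)\<^sup>2) * Q (\<eta>\<^sub>0 + (clip t)\<^sup>2)))
   - (1 - 2 * \<kappa>) * edge * tail t * sqrt ((1 - tail t) * r (tail t))
   + (1 - 2 * \<kappa>) * edge * tail (- t) * sqrt ((1 - tail (- t)) * r (tail (- t)))"

section \<open>Signs, symmetries and continuity of the profile functions\<close>

lemma inv_\<kappa>_pos: "0 < 1 / (2 * \<kappa>)" using \<kappa>_pos by simp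

lemma \<eta>\<^sub>0_neg: "\<eta>\<^sub>0 < - 1" "\<eta>\<^sub>0 < edge"
  using \<eta>\<^sub>0_less inv_\<kappa>_pos \<kappa>_pos zero_le_power2[of c] unfolding edge_def by linarith+

lemma edge_less_1: "edge < 1" using inv_\<kappa>_pos by (simp add: edge_def)

lemma edge_\<kappa>: "2 * \<kappa> * edge = 2 * \<kappa> - 1" using \<kappa>_pos by (simp add: edge_def field_simps)

lemma radius_pos: "0 < radius" using \<eta>\<^sub>0_neg by (simp add: radius_def)

lemma radius_sq: "radius\<^sup>2 = edge - \<eta>\<^sub>0" using \<eta>\<^sub>0_neg by (simp add: radius_def)

lemma K\<^sub>0_eq: "K\<^sub>0 * (1 - \<eta>\<^sub>0) = - (\<eta>\<^sub>0\<^sup>2 * (2 - c\<^sup>2 - 2 * \<eta>\<^sub>0))"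
  using \<eta>\<^sub>0_neg by (simp add: K\<^sub>0_def)

lemma K\<^sub>0_neg: "K\<^sub>0 < 0"
proof -
  have "0 < 2 - c\<^sup>2 - 2 * \<eta>\<^sub>0"
    using \<eta>\<^sub>0_less inv_\<kappa>_pos \<kappa>_pos zero_le_power2[of c] by linarith
  then have "0 < \<eta>\<^sub>0\<^sup>2 * (2 - c\<^sup>2 - 2 * \<eta>\<^sub>0)" using \<eta>\<^sub>0_neg by (intro mult_pos_pos) auto
  then show ?thesis using \<eta>\<^sub>0_neg by (simp add: K\<^sub>0_def divide_neg_pos)
qed

text \<open>Multiplication by 1 - \<open>\<eta>\<^sub>0\<close> removes the denominator of
  \<open>K\<^sub>0\<close> and leaves 2(1 + n) y^2 + b (n - (1 + n) y) with n =
  -\<open>\<eta>\<^sub>0\<close>. Up to \<open>edge\<close> the bracket is positive because 1 + n >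
  2\<kappa>, and b > 0 because 2n exceeds c^2.\<close>

lemma Q_pos: assumes "y \<le> edge" shows "0 < Q y"
proof -
  define n b where "n = - \<eta>\<^sub>0" and "b = 2 * n + 2 - c\<^sup>2"
  have n: "n > 1 + 2 * \<kappa> + c\<^sup>2 + 1 / (2 * \<kappa>)" using \<eta>\<^sub>0_less by (simp add: n_def)
  have b: "b > 0" unfolding b_def using n \<kappa>_pos inv_\<kappa>_pos zero_le_power2[of c] by linarith
  have n0: "n > 0" "1 + n > 2 * \<kappa>" using n \<kappa>_pos inv_\<kappa>_pos zero_le_power2[of c] by linarith+
  have "(1 - \<eta>\<^sub>0) * Q y = (1 - \<eta>\<^sub>0) * (- (2 - c\<^sup>2) * (y + \<eta>\<^sub>0) + 2 * (y\<^sup>2 + y * \<eta>\<^sub>0 + \<eta>\<^sub>0\<^sup>2)) + K\<^sub>0 * (1 - \<eta>\<^sub>0)"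
    by (simp add: Q_def algebra_simps)
  also have "\<dots> = 2 * (1 + n) * y\<^sup>2 + b * (n - (1 + n) * y)"
    unfolding K\<^sub>0_eq by (simp add: n_def b_def algebra_simps power2_eq_square)
  finally have eq: "(1 - \<eta>\<^sub>0) * Q y = 2 * (1 + n) * y\<^sup>2 + b * (n - (1 + n) * y)" .
  have "(1 + n) * y < n"
  proof (cases "y \<le> 0")
    case True
    then have "(1 + n) * y \<le> 0" using n0 by (intro mult_nonneg_nonpos) auto
    then show ?thesis using n0 by linarith
  next
    case False
    have "(1 + n) * y \<le> (1 + n) * (1 - 1 / (2 * \<kappa>))"
      using assms n0 by (intro mult_left_mono) (auto simp: edge_def)
    also have "\<dots> = 1 + n - (1 + n) / (2 * \<kappa>)" by (simp add: algebra_simps)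
    also have "\<dots> < n"
      using n0 \<kappa>_pos by (simp add: field_simps)
    finally show ?thesis .
  qed
  then have "0 < b * (n - (1 + n) * y)" using b by simp
  moreover have "0 \<le> 2 * (1 + n) * y\<^sup>2" using n0 by simp
  ultimately have "0 < (1 - \<eta>\<^sub>0) * Q y" unfolding eq by linarith
  then show ?thesis using \<eta>\<^sub>0_neg by (simp add: zero_less_mult_iff)
qed

lemma r_pos: "0 < y \<Longrightarrow> 0 < r y" and r_ge: "y / \<kappa> \<le> r y"
  using ratio_nonneg \<kappa>_pos by (auto simp: r_def intro!: add_nonneg_pos)

lemma tail_props: "0 < tail t" "tail t \<le> 1" "tail t < 1 \<longleftrightarrow> radius < t"
  by (auto simp: tail_def)

lemma clip_props: "- radius \<le> clip t" "clip t \<le> radius" "(clip t)\<^sup>2 \<le> radius\<^sup>2"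
proof -
  show a: "- radius \<le> clip t" "clip t \<le> radius" using radius_pos by (auto simp: clip_def)
  then have "\<bar>clip t\<bar> \<le> radius" by auto
  from power_mono[OF this, of 2] show "(clip t)\<^sup>2 \<le> radius\<^sup>2" by simp
qed

lemma core_simps: 
  assumes "\<bar>t\<bar> \<le> radius"
  shows "clip t = t" "tail t = 1" "tail (- t) = 1"
    "E t = \<eta>\<^sub>0 + t\<^sup>2" "speed t = 2 * sqrt (2 * \<kappa> * (radius\<^sup>2 - t\<^sup>2) / Q (\<eta>\<^sub>0 + t\<^sup>2))"
    "mom t = - (t * sqrt (2 * \<kappa> * (radius\<^sup>2 - t\<^sup>2) * Q (\<eta>\<^sub>0 + t\<^sup>2)))"
proof -
  show *: "clip t = t" "tail t = 1" "tail (- t) = 1"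
    using assms by (auto simp: clip_def tail_def max_def min_def)
  show "E t = \<eta>\<^sub>0 + t\<^sup>2" "speed t = 2 * sqrt (2 * \<kappa> * (radius\<^sup>2 - t\<^sup>2) / Q (\<eta>\<^sub>0 + t\<^sup>2))"
    "mom t = - (t * sqrt (2 * \<kappa> * (radius\<^sup>2 - t\<^sup>2) * Q (\<eta>\<^sub>0 + t\<^sup>2)))"
    unfolding E_def speed_def mom_def * by simp_all
qed

lemma outer_simps: 
  assumes "radius \<le> t"
  shows "clip t = radius" "tail t = exp (radius - t)" "tail (- t) = 1"
    "E t = edge * tail t" "speed t = sqrt ((1 - tail t) / r (tail t))"
    "mom t = - (1 - 2 * \<kappa>) * edge * tail t * sqrt ((1 - tail t) * r (tail t))"
proof -
  show *: "clip t = radius" "tail t = exp (radius - t)" "tail (- t) = 1"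
    using assms radius_pos by (auto simp: clip_def tail_def max_def min_def)
  show "E t = edge * tail t" "speed t = sqrt ((1 - tail t) / r (tail t))"
    "mom t = - (1 - 2 * \<kappa>) * edge * tail t * sqrt ((1 - tail t) * r (tail t))"
    unfolding E_def speed_def mom_def *(1,3) by (simp_all add: radius_sq algebra_simps)
qed

lemma clip_minus: "clip (- t) = - clip t"
  using radius_pos by (auto simp: clip_def max_def min_def)

lemma reflection:
  "E (- t) = E t" "E' (- t) = - E' t" "speed (- t) = speed t" "mom (- t) = - mom t"
  by (simp_all add: E_def E'_def speed_def mom_def clip_minus)

lemma Q_core_pos: "0 < Q (\<eta>\<^sub>0 + (clip t)\<^sup>2)"
  using clip_props(3)[of t] by (intro Q_pos) (simp add: radius_sq)

lemma continuous_clip: "continuous_on UNIV clip" and continuous_tail: "continuous_on UNIV tail"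
  unfolding clip_def tail_def by (intro continuous_intros)+

lemma continuous_tail': "continuous_on UNIV (\<lambda>t. tail (- t))"
  unfolding tail_def by (intro continuous_intros)+

lemma continuous_profile_functions:
  "continuous_on UNIV E" "continuous_on UNIV speed" "continuous_on UNIV mom"
proof -
  note c = continuous_clip continuous_tail continuous_tail'
  have nz: "Q (\<eta>\<^sub>0 + (clip t)\<^sup>2) \<noteq> 0" "r (tail t) \<noteq> 0" for t
    using Q_core_pos[of t] r_pos[OF tail_props(1), of t] by auto
  have rc: "continuous_on UNIV (\<lambda>t. r (tail t))" "continuous_on UNIV (\<lambda>t. r (tail (- t)))"
    and Qc: "continuous_on UNIV (\<lambda>t. Q (\<eta>\<^sub>0 + (clip t)\<^sup>2))"
    unfolding r_def Q_def divide_inverse by (intro continuous_intros c)+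
  show "continuous_on UNIV E" "continuous_on UNIV speed" "continuous_on UNIV mom"
    unfolding E_def speed_def mom_def using nz
    by (intro continuous_intros c rc Qc; blast)+
qed

lemma speed_nonneg: "0 \<le> speed t"
proof -
  have "0 \<le> 2 * \<kappa> * (radius\<^sup>2 - (clip t)\<^sup>2) / Q (\<eta>\<^sub>0 + (clip t)\<^sup>2)"
    using Q_core_pos[of t] clip_props(3)[of t] \<kappa>_pos by simp
  moreover have "0 \<le> (1 - tail s) / r (tail s)" for s
    using r_pos[OF tail_props(1), of s] tail_props(2)[of s] by simp
  ultimately show ?thesis unfolding speed_def by simp
qed

lemma speed_pos_iff: "0 < speed t \<longleftrightarrow> \<bar>t\<bar> \<noteq> radius"
proof -
  consider "\<bar>t\<bar> < radius" | "\<bar>t\<bar> = radius" | "t > radius" | "t < - radius" by linarith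
  then show ?thesis
  proof cases
    case 1
    then have "t\<^sup>2 < radius\<^sup>2" using power_strict_mono[of "\<bar>t\<bar>" radius 2] by simp
    then show ?thesis using 1 \<kappa>_pos Q_pos[of "\<eta>\<^sub>0 + t\<^sup>2"] by (simp add: core_simps radius_sq)
  next
    case 2
    then have "t\<^sup>2 = radius\<^sup>2" by (metis power2_abs)
    then show ?thesis using 2 by (simp add: core_simps)
  next
    case 3
    then show ?thesis using radius_pos r_pos[OF tail_props(1), of t] tail_props(3)[of t] by (simp add: outer_simps)
  next
    case 4
    then show ?thesis using radius_pos r_pos[OF tail_props(1), of "- t"] tail_props(3)[of "- t"] outer_simps(5)[of "- t"]
      by (simp add: reflection)
  qed
qed

text \<open>With s = 1 for even and s = -1 for odd functions, statements for t > radius carry over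
  to t < -radius.\<close>

lemma has_derivative_reflect:
  fixes f g :: "real \<Rightarrow> real"
  assumes "(f has_real_derivative D) (at (- t))" "\<And>t. f (- t) = s * f t"
    and "s * s = 1"
  shows "(f has_real_derivative - (s * D)) (at t)"
proof -
  have "((\<lambda>x. f (- x)) has_real_derivative - D) (at t)"
    using assms(1) by (simp add: DERIV_mirror)
  from DERIV_cmult[OF this, of s] assms(3) show ?thesis
    by (simp add: assms(2) flip: mult.assoc)
qed

lemma E_has_derivative:
  assumes "\<bar>t\<bar> \<noteq> radius"
  shows "(E has_real_derivative E' t) (at t)"
proof -
  have outer: "(E has_real_derivative E' t) (at t)" if "t > radius" for t
  proof (rule has_field_derivative_transform_within_open[of "\<lambda>t. edge * exp (radius - t)" _ _ "{radius<..}"])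
    show "((\<lambda>t. edge * exp (radius - t)) has_real_derivative E' t) (at t)"
      using that radius_pos by (auto intro!: derivative_eq_intros simp: E'_def outer_simps)
  qed (use that in \<open>auto simp: outer_simps\<close>)
  consider "\<bar>t\<bar> < radius" | "t > radius" | "t < - radius" using assms by linarith
  then show ?thesis
  proof cases
    case 1
    show ?thesis
    proof (rule has_field_derivative_transform_within_open[of "\<lambda>t. \<eta>\<^sub>0 + t\<^sup>2" _ _ "{-radius<..<radius}"])
      show "((\<lambda>t. \<eta>\<^sub>0 + t\<^sup>2) has_real_derivative E' t) (at t)"
        using 1 by (auto intro!: derivative_eq_intros simp: E'_def)
    qed (use 1 in \<open>auto simp: core_simps\<close>)
  next
    case 2 then show ?thesis by (rule outer)
  next
    case 3
    then show ?thesis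
      using has_derivative_reflect[of E "E' (- t)" t 1] outer[of "- t"] by (simp add: reflection)
  qed
qed

lemma Q_has_derivative: "(Q has_real_derivative Q' y) (at y)"
  unfolding Q_def Q'_def by (auto intro!: derivative_eq_intros)

text \<open>The left side is (1 - y)^2 times the derivative of s Q(y)/(1 - y) with respect to y. In
  this quotient \<open>K\<^sub>0\<close> contributes only an additive constant, so it is absent on
  the right.\<close>

lemma core_identity:
  assumes "y = \<eta>\<^sub>0 + s"
  shows "(1 - y) * Q y + (1 - y) * s * Q' y + s * Q y = c\<^sup>2 * y\<^sup>2 + 2 * (1 - y) * c\<^sup>2 * y - 4 * (1 - y)\<^sup>2 * y"
proof -
  have "(1 - y) * Q y + (1 - y) * s * Q' y + s * Q y =
    (1 - y + s) * (- (2 - c\<^sup>2) * (y + \<eta>\<^sub>0) + 2 * (y\<^sup>2 + y * \<eta>\<^sub>0 + \<eta>\<^sub>0\<^sup>2)) + (1 - y) * s * Q' y + K\<^sub>0 * (1 - \<eta>\<^sub>0)"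
    unfolding Q_def using assms by (simp add: algebra_simps)
  also have "\<dots> = c\<^sup>2 * y\<^sup>2 + 2 * (1 - y) * c\<^sup>2 * y - 4 * (1 - y)\<^sup>2 * y"
    unfolding K\<^sub>0_eq Q'_def using assms by (simp add: algebra_simps power2_eq_square)
  finally show ?thesis .
qed

end


text \<open>With denominators cleared, the profile equation becomes a polynomial identity. The free
  d is the denominator of the squared slope, which differs between the core, the outer part and the
  general case d = 1.\<close>

lemma TW_rhs_cleared:
  assumes "e\<^sup>2 = N / d" "d > 0" "y < 1"
  shows "2 * (1 - y) * (d * TW_rhs c \<kappa> y e) =
    - (N + d * c\<^sup>2 * y\<^sup>2) + 2 * (1 - y) * (2 * \<kappa> * N - d * c\<^sup>2 * y + 2 * d * (1 - y) * y)"
proof -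
  have N: "N = d * e\<^sup>2" using assms by simp
  have "2 * (1 - y) * (d * TW_rhs c \<kappa> y e) = d * (2 * (1 - y) * (- (e\<^sup>2 + c\<^sup>2 * y\<^sup>2) / (2 * (1 - y)))) +
    2 * (1 - y) * d * (2 * \<kappa> * e\<^sup>2 - c\<^sup>2 * y + 2 * (1 - y) * y)"
    unfolding TW_rhs_def by (simp only: algebra_simps)
  also have "2 * (1 - y) * (- (e\<^sup>2 + c\<^sup>2 * y\<^sup>2) / (2 * (1 - y))) = - (e\<^sup>2 + c\<^sup>2 * y\<^sup>2)"
    using assms(3) by simp
  finally show ?thesis unfolding N by (simp add: algebra_simps)
qed

section \<open>The profile equation in the parameter\<close>

context TW_profile
begin

lemma core_first_integral:
  assumes "y = \<eta>\<^sub>0 + s"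
  shows "y\<^sup>2 * (2 - c\<^sup>2 - 2 * y) + K\<^sub>0 * (1 - y) = - (s * Q y)"
proof -
  have "y\<^sup>2 * (2 - c\<^sup>2 - 2 * y) + K\<^sub>0 * (1 - y) + s * Q y =
     y\<^sup>2 * (2 - c\<^sup>2 - 2 * y) + s * (- (2 - c\<^sup>2) * (y + \<eta>\<^sub>0) + 2 * (y\<^sup>2 + y * \<eta>\<^sub>0 + \<eta>\<^sub>0\<^sup>2)) + K\<^sub>0 * (1 - \<eta>\<^sub>0)"
    unfolding Q_def using assms by (simp add: algebra_simps)
  also have "\<dots> = 0"
    unfolding K\<^sub>0_eq using assms by (simp add: algebra_simps power2_eq_square)
  finally show ?thesis by linarith
qed

text \<open>Here -a is the weight 1 - 2\<kappa>(1 - y) and t^2 q / a is the squared slope. In the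
  form 2a / sqrt(a q) the speed shares its square root with \<open>mom\<close>.\<close>

lemma core_facts:
  assumes "\<bar>t\<bar> < radius"
  defines "a \<equiv> 2 * \<kappa> * (radius\<^sup>2 - t\<^sup>2)" and "q \<equiv> Q (\<eta>\<^sub>0 + t\<^sup>2)"
  shows "0 < a" "0 < q" "1 - 2 * \<kappa> * (1 - E t) = - a" "E t < edge"
    "speed t = 2 * a / sqrt (a * q)" "(E' t / speed t)\<^sup>2 = t\<^sup>2 * q / a"
proof -
  have t2: "t\<^sup>2 < radius\<^sup>2" using power_strict_mono[of "\<bar>t\<bar>" radius 2] assms by simp
  show a: "0 < a" using t2 \<kappa>_pos by (simp add: a_def)
  show q: "0 < q" using t2 Q_pos[of "\<eta>\<^sub>0 + t\<^sup>2"] by (simp add: q_def radius_sq)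
  have Et: "E t = \<eta>\<^sub>0 + t\<^sup>2" using assms by (simp add: core_simps)
  show "1 - 2 * \<kappa> * (1 - E t) = - a" "E t < edge"
    using edge_\<kappa> t2 by (auto simp: Et a_def radius_sq algebra_simps)
  have "sqrt (a / q) = a / sqrt (a * q)"
    using a q by (intro real_sqrt_unique) (simp_all add: power_divide power2_eq_square field_simps)
  then show sp: "speed t = 2 * a / sqrt (a * q)"
    using assms by (simp add: core_simps a_def q_def)
  have "E' t = 2 * t" using assms(1) by (auto simp: E'_def)
  then have "(E' t / speed t)\<^sup>2 = (2 * t)\<^sup>2 / (speed t)\<^sup>2"
    by (simp only: power_divide)
  also have "(speed t)\<^sup>2 = 4 * a / q"
    unfolding sp using a q by (simp add: power_divide power_mult_distrib power2_eq_square field_simps)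
  finally show "(E' t / speed t)\<^sup>2 = t\<^sup>2 * q / a" using a q by (simp add: power_mult_distrib)
qed

text \<open>The factor \<open>edge\<close> on both sides keeps the identity true at \<kappa> = 1/2,
  where it reads 0 = 0.\<close>

lemma edge_ratio: "edge * (1 - 2 * \<kappa>) * r y = edge * (2 - c\<^sup>2 - 2 * edge * y)"
proof (cases "\<kappa> = 1 / 2")
  case False
  then have "(1 - 2 * \<kappa>) * ((2 - c\<^sup>2) / (1 - 2 * \<kappa>)) = 2 - c\<^sup>2" by simp
  then have "(1 - 2 * \<kappa>) * r y = 2 - c\<^sup>2 + (1 - 2 * \<kappa>) / \<kappa> * y"
    unfolding r_def distrib_left by simp
  also have "(1 - 2 * \<kappa>) / \<kappa> = - 2 * edge" using \<kappa>_pos by (simp add: edge_def field_simps)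
  finally show ?thesis by (simp add: ac_simps)
qed (simp add: edge_def)

lemma outer_facts:
  assumes "radius < t"
  defines "y \<equiv> tail t"
  shows "0 < y" "y < 1" "0 < r y" "E t = edge * y"
    "speed t = (1 - y) / sqrt ((1 - y) * r y)" "(E' t / speed t)\<^sup>2 = edge\<^sup>2 * y\<^sup>2 * r y / (1 - y)"
proof -
  show y: "0 < y" "y < 1" using tail_props[of t] assms by (auto simp: y_def)
  then show ry: "0 < r y" by (simp add: r_pos)
  show "E t = edge * y" using assms by (simp add: outer_simps)
  have "sqrt ((1 - y) / r y) = (1 - y) / sqrt ((1 - y) * r y)"
    using y ry by (intro real_sqrt_unique) (simp_all add: power_divide power2_eq_square field_simps)
  then show sp: "speed t = (1 - y) / sqrt ((1 - y) * r y)"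
    using assms by (simp add: outer_simps)
  have "(E' t / speed t)\<^sup>2 = (edge * y)\<^sup>2 / (speed t)\<^sup>2"
    using assms radius_pos by (simp add: E'_def power_divide)
  also have "(speed t)\<^sup>2 = (1 - y) / r y"
    unfolding sp using y ry by (simp add: power_divide power_mult_distrib power2_eq_square field_simps)
  finally show "(E' t / speed t)\<^sup>2 = edge\<^sup>2 * y\<^sup>2 * r y / (1 - y)"
    using y ry by (simp add: power_mult_distrib)
qed

text \<open>R stands for \<open>r y\<close> and w for 1/\<kappa>. Once R is eliminated through
  \<open>rel\<close>, both sides are polynomials in y.\<close>

lemma outer_identity:
  assumes w: "\<kappa> * w = 1" and rel: "edge * (1 - 2 * \<kappa>) * R = edge * (2 - c\<^sup>2 - 2 * edge * y)"
  shows "2 * (1 - edge * y) * (- (1 - 2 * \<kappa>) * edge * (- y * (1 - y) * R + y\<^sup>2 * (R - (1 - y) * w) / 2)) =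
    - (edge\<^sup>2 * y\<^sup>2 * R + (1 - y) * c\<^sup>2 * (edge * y)\<^sup>2) + 2 * (1 - edge * y) * (2 * \<kappa> * edge\<^sup>2 * y\<^sup>2 * R
      - (1 - y) * c\<^sup>2 * (edge * y) + 2 * (1 - y) * (1 - edge * y) * (edge * y))"
proof -
  have ew: "edge = 1 - w / 2" using w \<kappa>_pos by (simp add: edge_def field_simps)
  have wb: "(1 - 2 * \<kappa>) * w = - 2 * edge" unfolding ew using w by (simp add: algebra_simps)
  \<comment> \<open>One factor \<open>edge\<close> is traded for -(1 - 2\<kappa>) w / 2, so that
    \<open>rel\<close> applies without a division by 1 - 2\<kappa>.\<close>
  have "edge\<^sup>2 * R = - ((1 - 2 * \<kappa>) * w / 2) * (edge * R)"
    unfolding wb by (simp add: power2_eq_square)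
  then have "edge\<^sup>2 * R = - (w / 2) * (edge * (1 - 2 * \<kappa>) * R)" by simp
  then have e2: "edge\<^sup>2 * R = - (w / 2) * (edge * (2 - c\<^sup>2 - 2 * edge * y))" unfolding rel .
  have w2: "w = 2 - 2 * edge" using ew by simp
  have L: "- (1 - 2 * \<kappa>) * edge * (- y * (1 - y) * R + y\<^sup>2 * (R - (1 - y) * w) / 2) =
      (y * (1 - y) - y\<^sup>2 / 2) * (edge * (1 - 2 * \<kappa>) * R) + edge * y\<^sup>2 * (1 - y) / 2 * ((1 - 2 * \<kappa>) * w)"
    by (simp add: field_simps)
  have "2 * \<kappa> * edge\<^sup>2 * y\<^sup>2 * R = 2 * \<kappa> * y\<^sup>2 * (edge\<^sup>2 * R)" by simp
  also have "\<dots> = - (\<kappa> * w) * y\<^sup>2 * (edge * (2 - c\<^sup>2 - 2 * edge * y))" unfolding e2 by simp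
  finally have k2: "2 * \<kappa> * edge\<^sup>2 * y\<^sup>2 * R = - (y\<^sup>2 * (edge * (2 - c\<^sup>2 - 2 * edge * y)))" unfolding w by simp
  have wh: "w / 2 = 1 - edge" using w2 by simp
  have "edge\<^sup>2 * y\<^sup>2 * R = y\<^sup>2 * (edge\<^sup>2 * R)" by simp
  also have "\<dots> = - (y\<^sup>2 * (1 - edge) * (edge * (2 - c\<^sup>2 - 2 * edge * y)))"
    unfolding e2 wh by (simp add: algebra_simps)
  finally have k1: "edge\<^sup>2 * y\<^sup>2 * R = - (y\<^sup>2 * (1 - edge) * (edge * (2 - c\<^sup>2 - 2 * edge * y)))" .
  show ?thesis
    unfolding L rel wb k1 k2 by (simp add: field_simps power2_eq_square)
qed

text \<open>By dm/dt = (dx/dt)(dm/dx) this is the profile equation itself. In both regions the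
  derivative d is computed by calculus and n d is compared, where n is the square root occurring in
  \<open>mom\<close>, so that only polynomial identities remain.\<close>

lemma mom_has_derivative:
  assumes "\<bar>t\<bar> \<noteq> radius"
  shows "(mom has_real_derivative speed t * TW_rhs c \<kappa> (E t) (E' t / speed t)) (at t)"
proof -
  have outer: "(mom has_real_derivative speed t * TW_rhs c \<kappa> (E t) (E' t / speed t)) (at t)" if t: "t > radius" for t
  proof -
    define y n where "y = tail t" and "n = sqrt ((1 - y) * r y)"
    note o = outer_facts[OF t, folded y_def, folded n_def]
    have n: "n > 0" "n\<^sup>2 = (1 - y) * r y" using o by (auto simp: n_def)
    have D: "1 - edge * y > 0"
    proof -
      have "edge * y < 1"
      proof (cases "edge \<le> 0")
        case True then show ?thesis using o(1) by (smt (verit) mult_nonpos_nonneg)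
      next
        case False
        then have "edge * y \<le> edge * 1" using o by (intro mult_left_mono) auto
        then show ?thesis using edge_less_1 by simp
      qed
      then show ?thesis by simp
    qed
    define d where "d = - (1 - 2 * \<kappa>) * edge * (- y * n + y * ((y * r y - (1 - y) * (y / \<kappa>)) / (2 * n)))"
    have dy: "((\<lambda>t. exp (radius - t)) has_real_derivative - y) (at t)"
      using t by (auto intro!: derivative_eq_intros simp: y_def outer_simps)
    have ey: "exp (radius - t) = y" using t by (simp add: y_def outer_simps)
    have dn: "((\<lambda>t. sqrt ((1 - exp (radius - t)) * r (exp (radius - t)))) has_real_derivative
        (y * r y - (1 - y) * (y / \<kappa>)) / (2 * n)) (at t)"
    proof -
      have dr: "((\<lambda>t. r (exp (radius - t))) has_real_derivative - (y / \<kappa>)) (at t)"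
        unfolding r_def using DERIV_add[OF DERIV_const DERIV_cdivide[OF dy, of \<kappa>]] by simp
      have "((\<lambda>t. (1 - exp (radius - t)) * r (exp (radius - t))) has_real_derivative
          (0 - - y) * r y + - (y / \<kappa>) * (1 - y)) (at t)"
        using DERIV_mult[OF DERIV_diff[OF DERIV_const dy] dr] by (simp add: ey)
      moreover have "(1 - exp (radius - t)) * r (exp (radius - t)) > 0"
        using o(2,3) by (simp add: ey)
      ultimately have "((\<lambda>t. sqrt ((1 - exp (radius - t)) * r (exp (radius - t)))) has_real_derivative
          inverse (sqrt ((1 - exp (radius - t)) * r (exp (radius - t)))) / 2 * ((0 - - y) * r y + - (y / \<kappa>) * (1 - y))) (at t)"
        by (intro DERIV_chain2[OF DERIV_real_sqrt])
      then show ?thesis unfolding ey n_def[symmetric] by (simp add: field_simps)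
    qed
    have dm: "(mom has_real_derivative d) (at t)"
    proof (rule has_field_derivative_transform_within_open[of
          "\<lambda>t. - (1 - 2 * \<kappa>) * edge * (exp (radius - t) * sqrt ((1 - exp (radius - t)) * r (exp (radius - t))))" _ _ "{radius<..}"])
      show "((\<lambda>t. - (1 - 2 * \<kappa>) * edge * (exp (radius - t) * sqrt ((1 - exp (radius - t)) * r (exp (radius - t)))))
          has_real_derivative d) (at t)"
        using DERIV_cmult[OF DERIV_mult[OF dy dn], of "- (1 - 2 * \<kappa>) * edge"]
        unfolding d_def ey n_def[symmetric] by (simp add: ac_simps)
    qed (use t in \<open>auto simp: outer_simps\<close>)
    have "2 * (1 - edge * y) * (n * d) = 2 * (1 - edge * y) *
        (- (1 - 2 * \<kappa>) * edge * (- y * n\<^sup>2 + y * (y * r y - (1 - y) * (y / \<kappa>)) / 2))"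
      using n(1) by (simp add: d_def power2_eq_square field_simps)
    also have "\<dots> = 2 * (1 - edge * y) *
        (- (1 - 2 * \<kappa>) * edge * (- y * (1 - y) * r y + y\<^sup>2 * (r y - (1 - y) * (1 / \<kappa>)) / 2))"
      unfolding n(2) by (simp add: algebra_simps power2_eq_square)
    also have "\<dots> = - (edge\<^sup>2 * y\<^sup>2 * r y + (1 - y) * c\<^sup>2 * (edge * y)\<^sup>2) + 2 * (1 - edge * y) * (2 * \<kappa> * edge\<^sup>2 * y\<^sup>2 * r y
      - (1 - y) * c\<^sup>2 * (edge * y) + 2 * (1 - y) * (1 - edge * y) * (edge * y))"
      by (rule outer_identity[OF _ edge_ratio]) (use \<kappa>_pos in simp)
    also have "\<dots> = 2 * (1 - edge * y) * ((1 - y) * TW_rhs c \<kappa> (E t) (E' t / speed t))"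
      unfolding o(4) using TW_rhs_cleared[OF o(6), of "edge * y"] D o(2)
      by (simp add: algebra_simps)
    finally have "n * d = (1 - y) * TW_rhs c \<kappa> (E t) (E' t / speed t)" using D by simp
    then have "d = speed t * TW_rhs c \<kappa> (E t) (E' t / speed t)"
      unfolding o(5) using n(1) by (simp add: field_simps)
    then show ?thesis using dm by simp
  qed
  consider "\<bar>t\<bar> < radius" | "t > radius" | "t < - radius" using assms by linarith
  then show ?thesis
  proof cases
    case 1
    define a q y s n where "a = 2 * \<kappa> * (radius\<^sup>2 - t\<^sup>2)" and "q = Q (\<eta>\<^sub>0 + t\<^sup>2)" and "y = E t" and "s = t\<^sup>2"
      and "n = sqrt (a * q)"
    note i = core_facts[OF 1, folded a_def q_def, folded n_def, folded y_def s_def]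
    have n: "n > 0" "n * n = a * q" using i by (auto simp: n_def)
    have y: "y = \<eta>\<^sub>0 + s" using 1 by (simp add: y_def s_def core_simps)
    have D: "1 - y > 0" using i(4) edge_less_1 by simp
    have "Q y = q" unfolding q_def y s_def ..
    note core = core_identity[OF y, unfolded this]
    define d where "d = - (n + t * ((t * (- 4 * \<kappa> * q + 2 * a * Q' y)) / (2 * n)))"
    have dN: "((\<lambda>t. 2 * \<kappa> * (radius\<^sup>2 - t\<^sup>2) * Q (\<eta>\<^sub>0 + t\<^sup>2)) has_real_derivative t * (- 4 * \<kappa> * q + 2 * a * Q' y)) (at t)"
    proof -
      have "((\<lambda>t. Q (\<eta>\<^sub>0 + t\<^sup>2)) has_real_derivative Q' y * (2 * t)) (at t)"
        unfolding y s_def by (rule DERIV_chain2[OF Q_has_derivative]) (auto intro!: derivative_eq_intros)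
      moreover have "((\<lambda>t. 2 * \<kappa> * (radius\<^sup>2 - t\<^sup>2)) has_real_derivative 2 * \<kappa> * (- (2 * t))) (at t)"
        by (auto intro!: derivative_eq_intros)
      ultimately have "((\<lambda>t. 2 * \<kappa> * (radius\<^sup>2 - t\<^sup>2) * Q (\<eta>\<^sub>0 + t\<^sup>2)) has_real_derivative
          2 * \<kappa> * (- (2 * t)) * Q (\<eta>\<^sub>0 + t\<^sup>2) + Q' y * (2 * t) * (2 * \<kappa> * (radius\<^sup>2 - t\<^sup>2))) (at t)"
        by (rule DERIV_mult[rotated])
      then show ?thesis by (simp add: a_def q_def algebra_simps)
    qed
    have "((\<lambda>t. sqrt (2 * \<kappa> * (radius\<^sup>2 - t\<^sup>2) * Q (\<eta>\<^sub>0 + t\<^sup>2))) has_real_derivative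
        (t * (- 4 * \<kappa> * q + 2 * a * Q' y)) / (2 * n)) (at t)"
    proof -
      have "2 * \<kappa> * (radius\<^sup>2 - t\<^sup>2) * Q (\<eta>\<^sub>0 + t\<^sup>2) > 0" using i(1,2) by (simp add: a_def q_def)
      from DERIV_chain2[OF DERIV_real_sqrt[OF this] dN] show ?thesis
        by (simp add: n_def a_def q_def field_simps)
    qed
    from DERIV_minus[OF DERIV_mult[OF DERIV_ident this]]
    have dm': "((\<lambda>t. - (t * sqrt (2 * \<kappa> * (radius\<^sup>2 - t\<^sup>2) * Q (\<eta>\<^sub>0 + t\<^sup>2)))) has_real_derivative d) (at t)"
      by (simp add: d_def n_def a_def q_def ac_simps)
    have dm: "(mom has_real_derivative d) (at t)"
      by (rule has_field_derivative_transform_within_open[OF dm', of "{-radius<..<radius}"])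
        (use 1 in \<open>auto simp: core_simps\<close>)
    have "n * d = - (n * n) - s * (- 4 * \<kappa> * q + 2 * a * Q' y) / 2"
      using n(1) by (simp add: d_def s_def power2_eq_square field_simps)
    also have "\<dots> = - a * q + 2 * \<kappa> * s * q - a * s * Q' y"
      unfolding n(2) by (simp add: field_simps)
    finally have "(1 - y) * (n * d) = (1 - y) * (- a * q + 2 * \<kappa> * s * q - a * s * Q' y)"
      by (rule arg_cong)
    \<comment> \<open>Regrouped around the cleared form of \<open>TW_rhs\<close>. The remaining
      terms cancel by \<open>core_identity\<close> and because 1 - 2\<kappa>(1 - y) = -a.\<close>
    also have "\<dots> = - (s * q + a * c\<^sup>2 * y\<^sup>2) + (1 - y) * (4 * \<kappa> * s * q - 2 * a * c\<^sup>2 * y + 4 * a * (1 - y) * y)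
        - a * ((1 - y) * q + (1 - y) * s * Q' y) + (1 - 2 * \<kappa> * (1 - y)) * (s * q)
        + a * (c\<^sup>2 * y\<^sup>2 + 2 * (1 - y) * c\<^sup>2 * y - 4 * (1 - y)\<^sup>2 * y)"
      by (simp add: algebra_simps power2_eq_square)
    also have "\<dots> = - (s * q + a * c\<^sup>2 * y\<^sup>2) + (1 - y) * (4 * \<kappa> * s * q - 2 * a * c\<^sup>2 * y + 4 * a * (1 - y) * y)"
      unfolding i(3) core[symmetric] by (simp add: algebra_simps)
    also have "\<dots> = (1 - y) * (2 * a * TW_rhs c \<kappa> (E t) (E' t / speed t))"
      using TW_rhs_cleared[OF i(6), of y c \<kappa>] D i(1) unfolding y_def[symmetric]
      by (simp add: algebra_simps)
    finally have "n * d = 2 * a * TW_rhs c \<kappa> (E t) (E' t / speed t)" using D by simp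
    then have "d = speed t * TW_rhs c \<kappa> (E t) (E' t / speed t)"
      unfolding i(5) using n(1) by (simp add: field_simps)
    then show ?thesis using dm by simp
  next
    case 2 then show ?thesis by (rule outer)
  next
    case 3
    then show ?thesis
      using has_derivative_reflect[of mom _ t "-1"] outer[of "- t"] by (simp add: reflection TW_rhs_def)
  qed
qed

end


section \<open>The profile as a function of the space variable\<close>

context TW_profile
begin

text \<open>Integrating dx/dt recovers the space variable from the parameter, with the origin at t =
  0; \<open>par\<close> below is the inverse map.\<close>

lemma ex_pos: "\<exists>X. X 0 = 0 \<and> (\<forall>t. (X has_real_derivative speed t) (at t))"
proof -
  obtain F where F: "\<And>t. (F has_vector_derivative speed t) (at t)"
    by (rule continuous_antiderivative[OF continuous_profile_functions(2)]) (rule that)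
  have "((\<lambda>t. F t - F 0) has_real_derivative speed t) (at t)" for t
    using DERIV_diff[OF F[folded has_real_derivative_iff_has_vector_derivative] DERIV_const] by simp
  then show ?thesis by (intro exI[of _ "\<lambda>t. F t - F 0"]) auto
qed

definition "pos = (SOME X. X 0 = 0 \<and> (\<forall>t. (X has_real_derivative speed t) (at t)))"

lemma pos_0: "pos 0 = 0" and pos_has_derivative: "(pos has_real_derivative speed t) (at t)"
  using someI_ex[OF ex_pos] unfolding pos_def[symmetric] by auto

lemma continuous_pos: "isCont pos t"
  using pos_has_derivative DERIV_isCont by blast

lemma pos_minus: "pos (- t) = - pos t"
proof -
  have "((\<lambda>t. pos t + pos (- t)) has_real_derivative 0) (at x)" for x
  proof -
    have "(pos has_real_derivative speed x) (at (- x))"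
      using pos_has_derivative[of "- x"] by (simp add: reflection)
    then have "((\<lambda>t. pos (- t)) has_real_derivative - speed x) (at x)" by (simp add: DERIV_mirror)
    from DERIV_add[OF pos_has_derivative this] show ?thesis by simp
  qed
  then have "pos t + pos (- t) = pos 0 + pos (- 0)"
    using DERIV_isconst_all[of "\<lambda>t. pos t + pos (- t)" t 0] by blast
  then show ?thesis by (simp add: pos_0)
qed

lemma pos_mono: "a \<le> b \<Longrightarrow> pos a \<le> pos b"
  by (rule DERIV_nonneg_imp_nondecreasing) (use pos_has_derivative speed_nonneg in blast)+

text \<open>The speed vanishes only at two points, whereas constancy of \<open>pos\<close> on an
  interval would make it vanish throughout.\<close>

lemma pos_strict_mono: assumes "a < b" shows "pos a < pos b"
proof (rule ccontr)
  assume "\<not> pos a < pos b"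
  then have eq: "pos x = pos a" if "x \<in> {a..b}" for x
    using pos_mono[of a x] pos_mono[of x b] that by auto
  have "infinite ({a<..<b} - {radius, - radius})" using assms by simp
  then have "{a<..<b} - {radius, - radius} \<noteq> {}" by (intro notI) simp
  then obtain x where "x \<in> {a<..<b} - {radius, - radius}" by blast
  then have x: "x \<in> {a<..<b}" "\<bar>x\<bar> \<noteq> radius" by auto
  have "(pos has_real_derivative 0) (at x)"
  proof (rule has_field_derivative_transform_within_open[OF DERIV_const[of "pos a"]])
    show "open {a<..<b}" "x \<in> {a<..<b}" using x by auto
    show "pos a = pos y" if "y \<in> {a<..<b}" for y using eq[of y] that by auto
  qed
  then have "speed x = 0" using pos_has_derivative DERIV_unique by blast
  then show False using speed_pos_iff[of x] x by auto
qed

lemma pos_less_iff: "pos a < pos b \<longleftrightarrow> a < b"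
  using pos_strict_mono[of a b] pos_mono[of b a] by linarith

lemma pos_eq_iff: "pos a = pos b \<longleftrightarrow> a = b"
  using pos_strict_mono[of a b] pos_strict_mono[of b a] by (cases a b rule: linorder_cases) auto

text \<open>For t \<ge> radius + 1 the tail is at most exp(-1), so the speed is at least \<delta>
  and \<open>pos\<close> grows at least linearly. Hence the profile is defined for every x.\<close>

lemma pos_unbounded: "\<exists>t\<ge>0. x \<le> pos t"
proof -
  define t0 where "t0 = radius + 1"
  define \<delta> where "\<delta> = sqrt ((1 - exp (-1)) / r 1)"
  have r1: "r 1 > 0" by (simp add: r_pos)
  have d: "\<delta> > 0" using r1 by (simp add: \<delta>_def)
  have sp: "\<delta> \<le> speed t" if "t \<ge> t0" for t
  proof -
    have t: "radius < t" using that by (simp add: t0_def)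
    have y: "tail t \<le> exp (- 1)" "0 < tail t" using t that tail_props(1) by (auto simp: outer_simps t0_def)
    have "r (tail t) \<le> r 1" using tail_props(2) \<kappa>_pos by (simp add: r_def divide_right_mono)
    then have "(1 - exp (- 1)) / r 1 \<le> (1 - tail t) / r (tail t)"
      using y r_pos[OF y(2)] tail_props(2)[of t] by (intro frac_le) auto
    then show ?thesis using t by (simp add: \<delta>_def outer_simps)
  qed
  have lin: "pos t0 + \<delta> * (t - t0) \<le> pos t" if "t \<ge> t0" for t
  proof -
    have "(\<lambda>t. pos t - \<delta> * t) t0 \<le> (\<lambda>t. pos t - \<delta> * t) t"
    proof (rule DERIV_nonneg_imp_nondecreasing[OF that])
      fix s assume "t0 \<le> s" "s \<le> t"
      then show "\<exists>y. ((\<lambda>t. pos t - \<delta> * t) has_real_derivative y) (at s) \<and> 0 \<le> y"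
        using sp[of s] by (intro exI[of _ "speed s - \<delta>"] conjI)
          (auto intro!: derivative_eq_intros pos_has_derivative)
    qed
    then show ?thesis by (simp add: algebra_simps)
  qed
  have t0: "t0 \<ge> 0" using radius_pos by (simp add: t0_def)
  have p0: "pos t0 \<ge> 0" using pos_mono[OF t0] by (simp add: pos_0)
  have "x \<le> pos (t0 + \<bar>x\<bar> / \<delta>)"
    using lin[of "t0 + \<bar>x\<bar> / \<delta>"] d p0 by simp
  then show ?thesis using t0 d by (intro exI[of _ "t0 + \<bar>x\<bar> / \<delta>"]) auto
qed

lemma pos_surj: "\<exists>t. pos t = x"
proof -
  obtain t where t: "t \<ge> 0" "\<bar>x\<bar> \<le> pos t" using pos_unbounded by blast
  have "\<exists>s\<ge>- t. s \<le> t \<and> pos s = x"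
    using t continuous_pos by (intro IVT) (auto simp: pos_minus)
  then show ?thesis by blast
qed

definition "par = inv pos"

lemma par_pos [simp]: "par (pos t) = t"
  unfolding par_def by (rule inv_f_f) (simp add: inj_def pos_eq_iff)

lemma pos_par [simp]: "pos (par x) = x"
  unfolding par_def using pos_surj[of x] by (intro f_inv_into_f) auto

lemma par_less_iff: "par x < t \<longleftrightarrow> x < pos t"
  and less_par_iff: "t < par x \<longleftrightarrow> pos t < x" and par_eq_iff: "par x = t \<longleftrightarrow> x = pos t"
  using pos_less_iff[of "par x" t] pos_less_iff[of t "par x"]
    pos_eq_iff[of "par x" t] by simp_all

lemma par_minus: "par (- x) = - par x"
  using pos_minus[of "par x"] by (simp add: par_eq_iff)

lemma par_0: "par 0 = 0"
  using par_pos[of 0] by (simp add: pos_0)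

lemma isCont_par: "isCont par x"
proof -
  have "isCont par (pos (par x))"
    by (rule isCont_inverse_function[of 1]) (auto intro: continuous_pos)
  then show ?thesis by simp
qed

lemma continuous_par: "continuous_on UNIV par"
  using isCont_par by (simp add: continuous_at_imp_continuous_on)

definition "core = pos radius"

lemma core_pos: "0 < core"
  using pos_strict_mono[OF radius_pos] by (simp add: core_def pos_0)

lemma par_core_iff: 
  "\<bar>par x\<bar> < radius \<longleftrightarrow> \<bar>x\<bar> < core" "\<bar>par x\<bar> = radius \<longleftrightarrow> \<bar>x\<bar> = core" "radius < \<bar>par x\<bar> \<longleftrightarrow> core < \<bar>x\<bar>"
proof -
  have "par x < radius \<longleftrightarrow> x < core" "- radius < par x \<longleftrightarrow> - core < x"
    "par x = radius \<longleftrightarrow> x = core" "par x = - radius \<longleftrightarrow> x = - core"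
    by (simp_all add: par_less_iff less_par_iff par_eq_iff core_def pos_minus)
  then show "\<bar>par x\<bar> < radius \<longleftrightarrow> \<bar>x\<bar> < core" "\<bar>par x\<bar> = radius \<longleftrightarrow> \<bar>x\<bar> = core" "radius < \<bar>par x\<bar> \<longleftrightarrow> core < \<bar>x\<bar>"
    by linarith+
qed

lemma par_has_derivative:
  assumes "\<bar>x\<bar> \<noteq> core"
  shows "(par has_real_derivative 1 / speed (par x)) (at x)"
proof -
  have "speed (par x) > 0" using assms by (simp add: speed_pos_iff par_core_iff)
  then have "(par has_real_derivative inverse (speed (par x))) (at x)"
    by (intro DERIV_inverse_function[of pos _ _ _ "x - 1" "x + 1"] pos_has_derivative isCont_par) auto
  then show ?thesis by (simp add: inverse_eq_divide)
qed

definition "prof x = E (par x)"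
text \<open>At \<bar>x\<bar> = core the speed is 0, so the quotient has the default value 0;
  elsewhere it is the classical derivative of \<open>prof\<close>.\<close>

definition "slope x = E' (par x) / speed (par x)"
definition "pmom x = mom (par x)"

lemma DERIV_comp_par:
  assumes "\<bar>x\<bar> \<noteq> core" "(f has_real_derivative D) (at (par x))"
  shows "((\<lambda>x. f (par x)) has_real_derivative D / speed (par x)) (at x)"
  using DERIV_chain2[OF assms(2) par_has_derivative[OF assms(1)]] by simp

lemma prof_has_derivative: "\<bar>x\<bar> \<noteq> core \<Longrightarrow> (prof has_real_derivative slope x) (at x)"
  unfolding prof_def slope_def by (intro DERIV_comp_par E_has_derivative) (auto simp: par_core_iff)

lemma pmom_has_derivative:
  assumes "\<bar>x\<bar> \<noteq> core"
  shows "(pmom has_real_derivative TW_rhs c \<kappa> (prof x) (slope x)) (at x)"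
proof -
  have "speed (par x) > 0" using assms by (simp add: speed_pos_iff par_core_iff)
  then show ?thesis
    using DERIV_comp_par[OF assms mom_has_derivative[of "par x"]] assms
    by (simp add: par_core_iff pmom_def[abs_def] prof_def slope_def)
qed

lemma continuous_prof: "continuous_on S prof" and continuous_pmom: "continuous_on S pmom"
proof -
  have "continuous_on UNIV (\<lambda>x. E (par x))" "continuous_on UNIV (\<lambda>x. mom (par x))"
    using continuous_on_compose2[OF continuous_profile_functions(1) continuous_par]
      continuous_on_compose2[OF continuous_profile_functions(3) continuous_par] by auto
  then have "continuous_on UNIV prof" "continuous_on UNIV pmom"
    unfolding prof_def[abs_def] pmom_def[abs_def] .
  then show "continuous_on S prof" "continuous_on S pmom" using continuous_on_subset by blast+
qed

lemma measurable_slope [measurable]: "slope \<in> borel_measurable borel"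
proof -
  have [measurable]: "par \<in> borel_measurable borel" "speed \<in> borel_measurable borel"
      "tail \<in> borel_measurable borel"
    by (intro borel_measurable_continuous_onI continuous_par continuous_profile_functions continuous_tail)+
  have [measurable]: "E' \<in> borel_measurable borel" unfolding E'_def[abs_def] by measurable
  show ?thesis unfolding slope_def[abs_def] by measurable
qed

lemma mom_eq: "mom t = (1 - 2 * \<kappa> * (1 - E t)) * (E' t / speed t)"
proof -
  have outer: "mom t = (1 - 2 * \<kappa> * (1 - E t)) * (E' t / speed t)" if t: "t > radius" for t
  proof -
    note o = outer_facts[OF t]
    have "1 - 2 * \<kappa> * (1 - E t) = 1 - 2 * \<kappa> + 2 * \<kappa> * edge * tail t"
      unfolding o(4) by (simp add: algebra_simps)
    then have g: "1 - 2 * \<kappa> * (1 - E t) = (1 - 2 * \<kappa>) * (1 - tail t)"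
      unfolding edge_\<kappa> by (simp add: algebra_simps)
    have E't: "E' t = - (edge * tail t)" using t radius_pos by (simp add: E'_def)
    define n where "n = sqrt ((1 - tail t) * r (tail t))"
    have "n > 0" using o by (simp add: n_def)
    then show ?thesis
      unfolding g o(5) E't outer_simps(6)[OF less_imp_le[OF t]] n_def[symmetric]
      using o(2) \<open>n > 0\<close> by (simp add: field_simps)
  qed
  consider "\<bar>t\<bar> < radius" | "\<bar>t\<bar> = radius" | "t > radius" | "t < - radius" by linarith
  then show ?thesis
  proof cases
    case 1
    note i = core_facts[OF 1]
    have E't: "E' t = 2 * t" using 1 by (auto simp: E'_def)
    have "sqrt (2 * \<kappa> * (radius\<^sup>2 - t\<^sup>2) * Q (\<eta>\<^sub>0 + t\<^sup>2)) > 0" using i by simp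
    then show ?thesis unfolding i(3) i(5) E't using 1 i(1) by (simp add: core_simps)
  next
    case 2
    then have "t\<^sup>2 = radius\<^sup>2" by (metis power2_abs)
    then show ?thesis using 2 radius_pos by (auto simp: core_simps E'_def)
  next
    case 3 then show ?thesis by (rule outer)
  next
    case 4 then show ?thesis using outer[of "- t"] by (simp add: reflection)
  qed
qed

lemma pmom_eq: "pmom x = (1 - 2 * \<kappa> * (1 - prof x)) * slope x"
  by (simp add: pmom_def prof_def slope_def mom_eq)

lemma prof_0: "prof 0 = \<eta>\<^sub>0"
  using radius_pos by (simp add: prof_def par_0 core_simps)

lemma E_bounds: "\<eta>\<^sub>0 \<le> E t" "E t \<le> max edge 0"
proof -
  have outer: "\<eta>\<^sub>0 \<le> E t \<and> E t \<le> max edge 0" if "t > radius" for t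
  proof -
    note o = outer_facts[OF that]
    show ?thesis
    proof (cases "edge \<le> 0")
      case True
      have "edge * 1 \<le> edge * tail t" using True o(2) by (intro mult_left_mono_neg) auto
      moreover have "edge * tail t \<le> 0" using True o(1) by (intro mult_nonpos_nonneg) auto
      ultimately show ?thesis using o(4) \<eta>\<^sub>0_neg True by auto
    next
      case False
      have "edge * tail t \<le> edge * 1" using False o(2) by (intro mult_left_mono) auto
      moreover have "0 \<le> edge * tail t" using False o(1) by (intro mult_nonneg_nonneg) auto
      ultimately show ?thesis using o(4) \<eta>\<^sub>0_neg False by auto
    qed
  qed
  have "\<eta>\<^sub>0 \<le> E t \<and> E t \<le> max edge 0"
  proof -
    consider "\<bar>t\<bar> \<le> radius" | "t > radius" | "t < - radius" by linarith
    then show ?thesis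
    proof cases
      case 1
      then have "t\<^sup>2 \<le> radius\<^sup>2" using power_mono[of "\<bar>t\<bar>" radius 2] by simp
      then show ?thesis using 1 by (auto simp: core_simps radius_sq)
    next
      case 2 then show ?thesis by (rule outer)
    next
      case 3 then show ?thesis using outer[of "- t"] by (simp add: reflection)
    qed
  qed
  then show "\<eta>\<^sub>0 \<le> E t" "E t \<le> max edge 0" by auto
qed

lemma prof_bounds: "\<eta>\<^sub>0 \<le> prof x" "prof x \<le> max edge 0" "prof x < 1"
proof -
  show "\<eta>\<^sub>0 \<le> prof x" "prof x \<le> max edge 0" by (simp_all add: prof_def E_bounds)
  then show "prof x < 1" using edge_less_1 by linarith
qed

lemma prof_minus: "prof (- x) = prof x"
  by (simp add: prof_def par_minus reflection)

lemma prof_core: "\<bar>x\<bar> = core \<Longrightarrow> prof x = edge"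
proof -
  assume "\<bar>x\<bar> = core"
  then have *: "\<bar>par x\<bar> = radius" by (simp add: par_core_iff)
  then have "(par x)\<^sup>2 = radius\<^sup>2" by (metis power2_abs)
  then show ?thesis using * by (simp add: prof_def core_simps radius_sq)
qed

lemma prof_inner: "\<bar>x\<bar> < core \<Longrightarrow> prof x < edge"
  using core_facts(4)[of "par x"] by (simp add: prof_def par_core_iff)

lemma E_outer: "radius < \<bar>t\<bar> \<Longrightarrow> E t = edge * tail \<bar>t\<bar>"
  using outer_simps(4)[of "\<bar>t\<bar>"] radius_pos by (cases "t \<ge> 0") (auto simp: reflection)

lemma prof_outer: "core < \<bar>x\<bar> \<Longrightarrow> edge \<noteq> 0 \<Longrightarrow> prof x \<noteq> edge"
  using E_outer[of "par x"] tail_props(3)[of "\<bar>par x\<bar>"] par_core_iff(3)[of x] by (auto simp: prof_def)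

lemma prof_outer_zero: "core \<le> \<bar>x\<bar> \<Longrightarrow> edge = 0 \<Longrightarrow> prof x = 0"
  using E_outer[of "par x"] par_core_iff(3)[of x] prof_core[of x]
  by (cases "core < \<bar>x\<bar>") (auto simp: prof_def)

text \<open>In the core \<open>E'\<close> is 2t. Outside, \<open>E'\<close> vanishes only if
  \<open>edge\<close> does, and then the profile is identically \<open>edge\<close> there.\<close>

lemma slope_eq_0_imp:
  assumes "slope x = 0" "prof x \<noteq> edge" shows "x = 0"
proof -
  have ne: "\<bar>x\<bar> \<noteq> core" using prof_core assms by blast
  then have "speed (par x) > 0" by (simp add: speed_pos_iff par_core_iff)
  then have E': "E' (par x) = 0" using assms by (simp add: slope_def)
  have "\<bar>x\<bar> < core"
  proof (rule ccontr)
    assume "\<not> \<bar>x\<bar> < core"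
    then have *: "radius < \<bar>par x\<bar>" using ne by (simp add: par_core_iff)
    then have "edge * tail \<bar>par x\<bar> = 0" using E' radius_pos by (auto simp: E'_def abs_if split: if_splits)
    then have "edge = 0" using tail_props(1)[of "\<bar>par x\<bar>"] by auto
    then show False using prof_outer_zero[of x] assms(2) \<open>\<not> \<bar>x\<bar> < core\<close> by simp
  qed
  then have "E' (par x) = 2 * par x" by (auto simp: E'_def par_core_iff[symmetric])
  then have "par x = 0" using E' by simp
  then show ?thesis using pos_par[of x] by (simp add: pos_0)
qed

text \<open>The map \<open>pos\<close> has derivative 0 at radius, so a finite slope of
  \<open>prof\<close> would give the composite \<open>E\<close> derivative 0 there; but from inside
  the core \<open>E\<close> has slope 2 radius.\<close>

lemma prof_not_differentiable:
  assumes "\<bar>x\<bar> = core" shows "\<not> (prof has_real_derivative d) (at x)"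
proof -
  have main: False if d: "(prof has_real_derivative d) (at core)" for d
  proof -
    have "((\<lambda>t. prof (pos t)) has_real_derivative d * speed radius) (at radius)"
      by (rule DERIV_chain2[OF _ pos_has_derivative]) (use d in \<open>simp add: core_def\<close>)
    moreover have "speed radius = 0" using speed_pos_iff[of radius] speed_nonneg[of radius] radius_pos by auto
    ultimately have "(E has_real_derivative 0) (at radius)" by (simp add: prof_def[abs_def])
    \<comment> \<open>Subtracting the parabola, which agrees with \<open>E\<close> in the core,
      leaves a function that is zero to the left of radius but would have a negative derivative at
      radius.\<close>
    then have "((\<lambda>t. E t - (\<eta>\<^sub>0 + t\<^sup>2)) has_real_derivative - (2 * radius)) (at radius)"
      by (auto intro!: derivative_eq_intros)
    from DERIV_neg_dec_left[OF this] radius_pos obtain e where e: "e > 0"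
      "\<And>h. h > 0 \<Longrightarrow> h < e \<Longrightarrow> E radius - (\<eta>\<^sub>0 + radius\<^sup>2) < E (radius - h) - (\<eta>\<^sub>0 + (radius - h)\<^sup>2)"
      by auto
    define h where "h = min (e / 2) radius"
    have "h > 0" "h < e" "h \<le> radius" using e radius_pos by (auto simp: h_def)
    then show False using e(2)[of h] radius_pos by (simp add: core_simps)
  qed
  show ?thesis
  proof
    assume d: "(prof has_real_derivative d) (at x)"
    consider "x = core" | "x = - core" using assms by linarith
    then show False
    proof cases
      case 2
      then have "((\<lambda>x. prof (- x)) has_real_derivative - d) (at core)" using d by (simp add: DERIV_mirror)
      then show False using main by (simp add: prof_minus)
    qed (use d main in simp)
  qed
qed

text \<open>Slope squared times dx/dt is the energy density in t. It has an inverse square root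
  singularity at \<bar>t\<bar> = radius, which is integrable.\<close>

lemma core_energy_bound:
  obtains C where "C \<ge> 0" "\<And>t. \<bar>t\<bar> < radius \<Longrightarrow>
    speed t * ((E' t / speed t)\<^sup>2 + (E t)\<^sup>2) \<le> C / sqrt (radius\<^sup>2 - t\<^sup>2)"
proof -
  \<comment> \<open>Dominates the density times sqrt(radius^2 - t^2), that root being estimated by
    radius in the second summand. G is continuous up to both ends, hence bounded.\<close>
  define G where "G t = 2 * t\<^sup>2 * sqrt (Q (\<eta>\<^sub>0 + t\<^sup>2) / (2 * \<kappa>)) + speed t * (E t)\<^sup>2 * radius" for t
  have "continuous_on {-radius..radius} G"
    unfolding G_def Q_def divide_inverse
    by (intro continuous_intros continuous_on_subset[OF continuous_profile_functions(1)]
        continuous_on_subset[OF continuous_profile_functions(2)]) auto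
  then obtain C where C: "\<And>t. t \<in> {-radius..radius} \<Longrightarrow> norm (G t) \<le> C"
    using continuous_on_Icc_bounded by blast
  show ?thesis
  proof (rule that[of "max C 0"])
    fix t assume t: "\<bar>t\<bar> < radius"
    define a q d where "a = 2 * \<kappa> * (radius\<^sup>2 - t\<^sup>2)" and "q = Q (\<eta>\<^sub>0 + t\<^sup>2)" and "d = sqrt (radius\<^sup>2 - t\<^sup>2)"
    note i = core_facts[OF t, folded a_def q_def]
    have "t\<^sup>2 < radius\<^sup>2" using power_strict_mono[of "\<bar>t\<bar>" radius 2] t by simp
    then have d: "d > 0" "d\<^sup>2 = radius\<^sup>2 - t\<^sup>2" by (auto simp: d_def)
    have dr: "d \<le> radius" unfolding d_def using radius_pos by (intro real_le_lsqrt) auto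
    have n: "sqrt (a * q) = sqrt (2 * \<kappa>) * d * sqrt q"
      by (simp add: a_def d_def real_sqrt_mult)
    have "speed t * (E' t / speed t)\<^sup>2 = 2 * t\<^sup>2 * q / sqrt (a * q)"
      unfolding i(6) unfolding i(5) using i(1) by simp
    also have "\<dots> = 2 * t\<^sup>2 * sqrt (q / (2 * \<kappa>)) / d"
      unfolding n using i(2) d(1) \<kappa>_pos by (simp add: real_sqrt_divide field_simps)
    finally have "speed t * (E' t / speed t)\<^sup>2 * d = 2 * t\<^sup>2 * sqrt (q / (2 * \<kappa>))" using d by simp
    moreover have "speed t * (E t)\<^sup>2 * d \<le> speed t * (E t)\<^sup>2 * radius"
      using dr speed_nonneg by (intro mult_left_mono) auto
    ultimately have "speed t * ((E' t / speed t)\<^sup>2 + (E t)\<^sup>2) * d \<le> G t"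
      by (simp add: G_def q_def algebra_simps)
    also have "\<dots> \<le> max C 0"
    proof -
      have "t \<in> {-radius..radius}" using t by auto
      then have "norm (G t) \<le> C" using C by blast
      then show ?thesis by auto
    qed
    finally show "speed t * ((E' t / speed t)\<^sup>2 + (E t)\<^sup>2) \<le> max C 0 / sqrt (radius\<^sup>2 - t\<^sup>2)"
      using d by (simp add: d_def[symmetric] pos_le_divide_eq)
  qed simp
qed

text \<open>An inverse square root singularity at radius and exponential decay beyond it. When c^2 =
  2 the function \<open>r\<close> tends to 0 along with its argument, so the speed is unbounded at
  infinity; the bound y/\<kappa> \<le> r y still controls the second term.\<close>

lemma outer_energy_bound:
  assumes t: "radius < t"
  shows "speed t * ((E' t / speed t)\<^sup>2 + (E t)\<^sup>2) \<le> edge\<^sup>2 * (sqrt (r 1) + sqrt \<kappa>) * (tail t / sqrt (1 - tail t))"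
proof -
  define y where "y = tail t"
  note o = outer_facts[OF t, folded y_def]
  define d where "d = sqrt (1 - y)"
  have d: "d > 0" "d \<le> 1" "d * d = 1 - y" using o by (auto simp: d_def)
  have sr: "sqrt (r y) > 0" "sqrt (r y) * sqrt (r y) = r y" using o by auto
  have n: "sqrt ((1 - y) * r y) = d * sqrt (r y)" by (simp add: d_def real_sqrt_mult)
  have r1: "sqrt (r y) \<le> sqrt (r 1)" using o \<kappa>_pos by (simp add: r_def divide_right_mono)
  have "sqrt (y / \<kappa>) \<le> sqrt (r y)" using r_ge by simp
  then have yk: "sqrt y \<le> sqrt \<kappa> * sqrt (r y)" using \<kappa>_pos by (simp add: real_sqrt_divide field_simps)
  have ysq: "y \<le> sqrt y"
  proof -
    have "sqrt y * sqrt y \<le> sqrt y * 1" using o by (intro mult_left_mono) auto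
    then show ?thesis using o by simp
  qed
  have "speed t * (E' t / speed t)\<^sup>2 = edge\<^sup>2 * y * (y * sqrt (r y)) / d"
    unfolding o(6) unfolding o(5) n using d sr o(1,2) by (simp add: power2_eq_square field_simps)
  also have "\<dots> \<le> edge\<^sup>2 * y * (1 * sqrt (r 1)) / d"
    using d o r1 sr by (intro divide_right_mono mult_left_mono mult_mono) auto
  finally have A: "speed t * (E' t / speed t)\<^sup>2 \<le> edge\<^sup>2 * sqrt (r 1) * (y / d)" by (simp add: ac_simps)
  have "speed t * (E t)\<^sup>2 = edge\<^sup>2 * y * (y * d / sqrt (r y))"
  proof -
    have "speed t = d / sqrt (r y)" unfolding o(5) n using d(1) by (simp flip: d(3))
    then show ?thesis unfolding o(4) by (simp add: power2_eq_square field_simps)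
  qed
  also have "\<dots> \<le> edge\<^sup>2 * y * (sqrt \<kappa> * (1 / d))"
  proof -
    have "y / sqrt (r y) \<le> sqrt \<kappa>"
      using ysq yk sr(1) by (simp add: pos_divide_le_eq)
    moreover have "d \<le> 1 / d" using d mult_le_one[of d d] by (simp add: pos_le_divide_eq)
    ultimately have "(y / sqrt (r y)) * d \<le> sqrt \<kappa> * (1 / d)"
      using d \<kappa>_pos by (intro mult_mono) auto
    then show ?thesis using o(1) by (intro mult_left_mono) (auto simp: ac_simps)
  qed
  finally have B: "speed t * (E t)\<^sup>2 \<le> edge\<^sup>2 * sqrt \<kappa> * (y / d)" by (simp add: ac_simps)
  show ?thesis using add_mono[OF A B] by (simp add: d_def y_def algebra_simps)
qed

text \<open>The two density bounds have explicit bounded primitives in t, an arcsine in the core and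
  multiples of sqrt(1 - tail) outside. Composition with \<open>par\<close> carries them to
  x.\<close>

lemma integrable_profile:
  "integrable lborel (\<lambda>x. (slope x)\<^sup>2)" "integrable lborel (\<lambda>x. (prof x)\<^sup>2)"
proof -
  obtain C1 where C1: "C1 \<ge> 0" "\<And>t. \<bar>t\<bar> < radius \<Longrightarrow>
    speed t * ((E' t / speed t)\<^sup>2 + (E t)\<^sup>2) \<le> C1 / sqrt (radius\<^sup>2 - t\<^sup>2)"
    by (rule core_energy_bound) (rule that; assumption)
  define C2 where "C2 = edge\<^sup>2 * (sqrt (r 1) + sqrt \<kappa>)"
  have C2: "C2 \<ge> 0" unfolding C2_def using r_pos[of 1] \<kappa>_pos by simp
  define \<Phi> where "\<Phi> t = C1 * arcsin (clip t / radius) + 2 * C2 * sqrt (1 - tail t) - 2 * C2 * sqrt (1 - tail (- t))" for t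
  define \<phi> where "\<phi> t = (if \<bar>t\<bar> < radius then C1 / sqrt (radius\<^sup>2 - t\<^sup>2)
     else if radius < t then C2 * (tail t / sqrt (1 - tail t))
     else C2 * (tail (- t) / sqrt (1 - tail (- t))))" for t
  have clip1: "- 1 \<le> clip t / radius \<and> clip t / radius \<le> 1" for t
    using clip_props(1,2)[of t] radius_pos by (simp add: field_simps)
  have c\<Phi>: "continuous_on UNIV \<Phi>"
    unfolding \<Phi>_def using clip1 radius_pos
    by (intro continuous_intros continuous_clip continuous_tail continuous_tail') auto
  have d\<Phi>: "(\<Phi> has_real_derivative \<phi> t) (at t)" if ne: "\<bar>t\<bar> \<noteq> radius" for t
  proof -
    have outer: "(\<Phi> has_real_derivative \<phi> t) (at t)" if t: "t > radius" for t
    proof (rule has_field_derivative_transform_within_open[of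
          "\<lambda>t. C1 * arcsin 1 + 2 * C2 * sqrt (1 - exp (radius - t))" _ _ "{radius<..}"])
      have y: "exp (radius - t) = tail t" using t by (simp add: outer_simps)
      have "((\<lambda>t. exp (radius - t)) has_real_derivative - tail t) (at t)"
        by (auto intro!: derivative_eq_intros simp: y)
      then have d1: "((\<lambda>t. 1 - exp (radius - t)) has_real_derivative 0 - - tail t) (at t)"
        by (rule DERIV_diff[OF DERIV_const])
      have "1 - exp (radius - t) > 0" using t by simp
      then have "((\<lambda>t. sqrt (1 - exp (radius - t))) has_real_derivative
          inverse (sqrt (1 - exp (radius - t))) / 2 * (0 - - tail t)) (at t)"
        by (intro DERIV_chain2[where g = "\<lambda>t. 1 - exp (radius - t)" and f = sqrt, OF _ d1] DERIV_real_sqrt)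
      then have d2: "((\<lambda>t. 2 * C2 * sqrt (1 - exp (radius - t))) has_real_derivative
          2 * C2 * (inverse (sqrt (1 - exp (radius - t))) / 2 * (0 - - tail t))) (at t)"
        by (rule DERIV_cmult)
      have "((\<lambda>t. C1 * arcsin 1 + 2 * C2 * sqrt (1 - exp (radius - t))) has_real_derivative
          0 + 2 * C2 * (inverse (sqrt (1 - exp (radius - t))) / 2 * (0 - - tail t))) (at t)"
        using d2 by (intro DERIV_add[where f = "\<lambda>_. C1 * arcsin 1"]) (rule DERIV_const)
      moreover have "0 + 2 * C2 * (inverse (sqrt (1 - exp (radius - t))) / 2 * (0 - - tail t)) = \<phi> t"
        unfolding y using t radius_pos by (simp add: \<phi>_def field_simps)
      ultimately show "((\<lambda>t. C1 * arcsin 1 + 2 * C2 * sqrt (1 - exp (radius - t))) has_real_derivative \<phi> t) (at t)"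
        by (simp only:)
    qed (use t radius_pos in \<open>auto simp: \<Phi>_def outer_simps\<close>)
    consider "\<bar>t\<bar> < radius" | "t > radius" | "t < - radius" using ne by linarith
    then show ?thesis
    proof cases
      case 1
      show ?thesis
      proof (rule has_field_derivative_transform_within_open[of "\<lambda>t. C1 * arcsin (t / radius)" _ _ "{-radius<..<radius}"])
        have "- 1 < t / radius" "t / radius < 1" using 1 radius_pos by (auto simp: field_simps abs_less_iff)
        then have "((\<lambda>t. arcsin (t / radius)) has_real_derivative inverse (sqrt (1 - (t / radius)\<^sup>2)) * (1 / radius)) (at t)"
          by (intro DERIV_chain2[where g = "\<lambda>t. t / radius" and f = arcsin, OF DERIV_arcsin] DERIV_cdivide DERIV_ident)
        moreover have "sqrt (1 - (t / radius)\<^sup>2) = sqrt (radius\<^sup>2 - t\<^sup>2) / radius"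
        proof -
          have "1 - (t / radius)\<^sup>2 = (radius\<^sup>2 - t\<^sup>2) / radius\<^sup>2"
            using radius_pos by (simp add: power_divide diff_divide_distrib)
          then show ?thesis using radius_pos by (simp add: real_sqrt_divide)
        qed
        ultimately have "((\<lambda>t. arcsin (t / radius)) has_real_derivative 1 / sqrt (radius\<^sup>2 - t\<^sup>2)) (at t)"
          using radius_pos by simp
        from DERIV_cmult[OF this, of C1] show "((\<lambda>t. C1 * arcsin (t / radius)) has_real_derivative \<phi> t) (at t)"
          using 1 by (simp add: \<phi>_def)
      qed (use 1 in \<open>auto simp: \<Phi>_def core_simps\<close>)
    next
      case 2 then show ?thesis by (rule outer)
    next
      case 3
      have "\<Phi> (- t) = - 1 * \<Phi> t" for t
        using clip1[of t] by (simp add: \<Phi>_def clip_minus arcsin_minus)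
      then show ?thesis
        using has_derivative_reflect[of \<Phi> _ t "-1"] outer[of "- t"] 3 radius_pos by (simp add: \<phi>_def)
    qed
  qed
  have le: "speed t * ((E' t / speed t)\<^sup>2 + (E t)\<^sup>2) \<le> \<phi> t" if ne: "\<bar>t\<bar> \<noteq> radius" for t
  proof -
    consider "\<bar>t\<bar> < radius" | "t > radius" | "t < - radius" using ne by linarith
    then show ?thesis
    proof cases
      case 1 then show ?thesis using C1(2) by (simp add: \<phi>_def)
    next
      case 2
      then have "\<not> \<bar>t\<bar> < radius" by linarith
      then show ?thesis using outer_energy_bound[of t] 2 by (simp add: \<phi>_def C2_def)
    next
      case 3
      then have "\<not> \<bar>t\<bar> < radius" "\<not> radius < t" using radius_pos by linarith+
      then show ?thesis using outer_energy_bound[of "- t"] 3 by (simp add: \<phi>_def C2_def reflection)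
    qed
  qed
  have [measurable]: "par \<in> borel_measurable borel" "speed \<in> borel_measurable borel"
      "tail \<in> borel_measurable borel" "prof \<in> borel_measurable borel"
    by (intro borel_measurable_continuous_onI continuous_par continuous_profile_functions continuous_tail continuous_prof)+
  have [measurable]: "\<phi> \<in> borel_measurable borel" unfolding \<phi>_def[abs_def] by measurable
  have int: "integrable lborel (\<lambda>x. (slope x)\<^sup>2 + (prof x)\<^sup>2)"
  proof (rule integrable_of_bounded_antiderivative[of "{core, - core}" _ "\<lambda>x. \<phi> (par x) / speed (par x)" "\<lambda>x. \<Phi> (par x)"])
    show "continuous_on UNIV (\<lambda>x. \<Phi> (par x))"
      by (rule continuous_on_compose2[OF c\<Phi> continuous_par]) simp
    show "((\<lambda>x. \<Phi> (par x)) has_real_derivative \<phi> (par x) / speed (par x)) (at x)" if "x \<notin> {core, - core}" for x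
      using that by (intro DERIV_comp_par d\<Phi>) (auto simp: par_core_iff)
    show "\<bar>(slope x)\<^sup>2 + (prof x)\<^sup>2\<bar> \<le> \<phi> (par x) / speed (par x)" if "x \<notin> {core, - core}" for x
    proof -
      have ne: "\<bar>par x\<bar> \<noteq> radius" using that by (auto simp: par_core_iff)
      then have "speed (par x) > 0" by (simp add: speed_pos_iff)
      then show ?thesis using le[OF ne] by (simp add: pos_le_divide_eq slope_def prof_def mult.commute)
    qed
    show "\<bar>\<Phi> (par x)\<bar> \<le> C1 * (pi / 2) + 2 * C2 + 2 * C2" for x
    proof -
      have s: "0 \<le> sqrt (1 - tail t)" "sqrt (1 - tail t) \<le> 1" for t
        using tail_props(1,2)[of t] by auto
      have "\<bar>arcsin (clip (par x) / radius)\<bar> \<le> pi / 2"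
        using arcsin_bounded[of "clip (par x) / radius"] clip1[of "par x"] by linarith
      then have a: "\<bar>C1 * arcsin (clip (par x) / radius)\<bar> \<le> C1 * (pi / 2)"
        unfolding abs_mult abs_of_nonneg[OF C1(1)] by (rule mult_left_mono[OF _ C1(1)])
      have b: "\<bar>2 * C2 * sqrt (1 - tail t)\<bar> \<le> 2 * C2" for t
        using s[of t] C2 mult_left_mono[OF s(2)[of t], of "2 * C2"] by (simp add: abs_mult)
      show ?thesis unfolding \<Phi>_def using a b[of "par x"] b[of "- par x"] by linarith
    qed
  qed (simp, measurable)
  show "integrable lborel (\<lambda>x. (slope x)\<^sup>2)" "integrable lborel (\<lambda>x. (prof x)\<^sup>2)"
    by (rule Bochner_Integration.integrable_bound[OF int]; simp)+
qed

end


section \<open>Existence\<close>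

lemma L2_imp_L1_loc:
  fixes f :: "real \<Rightarrow> 'a::{banach, second_countable_topology}"
  assumes "f \<in> borel_measurable borel" "integrable lborel (\<lambda>x. (norm (f x))\<^sup>2)"
  shows "f \<in> L1_loc"
proof (rule L1_loc_bound[OF L1_loc_add[OF L1_loc_continuous[OF continuous_on_const] integrable_imp_L1_loc[OF assms(2)], of 1]])
  have "norm (f x) \<le> 1 * norm (1 + (norm (f x))\<^sup>2)" for x
  proof -
    have "2 * norm (f x) \<le> 1 + (norm (f x))\<^sup>2"
      using zero_le_power2[of "norm (f x) - 1"] by (simp add: power2_diff)
    then have "norm (f x) \<le> 1 + (norm (f x))\<^sup>2" using norm_ge_zero[of "f x"] by linarith
    then show ?thesis by simp
  qed
  then show "\<exists>C. \<forall>x\<in>{a..b}. norm (f x) \<le> C * norm (1 + (norm (f x))\<^sup>2)" for a b by blast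
qed fact

lemma local_extremum_deriv:
  assumes "local_extremum f x" "(f has_real_derivative D) (at x)"
  shows "D = 0"
  using assms(1) unfolding local_extremum_def
proof
  assume "\<forall>\<^sub>F y in nhds x. f y \<le> f x"
  then obtain d where "d > 0" "\<forall>y. dist y x < d \<longrightarrow> f y \<le> f x" by (auto simp: eventually_nhds_metric)
  then show ?thesis using DERIV_local_max[OF assms(2), of d] by (simp add: dist_real_def abs_minus_commute)
next
  assume "\<forall>\<^sub>F y in nhds x. f x \<le> f y"
  then obtain d where "d > 0" "\<forall>y. dist y x < d \<longrightarrow> f x \<le> f y" by (auto simp: eventually_nhds_metric)
  then show ?thesis using DERIV_local_min[OF assms(2), of d] by (simp add: dist_real_def abs_minus_commute)
qed

lemma has_vector_derivative_complex:
  assumes "((\<lambda>x. Re (f x)) has_real_derivative Re D) (at x)" "((\<lambda>x. Im (f x)) has_real_derivative Im D) (at x)"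
  shows "(f has_vector_derivative D) (at x)"
  using assms by (simp add: has_vector_derivative_complex_iff)

context TW_profile
begin

text \<open>For u = \<rho> cis \<theta> one has \<langle>\<i>u, u'\<rangle> = \<rho>^2 \<theta>', so
  the momentum relation prescribes this derivative of the phase.\<close>

definition "angle = (SOME \<theta>. \<forall>x. (\<theta> has_real_derivative c * prof x / (2 * (1 - prof x))) (at x))"

lemma angle_has_derivative: "(angle has_real_derivative c * prof x / (2 * (1 - prof x))) (at x)"
proof -
  have nz: "prof x \<noteq> 1" for x using prof_bounds(3)[of x] by simp
  have c: "continuous_on UNIV (\<lambda>x. c * prof x / (2 * (1 - prof x)))"
    by (intro continuous_intros continuous_prof) (simp add: nz)
  obtain F where "\<And>x. (F has_vector_derivative c * prof x / (2 * (1 - prof x))) (at x)"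
    using continuous_antiderivative[OF c] by blast
  then have "\<exists>\<theta>. \<forall>x. (\<theta> has_real_derivative c * prof x / (2 * (1 - prof x))) (at x)"
    by (auto simp: has_real_derivative_iff_has_vector_derivative)
  from someI_ex[OF this] show ?thesis unfolding angle_def[symmetric] by blast
qed

definition "wave x = complex_of_real (sqrt (1 - prof x)) * cis (angle x)"
text \<open>The logarithmic derivative u'/u: its real part is \<rho>'/\<rho> with \<rho>^2 = 1 - y,
  its imaginary part the derivative of the phase.\<close>

definition "wave_ratio x = Complex (- slope x / (2 * (1 - prof x))) (c * prof x / (2 * (1 - prof x)))"
text \<open>Expressed through \<open>pmom\<close> in place of \<open>slope\<close>, which makes it
  continuous at the ends of the core.\<close>

definition "wave_flux x = Complex (- pmom x / (2 * (1 - prof x))) (c * prof x / (2 * (1 - prof x))) * wave x"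

lemma cmod_wave: "(cmod (wave x))\<^sup>2 = 1 - prof x"
  using prof_bounds(3)[of x] by (simp add: wave_def norm_mult power_mult_distrib)

lemma wave_nonzero: "wave x \<noteq> 0"
  using cmod_wave[of x] prof_bounds(3)[of x] by auto

lemma wave_has_derivative:
  assumes "\<bar>x\<bar> \<noteq> core"
  shows "(wave has_vector_derivative wave_ratio x * wave x) (at x)"
proof (rule has_vector_derivative_complex)
  have D: "1 - prof x > 0" using prof_bounds(3)[of x] by simp
  define \<rho> where "\<rho> = sqrt (1 - prof x)"
  have \<rho>: "\<rho> > 0" "\<rho> * \<rho> = 1 - prof x" using D by (auto simp: \<rho>_def)
  have "((\<lambda>x. 1 - prof x) has_real_derivative 0 - slope x) (at x)"
    by (rule DERIV_diff[OF DERIV_const prof_has_derivative[OF assms]])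
  then have d\<rho>: "((\<lambda>x. sqrt (1 - prof x)) has_real_derivative - slope x / (2 * \<rho>)) (at x)"
    using DERIV_chain2[where f = sqrt and g = "\<lambda>x. 1 - prof x", OF DERIV_real_sqrt[OF D]]
    by (fastforce simp: \<rho>_def field_simps)
  have \<theta>: "c * prof x / (2 * (1 - prof x)) = c * prof x / (2 * (\<rho> * \<rho>))" using \<rho> by simp
  have dc: "((\<lambda>x. cos (angle x)) has_real_derivative - sin (angle x) * (c * prof x / (2 * (1 - prof x)))) (at x)"
    by (rule DERIV_chain2[OF DERIV_cos angle_has_derivative])
  have ds: "((\<lambda>x. sin (angle x)) has_real_derivative cos (angle x) * (c * prof x / (2 * (1 - prof x)))) (at x)"
    by (rule DERIV_chain2[OF DERIV_sin angle_has_derivative])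
  show "((\<lambda>x. Re (wave x)) has_real_derivative Re (wave_ratio x * wave x)) (at x)"
    using DERIV_mult[OF d\<rho> dc] \<rho>(1)
    by (simp add: wave_def wave_ratio_def \<rho>_def[symmetric] \<theta> flip: \<rho>(2)) (simp add: field_simps)
  show "((\<lambda>x. Im (wave x)) has_real_derivative Im (wave_ratio x * wave x)) (at x)"
    using DERIV_mult[OF d\<rho> ds] \<rho>(1)
    by (simp add: wave_def wave_ratio_def \<rho>_def[symmetric] \<theta> flip: \<rho>(2)) (simp add: field_simps)
qed

lemma continuous_wave: "continuous_on UNIV wave"
proof -
  have "continuous_on UNIV angle"
    using angle_has_derivative by (meson DERIV_isCont continuous_at_imp_continuous_on)
  then show ?thesis unfolding wave_def by (intro continuous_intros continuous_prof)
qed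

lemma wave_inner: "wave x \<bullet> (wave_ratio x * wave x) = - slope x / 2"
proof -
  have "wave x \<bullet> (wave_ratio x * wave x) = Re (wave_ratio x) * (cmod (wave x))\<^sup>2"
    by (simp only: inner_complex_def cmod_power2 times_complex.sel) (simp add: algebra_simps power2_eq_square)
  also have "Re (wave_ratio x) = - slope x / (2 * (1 - prof x))" by (simp add: wave_ratio_def)
  also have "- slope x / (2 * (1 - prof x)) * (cmod (wave x))\<^sup>2 = - slope x / 2"
    unfolding cmod_wave using prof_bounds(3)[of x] by (simp add: field_simps)
  finally show ?thesis .
qed

lemma wave_flux_eq: "wave_flux x = TW_flux \<kappa> (wave x) (wave_ratio x * wave x)"
proof -
  have D: "1 - prof x > 0" using prof_bounds(3)[of x] by simp
  have "TW_flux \<kappa> (wave x) (wave_ratio x * wave x) = (wave_ratio x + complex_of_real (\<kappa> * slope x)) * wave x"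
    unfolding TW_flux_def wave_inner by (simp add: scaleR_conv_of_real algebra_simps)
  also have "wave_ratio x + complex_of_real (\<kappa> * slope x) = Complex (- pmom x / (2 * (1 - prof x))) (c * prof x / (2 * (1 - prof x)))"
    using D by (simp add: complex_eq_iff wave_ratio_def pmom_eq field_simps)
  finally show ?thesis by (simp add: wave_flux_def)
qed

lemma TW_source_wave:
  "TW_source c \<kappa> (wave x) (wave_ratio x * wave x) =
    (\<i> * complex_of_real c * wave_ratio x + complex_of_real (prof x) - complex_of_real (\<kappa> * slope x) * wave_ratio x) * wave x"
  unfolding TW_source_def cmod_wave wave_inner by (simp add: scaleR_conv_of_real algebra_simps)

text \<open>After division by u the real part is the equation for \<open>pmom\<close>, and the
  imaginary part is the conservation of momentum.\<close>

lemma wave_flux_has_derivative: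
  assumes "\<bar>x\<bar> \<noteq> core"
  shows "(wave_flux has_vector_derivative - TW_source c \<kappa> (wave x) (wave_ratio x * wave x)) (at x)"
proof -
  define B where "B x = Complex (- pmom x / (2 * (1 - prof x))) (c * prof x / (2 * (1 - prof x)))" for x
  define D e m where "D = 1 - prof x" and "e = slope x" and "m = pmom x"
  have D: "D > 0" using prof_bounds(3)[of x] by (simp add: D_def)
  define B' where "B' = Complex ((- TW_rhs c \<kappa> (prof x) e * D - m * e) / (2 * D\<^sup>2)) (c * e / (2 * D\<^sup>2))"
  have dD: "((\<lambda>x. 2 * (1 - prof x)) has_real_derivative 2 * (0 - e)) (at x)"
    unfolding e_def by (intro DERIV_cmult DERIV_diff DERIV_const prof_has_derivative assms)
  have "(B has_vector_derivative B') (at x)"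
  proof (rule has_vector_derivative_complex)
    have nz: "2 * (1 - prof x) \<noteq> 0" using D by (simp add: D_def)
    have "((\<lambda>x. - pmom x / (2 * (1 - prof x))) has_real_derivative
        (- TW_rhs c \<kappa> (prof x) e * (2 * (1 - prof x)) - - pmom x * (2 * (0 - e))) / ((2 * (1 - prof x)) * (2 * (1 - prof x)))) (at x)"
      unfolding e_def by (intro DERIV_divide DERIV_minus pmom_has_derivative assms dD[unfolded e_def] nz)
    moreover have "(- TW_rhs c \<kappa> (prof x) e * (2 * (1 - prof x)) - - pmom x * (2 * (0 - e))) / ((2 * (1 - prof x)) * (2 * (1 - prof x))) =
      (- TW_rhs c \<kappa> (prof x) e * D - m * e) / (2 * D\<^sup>2)"
    proof -
      have num: "- TW_rhs c \<kappa> (prof x) e * (2 * (1 - prof x)) - - pmom x * (2 * (0 - e)) = 2 * (- TW_rhs c \<kappa> (prof x) e * D - m * e)"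
        by (simp add: D_def m_def algebra_simps)
      show ?thesis unfolding num D_def[symmetric] power2_eq_square using D by (simp add: m_def field_simps)
    qed
    ultimately show "((\<lambda>x. Re (B x)) has_real_derivative Re B') (at x)"
      by (simp add: B_def B'_def)
    have "((\<lambda>x. c * prof x / (2 * (1 - prof x))) has_real_derivative
        (c * e * (2 * (1 - prof x)) - c * prof x * (2 * (0 - e))) / ((2 * (1 - prof x)) * (2 * (1 - prof x)))) (at x)"
      unfolding e_def by (intro DERIV_divide DERIV_cmult prof_has_derivative assms dD[unfolded e_def] nz)
    moreover have "(c * e * (2 * (1 - prof x)) - c * prof x * (2 * (0 - e))) / ((2 * (1 - prof x)) * (2 * (1 - prof x))) =
      c * e / (2 * D\<^sup>2)"
    proof -
      have "c * e * (2 * (1 - prof x)) - c * prof x * (2 * (0 - e)) = 2 * (c * e)" by (simp add: algebra_simps)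
      then show ?thesis using D by (simp add: D_def[symmetric] power2_eq_square)
    qed
    ultimately show "((\<lambda>x. Im (B x)) has_real_derivative Im B') (at x)"
      by (simp add: B_def B'_def)
  qed
  have flux: "wave_flux = (\<lambda>x. B x * wave x)" by (simp add: fun_eq_iff wave_flux_def B_def)
  from has_vector_derivative_mult[OF \<open>(B has_vector_derivative B') (at x)\<close> wave_has_derivative[OF assms]]
  have "(wave_flux has_vector_derivative (B' + B x * wave_ratio x) * wave x) (at x)"
    unfolding flux by (simp add: algebra_simps)
  moreover have "B' + B x * wave_ratio x =
    - (\<i> * complex_of_real c * wave_ratio x + complex_of_real (prof x) - complex_of_real (\<kappa> * slope x) * wave_ratio x)"
  proof -
    have y: "prof x = 1 - D" by (simp add: D_def)
    have rhs: "2 * D * TW_rhs c \<kappa> (prof x) e = - (e\<^sup>2 + c\<^sup>2 * (prof x)\<^sup>2) + 2 * D * (2 * \<kappa> * e\<^sup>2 - c\<^sup>2 * prof x + 2 * D * prof x)"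
      using TW_rhs_cleared[of e "e\<^sup>2" 1 "prof x" c \<kappa>] D by (simp add: D_def)
    have m: "m = (1 - 2 * \<kappa> * D) * e" by (simp add: m_def pmom_eq D_def e_def)
    have num: "- (2 * D * TW_rhs c \<kappa> (prof x) e) - 2 * m * e + (m * e - c\<^sup>2 * (prof x)\<^sup>2) =
      2 * D * c\<^sup>2 * prof x - 4 * D\<^sup>2 * prof x - 2 * D * \<kappa> * e\<^sup>2"
      unfolding rhs unfolding m y by (simp add: algebra_simps power2_eq_square)
    have "(- TW_rhs c \<kappa> (prof x) e * D - m * e) / (2 * D\<^sup>2) + (m * e - c\<^sup>2 * (prof x)\<^sup>2) / (4 * D\<^sup>2) =
      (- (2 * D * TW_rhs c \<kappa> (prof x) e) - 2 * m * e + (m * e - c\<^sup>2 * (prof x)\<^sup>2)) / (4 * D\<^sup>2)"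
      using D by (simp add: field_simps)
    also have "\<dots> = c\<^sup>2 * prof x / (2 * D) - prof x - \<kappa> * e\<^sup>2 / (2 * D)"
      unfolding num using D by (simp add: field_simps power2_eq_square)
    finally have re: "(- TW_rhs c \<kappa> (prof x) e * D - m * e) / (2 * D\<^sup>2) + (m * e - c\<^sup>2 * (prof x)\<^sup>2) / (4 * D\<^sup>2) =
      c\<^sup>2 * prof x / (2 * D) - prof x - \<kappa> * e\<^sup>2 / (2 * D)" .
    have im: "c * e / (2 * D\<^sup>2) - (m + e) * c * prof x / (4 * D\<^sup>2) = c * e / (2 * D) + \<kappa> * e * c * prof x / (2 * D)"
      unfolding m y using D by (simp add: field_simps power2_eq_square)
    have Bq: "B x * wave_ratio x = Complex ((m * e - c\<^sup>2 * (prof x)\<^sup>2) / (4 * D\<^sup>2)) (- ((m + e) * c * prof x / (4 * D\<^sup>2)))"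
      using D by (simp add: complex_eq_iff B_def wave_ratio_def D_def[symmetric] m_def[symmetric] e_def[symmetric] field_simps power2_eq_square)
    show ?thesis
      unfolding Bq B'_def
      using re im by (simp add: complex_eq_iff wave_ratio_def D_def[symmetric] m_def[symmetric] e_def[symmetric] power2_eq_square algebra_simps)
  qed
  ultimately show ?thesis unfolding TW_source_wave by (simp only: mult_minus_left)
qed

lemma cmod_wave_derivative: "(cmod (wave_ratio x * wave x))\<^sup>2 = ((slope x)\<^sup>2 + c\<^sup>2 * (prof x)\<^sup>2) / (4 * (1 - prof x))"
proof -
  define D where "D = 1 - prof x"
  have D: "D > 0" using prof_bounds(3)[of x] by (simp add: D_def)
  have "(cmod (wave_ratio x * wave x))\<^sup>2 = ((slope x / (2 * D))\<^sup>2 + (c * prof x / (2 * D))\<^sup>2) * D"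
    unfolding D_def by (simp add: norm_mult power_mult_distrib cmod_wave) (simp add: wave_ratio_def cmod_power2)
  also have "\<dots> = ((slope x)\<^sup>2 + c\<^sup>2 * (prof x)\<^sup>2) / (4 * D)"
    using D by (simp add: power_divide power_mult_distrib power2_eq_square field_simps)
  finally show ?thesis by (simp add: D_def)
qed

lemma wave_derivative_L2: "integrable lborel (\<lambda>x. (cmod (wave_ratio x * wave x))\<^sup>2)"
proof -
  define \<delta> where "\<delta> = 1 - max edge 0"
  have \<delta>: "\<delta> > 0" using edge_less_1 by (simp add: \<delta>_def)
  have [measurable]: "prof \<in> borel_measurable borel" by (rule borel_measurable_continuous_onI[OF continuous_prof])
  have "integrable lborel (\<lambda>x. ((slope x)\<^sup>2 + c\<^sup>2 * (prof x)\<^sup>2) / (4 * \<delta>))"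
    using integrable_profile by simp
  then show ?thesis unfolding cmod_wave_derivative
  proof (rule Bochner_Integration.integrable_bound)
    show "AE x in lborel. norm (((slope x)\<^sup>2 + c\<^sup>2 * (prof x)\<^sup>2) / (4 * (1 - prof x)))
      \<le> norm (((slope x)\<^sup>2 + c\<^sup>2 * (prof x)\<^sup>2) / (4 * \<delta>))"
    proof (intro AE_I2)
      fix x
      have "\<delta> \<le> 1 - prof x" using prof_bounds(2)[of x] by (simp add: \<delta>_def)
      then have "((slope x)\<^sup>2 + c\<^sup>2 * (prof x)\<^sup>2) / (4 * (1 - prof x)) \<le> ((slope x)\<^sup>2 + c\<^sup>2 * (prof x)\<^sup>2) / (4 * \<delta>)"
        using \<delta> by (intro frac_le) auto
      then show "norm (((slope x)\<^sup>2 + c\<^sup>2 * (prof x)\<^sup>2) / (4 * (1 - prof x)))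
        \<le> norm (((slope x)\<^sup>2 + c\<^sup>2 * (prof x)\<^sup>2) / (4 * \<delta>))"
        using prof_bounds(3)[of x] \<delta> by simp
    qed
  qed simp
qed

lemma has_ac_derivative_wave: "has_ac_derivative wave (\<lambda>x. wave_ratio x * wave x)"
proof (rule has_ac_derivativeI[of "{core, - core}"])
  have [measurable]: "prof \<in> borel_measurable borel" "wave \<in> borel_measurable borel"
    by (rule borel_measurable_continuous_onI[OF continuous_prof] borel_measurable_continuous_onI[OF continuous_wave])+
  have "wave_ratio = (\<lambda>x. complex_of_real (- slope x / (2 * (1 - prof x))) + \<i> * complex_of_real (c * prof x / (2 * (1 - prof x))))"
    by (simp add: wave_ratio_def complex_eq_iff fun_eq_iff)
  then have [measurable]: "wave_ratio \<in> borel_measurable borel" by simp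
  show "(\<lambda>x. wave_ratio x * wave x) \<in> L1_loc"
    by (rule L2_imp_L1_loc[OF _ wave_derivative_L2]) simp
  show "(wave has_vector_derivative wave_ratio x * wave x) (at x)" if "x \<notin> {core, - core}" for x
    using that by (intro wave_has_derivative) auto
qed (simp_all add: continuous_wave)

text \<open>Continuity of \<open>wave_flux\<close> at the ends of the core means that no jump term
  appears there. The source is locally integrable, since u' is square integrable, so the classical
  equation off two points yields the weak one.\<close>

lemma TW_weak_solution_wave: "TW_weak_solution c \<kappa> wave"
proof (rule TW_weak_solutionI[OF has_ac_derivative_wave wave_derivative_L2])
  show "integrable lborel (\<lambda>x. (1 - (cmod (wave x))\<^sup>2)\<^sup>2)"
    using integrable_profile(2) by (simp add: cmod_wave)
  have nz: "prof x \<noteq> 1" for x using prof_bounds(3)[of x] by simp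
  have Bc: "continuous_on UNIV (\<lambda>x. Complex (- pmom x / (2 * (1 - prof x))) (c * prof x / (2 * (1 - prof x))))"
    by (intro continuous_on_Complex continuous_intros continuous_prof continuous_pmom) (simp_all add: nz)
  show "has_ac_derivative wave_flux (\<lambda>x. - TW_source c \<kappa> (wave x) (wave_ratio x * wave x))"
  proof (rule has_ac_derivativeI[of "{core, - core}"])
    show "continuous_on UNIV wave_flux"
      unfolding wave_flux_def by (rule continuous_on_mult[OF Bc continuous_wave])
    show "(\<lambda>x. - TW_source c \<kappa> (wave x) (wave_ratio x * wave x)) \<in> L1_loc"
      by (intro L1_loc_minus TW_L1_loc(2)[OF continuous_wave has_ac_derivativeD(1)[OF has_ac_derivative_wave] wave_derivative_L2])
    show "(wave_flux has_vector_derivative - TW_source c \<kappa> (wave x) (wave_ratio x * wave x)) (at x)"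
      if "x \<notin> {core, - core}" for x
      using that by (intro wave_flux_has_derivative) auto
  qed simp
  show "AE x in lborel. wave_flux x = TW_flux \<kappa> (wave x) (wave_ratio x * wave x)"
    by (simp add: wave_flux_eq)
qed

section \<open>Extrema, singular points and lower bound of the wave\<close>

lemma \<eta>_wave: "\<eta> wave x = prof x"
  by (simp add: \<eta>_def cmod_wave)

lemma \<Gamma>_wave: "\<Gamma> \<kappa> wave = {x. prof x = edge}"
  by (auto simp: \<Gamma>_def cmod_wave edge_def)

lemma \<Z>_wave: "\<Z> \<kappa> wave = {0}"
proof (intro equalityI subsetI)
  fix x assume "x \<in> \<Z> \<kappa> wave"
  then have ne: "prof x \<noteq> edge" and ext: "local_extremum prof x"
    by (auto simp: \<Z>_def \<Gamma>_wave \<eta>_wave[abs_def])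
  then have "\<bar>x\<bar> \<noteq> core" using prof_core by blast
  then have d: "(prof has_real_derivative slope x) (at x)" by (rule prof_has_derivative)
  from local_extremum_deriv[OF ext d] have "slope x = 0" .
  then show "x \<in> {0}" using slope_eq_0_imp ne by simp
next
  fix x :: real assume "x \<in> {0}"
  then have "local_extremum prof x" using prof_bounds(1) by (simp add: local_extremum_def prof_0)
  then show "x \<in> \<Z> \<kappa> wave"
    using \<open>x \<in> {0}\<close> \<eta>\<^sub>0_neg by (simp add: \<Z>_def \<Gamma>_wave \<eta>_wave[abs_def] prof_0)
qed

lemma \<N>_wave: "\<N> wave = {core, - core}"
proof (intro equalityI subsetI)
  fix x assume "x \<in> \<N> wave"
  then have "\<not> wave differentiable (at x)" by (simp add: \<N>_def)
  then have "\<bar>x\<bar> = core" using wave_has_derivative differentiableI_vector by blast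
  then show "x \<in> {core, - core}" by auto
next
  fix x assume "x \<in> {core, - core}"
  then have x: "\<bar>x\<bar> = core" using core_pos by auto
  show "x \<in> \<N> wave" unfolding \<N>_def
  proof (intro CollectI notI)
    assume "wave differentiable (at x)"
    \<comment> \<open>The profile is a quadratic polynomial in the wave and would inherit its
      differentiability.\<close>
    then have "(\<lambda>x. 1 - wave x \<bullet> wave x) differentiable (at x)"
      by (intro differentiable_diff differentiable_const differentiable_inner)
    moreover have "(\<lambda>x. 1 - wave x \<bullet> wave x) = prof"
      by (simp add: fun_eq_iff cmod_wave flip: power2_norm_eq_inner)
    ultimately show False using prof_not_differentiable[OF x] by (auto simp: real_differentiable_def)
  qed
qed

lemma nonvanishing_wave: "wave \<in> nonvanishing_energy_space"
proof -
  define \<delta> where "\<delta> = sqrt (1 - max edge 0)"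
  have "\<delta> > 0" using edge_less_1 by (simp add: \<delta>_def)
  moreover have "\<delta> \<le> cmod (wave x)" for x
  proof -
    have "cmod (wave x) = sqrt (1 - prof x)" using cmod_wave[of x] by (metis norm_ge_zero real_sqrt_unique)
    then show ?thesis using prof_bounds(2)[of x] by (simp add: \<delta>_def)
  qed
  then have "\<delta> \<le> (INF x. cmod (wave x))" by (intro cINF_greatest) auto
  ultimately show ?thesis
    using TW_weak_solution_wave by (simp add: nonvanishing_energy_space_def TW_weak_solution_def)
qed

end


section \<open>Uniqueness\<close>

text \<open>If f \<ge> \<epsilon> held wherever P holds beyond N, the integral over (N, N + k) would
  be at least \<epsilon> k for every k.\<close>

lemma exists_small_point:
  fixes f :: "real \<Rightarrow> real"
  assumes f: "integrable lborel f" "\<And>x. 0 \<le> f x" and P: "AE x in lborel. P x" and "0 < \<epsilon>"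
  obtains x where "N < x" "P x" "f x < \<epsilon>"
proof (rule ccontr)
  assume "\<not> thesis"
  then have none: "\<And>x. N < x \<Longrightarrow> P x \<Longrightarrow> \<epsilon> \<le> f x" using that by fastforce
  have bound: "\<epsilon> * real k \<le> integral\<^sup>L lborel f" for k
  proof -
    have "\<epsilon> * real k = (LINT x|lborel. \<epsilon> * indicator {N<..<N + real k} x)" by simp
    also have "\<dots> \<le> integral\<^sup>L lborel f"
    proof (rule integral_mono_AE)
      show "AE x in lborel. \<epsilon> * indicator {N<..<N + real k} x \<le> f x"
        using P by eventually_elim (use none f(2) in \<open>auto simp: indicator_def\<close>)
    qed (use f(1) in auto)
    finally show ?thesis .
  qed
  obtain k where "integral\<^sup>L lborel f / \<epsilon> < real k" using reals_Archimedean2 by blast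
  then show False using bound[of k] \<open>0 < \<epsilon>\<close> by (simp add: field_simps)
qed

text \<open>A substitute for limits at infinity: derivatives are only square integrable and the
  equations hold only almost everywhere, so points are selected at which the equations are true and
  the energy density tends to 0.\<close>

lemma small_sequence:
  fixes f :: "real \<Rightarrow> real"
  assumes f: "integrable lborel f" "\<And>x. 0 \<le> f x" and P: "AE x in lborel. P x"
  obtains X :: "nat \<Rightarrow> real" where "\<And>n. real n < X n" "\<And>n. P (X n)" "(\<lambda>n. f (X n)) \<longlonglongrightarrow> 0"
proof -
  have "\<exists>x. real n < x \<and> P x \<and> f x < 1 / real (Suc n)" for n
    by (rule exists_small_point[OF f P, of "1 / real (Suc n)" "real n"]) auto
  then obtain X where X: "\<And>n. real n < X n \<and> P (X n) \<and> f (X n) < 1 / real (Suc n)" by metis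
  have "(\<lambda>n. f (X n)) \<longlonglongrightarrow> 0"
  proof (rule tendsto_sandwich[OF _ _ tendsto_const LIMSEQ_Suc[OF lim_1_over_n]])
    show "\<forall>\<^sub>F n in sequentially. 0 \<le> f (X n)" using f(2) by simp
    show "\<forall>\<^sub>F n in sequentially. f (X n) \<le> 1 / real (Suc n)" using X less_imp_le by (intro always_eventually) blast
  qed
  then show ?thesis using that[of X] X by blast
qed

lemma tendsto_zero_of_power2:
  fixes f :: "'a \<Rightarrow> real"
  assumes "((\<lambda>x. (f x)\<^sup>2) \<longlongrightarrow> 0) F"
  shows "(f \<longlongrightarrow> 0) F"
  using tendsto_real_sqrt[OF assms] by (simp add: tendsto_rabs_zero_iff)

lemma AE_lborel_reflect:
  fixes P :: "real \<Rightarrow> bool"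
  assumes "AE x in lborel. P x"
  shows "AE x in lborel. P (- x)"
proof -
  obtain N where N: "{x \<in> space lborel. \<not> P x} \<subseteq> N" "N \<in> sets lborel" "emeasure lborel N = 0"
    using AE_E[OF assms] by blast
  have "AE x in distr lborel borel (uminus :: real \<Rightarrow> real). x \<notin> N"
    unfolding lborel_distr_uminus using N by (intro AE_not_in) (auto simp: null_sets_def)
  then have "AE x in lborel. - x \<notin> N"
    using N(2) by (subst (asm) AE_distr_iff) auto
  then show ?thesis by eventually_elim (use N(1) in auto)
qed

lemma has_ac_derivative_reflect:
  assumes "has_ac_derivative f f'"
  shows "has_ac_derivative (\<lambda>x. f (- x)) (\<lambda>x. - f' (- x))"
  unfolding has_ac_derivative_def
proof (intro conjI allI impI)
  note L = has_ac_derivativeD(1)[OF assms]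
  have [measurable]: "f' \<in> borel_measurable borel" using L1_locD(1)[OF L] .
  have ind: "indicator {a..b} (- x) = (indicator {- b..- a} x :: real)" for a b x :: real
    by (auto simp: indicator_def)
  show "(\<lambda>x. - f' (- x)) \<in> L1_loc"
  proof (rule L1_locI)
    show "set_integrable lborel {a..b} (\<lambda>x. - f' (- x))" for a b
      using L1_locD(2)[OF L, of "- b" "- a"]
        lborel_integrable_real_affine_iff[of "- 1" "\<lambda>x. indicator {-b..-a} x *\<^sub>R f' x" 0]
      by (simp add: set_integrable_def ind)
  qed simp
  fix a b :: real assume ab: "a \<le> b"
  have "(LINT x:{a..b}|lborel. - f' (- x)) = - (LINT x:{- b..- a}|lborel. f' x)"
    using lborel_integral_real_affine[of "- 1" "\<lambda>x. indicator {-b..-a} x *\<^sub>R f' x" 0]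
    by (simp add: set_lebesgue_integral_def ind)
  then show "(LINT x:{a..b}|lborel. - f' (- x)) = f (- b) - f (- a)"
    using has_ac_derivativeD(2)[OF assms, of "- b" "- a"] ab by simp
qed

lemma has_ac_derivative_zero_imp_const:
  assumes f: "has_ac_derivative f f'" and "AE x in lborel. f' x = 0"
  shows "f x = f y"
proof -
  have "has_ac_derivative f (\<lambda>x. 0)"
    by (rule has_ac_derivative_cong_AE[OF f]) (use assms(2) in auto)
  then have "f b = f a" if "a \<le> b" for a b
    using has_ac_derivativeD(2)[OF _ that, of f "\<lambda>x. 0"] by (simp add: set_lebesgue_integral_def)
  then show ?thesis by (metis linear)
qed

lemma has_ac_derivative_const_on_imp_zero:
  assumes f: "has_ac_derivative f f'" and const: "\<And>x. x \<in> {p..q} \<Longrightarrow> f x = C"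
  shows "AE x in lborel. x \<in> {p..q} \<longrightarrow> f' x = 0"
proof -
  note L = has_ac_derivativeD(1)[OF f]
  have [measurable]: "f' \<in> borel_measurable borel" using L1_locD(1)[OF L] .
  have ind: "indicator {a..b} x *\<^sub>R (indicator {p..q} x *\<^sub>R f' x) = indicator {max a p..min b q} x *\<^sub>R f' x" for a b x
    by (auto simp: indicator_def)
  have "AE x in lborel. indicator {p..q} x *\<^sub>R f' x = 0"
  proof (rule AE_zero_intervals)
    show "(\<lambda>x. indicator {p..q} x *\<^sub>R f' x) \<in> L1_loc"
    proof (rule L1_locI)
      show "set_integrable lborel {a..b} (\<lambda>x. indicator {p..q} x *\<^sub>R f' x)" for a b
        using L1_locD(2)[OF L, of "max a p" "min b q"] by (simp only: set_integrable_def ind)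
    qed simp
    fix a b :: real
    show "(LINT x:{a..b}|lborel. indicator {p..q} x *\<^sub>R f' x) = 0"
    proof (cases "max a p \<le> min b q")
      case True
      then show ?thesis
        using has_ac_derivativeD(2)[OF f True] const[of "max a p"] const[of "min b q"]
        unfolding set_lebesgue_integral_def ind by simp
    next
      case False
      then have "{max a p..min b q} = {}" by auto
      then show ?thesis unfolding set_lebesgue_integral_def ind by simp
    qed
  qed
  then show ?thesis by eventually_elim (auto simp: indicator_def)
qed

section \<open>Local extrema and monotonicity\<close>

lemma local_extremum_uminus: "local_extremum (\<lambda>x. - f x) x \<longleftrightarrow> local_extremum f x"
  by (auto simp: local_extremum_def)

lemma local_extremum_reflect:
  assumes "local_extremum (\<lambda>x. f (- x)) x"
  shows "local_extremum f (- x)"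
proof -
  have "filtermap uminus (nhds (- x)) = nhds (x :: real)"
    by (simp add: filtermap_nhds_minus)
  then have "eventually P (nhds x) \<longleftrightarrow> eventually (\<lambda>y. P (- y)) (nhds (- x))" for P
    by (metis eventually_filtermap)
  then show ?thesis using assms by (simp add: local_extremum_def)
qed

lemma interior_local_max:
  fixes f :: "real \<Rightarrow> real"
  assumes f: "continuous_on {a..b} f" and x: "x \<in> {a<..<b}" "f a < f x" "f b < f x"
  obtains z where "z \<in> {a<..<b}" "local_extremum f z" "f x \<le> f z"
proof -
  obtain z where z: "z \<in> {a..b}" "\<And>y. y \<in> {a..b} \<Longrightarrow> f y \<le> f z"
    using continuous_attains_sup[OF compact_Icc _ f] x(1) by force
  have fz: "f x \<le> f z" using z(2)[of x] x(1) by auto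
  then have "z \<noteq> a" "z \<noteq> b" using x by auto
  then have zi: "z \<in> {a<..<b}" using z(1) by auto
  have "\<forall>\<^sub>F y in nhds z. y \<in> {a<..<b}" using zi by (intro eventually_nhds_in_open) auto
  then have "\<forall>\<^sub>F y in nhds z. f y \<le> f z" by eventually_elim (use z(2) in auto)
  then show ?thesis using that[OF zi _ fz] by (simp add: local_extremum_def)
qed

lemma interior_local_extremum:
  fixes f :: "real \<Rightarrow> real"
  assumes f: "continuous_on {a..b} f" and x: "x \<in> {a<..<b}" "f a = f b" "f x \<noteq> f a"
  obtains z where "z \<in> {a<..<b}" "local_extremum f z" "f z \<noteq> f a"
proof (cases "f a < f x")
  case True
  obtain z where "z \<in> {a<..<b}" "local_extremum f z" "f x \<le> f z"
    by (rule interior_local_max[OF f x(1) True]) (use x True in auto)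
  then show ?thesis using True that[of z] by simp
next
  case False
  then have lt: "f x < f a" using x by simp
  have c: "continuous_on {a..b} (\<lambda>x. - f x)" by (intro continuous_intros f)
  obtain z where "z \<in> {a<..<b}" "local_extremum (\<lambda>x. - f x) z" "- f x \<le> - f z"
    by (rule interior_local_max[OF c x(1)]) (use x lt in auto)
  then show ?thesis using lt that[of z] by (simp add: local_extremum_uminus)
qed

text \<open>Between two points with equal values there is an interior extremum. If the function is
  constant between them, any point in between is one, since \<open>local_extremum\<close> is not
  strict.\<close>

lemma no_extremum_inj_on:
  fixes f :: "real \<Rightarrow> real"
  assumes f: "continuous_on {a..b} f" and ne: "\<And>x. x \<in> {a<..<b} \<Longrightarrow> \<not> local_extremum f x"
  shows "inj_on f {a..b}"
proof -
  have False if xy: "x \<in> {a..b}" "y \<in> {a..b}" "x < y" "f x = f y" for x y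
  proof (cases "\<exists>z\<in>{x<..<y}. f z \<noteq> f x")
    case True
    then obtain z where z: "z \<in> {x<..<y}" "f z \<noteq> f x" by blast
    have c: "continuous_on {x..y} f" using f xy by (auto elim!: continuous_on_subset)
    obtain w where "w \<in> {x<..<y}" "local_extremum f w"
      by (rule interior_local_extremum[OF c z(1) xy(4) z(2)]) blast
    then show False using ne[of w] xy by auto
  next
    case False
    define z where "z = (x + y) / 2"
    have z: "z \<in> {x<..<y}" using xy by (simp add: z_def)
    have "\<forall>\<^sub>F w in nhds z. w \<in> {x<..<y}" using z by (intro eventually_nhds_in_open) auto
    then have "\<forall>\<^sub>F w in nhds z. f w \<le> f z" by eventually_elim (use False z in auto)
    then have "local_extremum f z" by (simp add: local_extremum_def)
    then show False using ne[of z] z xy by auto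
  qed
  then show ?thesis by (metis inj_onI linorder_neq_iff)
qed

text \<open>Everything is resolved along the orthogonal directions z and \<i>z. The last two
  decompositions of p are multiplied by \<bar>z\<bar>^2 instead of being divided by it, because an
  arbitrary solution is not known to be free of zeros.\<close>

lemma TW_algebra:
  fixes z p :: complex and c \<kappa> :: real
  defines "w \<equiv> TW_flux \<kappa> z p" and "F \<equiv> TW_source c \<kappa> z p"
  shows "z \<bullet> w = (z \<bullet> p) * (1 - 2 * \<kappa> * (cmod z)\<^sup>2)"
    and "(\<i> * z) \<bullet> w = (\<i> * z) \<bullet> p"
    and "(\<i> * z) \<bullet> (- F) + (\<i> * p) \<bullet> w = - c * (z \<bullet> p)"
    and "(cmod z)\<^sup>2 * (cmod p)\<^sup>2 = (z \<bullet> p)\<^sup>2 + ((\<i> * z) \<bullet> p)\<^sup>2"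
    and "complex_of_real ((cmod z)\<^sup>2) * p = Complex (z \<bullet> p) ((\<i> * z) \<bullet> p) * z"
    and "z \<bullet> (- F) + p \<bullet> w = c * ((\<i> * z) \<bullet> p) - (cmod z)\<^sup>2 * (1 - (cmod z)\<^sup>2) - 4 * \<kappa> * (z \<bullet> p)\<^sup>2 + (cmod p)\<^sup>2"
proof -
  obtain a b where z: "z = Complex a b" by (cases z)
  obtain s t where p: "p = Complex s t" by (cases p)
  note d = z p w_def F_def TW_flux_def TW_source_def inner_complex_def cmod_power2 complex_eq_iff
  show "z \<bullet> w = (z \<bullet> p) * (1 - 2 * \<kappa> * (cmod z)\<^sup>2)"
    by (simp add: d) (simp add: algebra_simps power2_eq_square)
  show "(\<i> * z) \<bullet> w = (\<i> * z) \<bullet> p"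
    by (simp add: d) (simp add: algebra_simps power2_eq_square)
  show "(\<i> * z) \<bullet> (- F) + (\<i> * p) \<bullet> w = - c * (z \<bullet> p)"
    by (simp add: d) (simp add: algebra_simps power2_eq_square)
  show "(cmod z)\<^sup>2 * (cmod p)\<^sup>2 = (z \<bullet> p)\<^sup>2 + ((\<i> * z) \<bullet> p)\<^sup>2"
    by (simp add: d) (simp add: algebra_simps power2_eq_square)
  show "complex_of_real ((cmod z)\<^sup>2) * p = Complex (z \<bullet> p) ((\<i> * z) \<bullet> p) * z"
    by (simp add: d) (simp add: algebra_simps power2_eq_square)
  show "z \<bullet> (- F) + p \<bullet> w = c * ((\<i> * z) \<bullet> p) - (cmod z)\<^sup>2 * (1 - (cmod z)\<^sup>2) - 4 * \<kappa> * (z \<bullet> p)\<^sup>2 + (cmod p)\<^sup>2"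
    by (simp add: d) (simp add: algebra_simps power2_eq_square)
qed

text \<open>The equations between \<open>y = 1 - \<bar>v\<bar>\<^sup>2\<close>, \<open>e = y'\<close>, \<open>m = (1 - 2\<kappa>(1 - y)) y'\<close>, \<open>d = m'\<close>
  and \<open>l = \<bar>v'\<bar>\<close> that remain once the momentum is known to vanish.\<close>

definition TW_scalar :: "real \<Rightarrow> real \<Rightarrow> real \<Rightarrow> real \<Rightarrow> real \<Rightarrow> real \<Rightarrow> real \<Rightarrow> bool" where
  "TW_scalar c \<kappa> y e m d l \<longleftrightarrow> m = (1 - 2 * \<kappa> * (1 - y)) * e \<and>
     4 * (1 - y) * l\<^sup>2 = e\<^sup>2 + c\<^sup>2 * y\<^sup>2 \<and>
     d = - 2 * l\<^sup>2 + 2 * \<kappa> * e\<^sup>2 - c\<^sup>2 * y + 2 * (1 - y) * y"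

text \<open>The momentum \<open>\<langle>\<i>v, v'\<rangle> - c(1 - \<bar>v\<bar>\<^sup>2)/2\<close> is conserved, and it vanishes because it is
  arbitrarily small at points far out. This leaves a system for \<open>1 - \<bar>v\<bar>\<^sup>2\<close> alone.\<close>

lemma TW_scalar_system:
  assumes TW: "TW_weak_solution c \<kappa> v"
  obtains p e m m' where
    "has_ac_derivative v p" "has_ac_derivative (\<eta> v) e" "has_ac_derivative m m'"
    "integrable lborel (\<lambda>x. (\<eta> v x)\<^sup>2 + (cmod (p x))\<^sup>2)"
    "AE x in lborel. TW_scalar c \<kappa> (\<eta> v x) (e x) (m x) (m' x) (cmod (p x)) \<and>
      complex_of_real (1 - \<eta> v x) * p x = Complex (- e x / 2) (c * \<eta> v x / 2) * v x"
proof -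
  obtain p W where vp: "has_ac_derivative v p"
    and p2: "integrable lborel (\<lambda>x. (cmod (p x))\<^sup>2)" and e2: "integrable lborel (\<lambda>x. (1 - (cmod (v x))\<^sup>2)\<^sup>2)"
    and W: "has_ac_derivative W (\<lambda>x. - TW_source c \<kappa> (v x) (p x))"
    and Wp: "AE x in lborel. W x = TW_flux \<kappa> (v x) (p x)"
    by (rule TW_weak_solutionD[OF TW]) (rule that; assumption)
  have D: "(cmod (v x))\<^sup>2 = 1 - \<eta> v x" for x by (simp add: \<eta>_def)
  define e where "e x = - 2 * (v x \<bullet> p x)" for x
  have "has_ac_derivative (\<lambda>x. 1 - v x \<bullet> v x) (\<lambda>x. 0 - (v x \<bullet> p x + p x \<bullet> v x))"
    by (intro has_ac_derivative_diff has_ac_derivative_const has_ac_derivative_inner vp)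
  moreover have "(\<lambda>x. 1 - v x \<bullet> v x) = \<eta> v" by (simp add: \<eta>_def fun_eq_iff power2_norm_eq_inner)
  moreover have "(\<lambda>x. 0 - (v x \<bullet> p x + p x \<bullet> v x)) = e" by (simp add: e_def fun_eq_iff inner_commute)
  ultimately have ye: "has_ac_derivative (\<eta> v) e" by simp
  define m where "m x = - 2 * (v x \<bullet> W x)" for x
  define m' where "m' x = - 2 * (v x \<bullet> (- TW_source c \<kappa> (v x) (p x)) + p x \<bullet> W x)" for x
  have mm: "has_ac_derivative m m'"
    unfolding m_def[abs_def] m'_def[abs_def]
    by (rule has_ac_derivative_bounded_linear[OF bounded_linear_mult_right has_ac_derivative_inner[OF vp W]])
  \<comment> \<open>The momentum with W in place of v', which makes it absolutely continuous; along
    \<i>v flux and derivative agree.\<close>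
  define b where "b x = (\<i> * v x) \<bullet> W x - c / 2 * \<eta> v x" for x
  have "has_ac_derivative b (\<lambda>x. ((\<i> * v x) \<bullet> (- TW_source c \<kappa> (v x) (p x)) + (\<i> * p x) \<bullet> W x) - c / 2 * e x)"
    unfolding b_def[abs_def]
    by (intro has_ac_derivative_diff has_ac_derivative_inner W
        has_ac_derivative_bounded_linear[OF bounded_linear_mult_right] vp ye)
  moreover have "AE x in lborel. ((\<i> * v x) \<bullet> (- TW_source c \<kappa> (v x) (p x)) + (\<i> * p x) \<bullet> W x) - c / 2 * e x = 0"
    using Wp by eventually_elim (simp only: TW_algebra(3), simp add: e_def)
  ultimately have bconst: "b x = b 0" for x by (rule has_ac_derivative_zero_imp_const)
  have int: "integrable lborel (\<lambda>x. (\<eta> v x)\<^sup>2 + (cmod (p x))\<^sup>2)"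
    using p2 e2 by (simp add: \<eta>_def)
  \<comment> \<open>Points going to infinity at which the flux identity holds exactly and the energy
    density tends to 0.\<close>
  obtain X where X: "\<And>n. real n < X n" "\<And>n. W (X n) = TW_flux \<kappa> (v (X n)) (p (X n))"
    "(\<lambda>n. (\<eta> v (X n))\<^sup>2 + (cmod (p (X n)))\<^sup>2) \<longlonglongrightarrow> 0"
    by (rule small_sequence[OF int sum_power2_ge_zero Wp]) (rule that; assumption)
  have "(\<lambda>n. (\<eta> v (X n))\<^sup>2) \<longlonglongrightarrow> 0" "(\<lambda>n. (cmod (p (X n)))\<^sup>2) \<longlonglongrightarrow> 0"
    by (rule tendsto_sandwich[OF _ _ tendsto_const X(3)]; simp)+
  then have y0: "(\<lambda>n. \<eta> v (X n)) \<longlonglongrightarrow> 0" and p0: "(\<lambda>n. cmod (p (X n))) \<longlonglongrightarrow> 0"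
    by (auto intro: tendsto_zero_of_power2)
  have lim: "(\<lambda>n. sqrt (1 - \<eta> v (X n)) * cmod (p (X n)) + \<bar>c / 2\<bar> * \<bar>\<eta> v (X n)\<bar>) \<longlonglongrightarrow> sqrt (1 - 0) * 0 + \<bar>c / 2\<bar> * \<bar>0\<bar>"
    by (intro tendsto_intros y0 p0)
  have "\<bar>b 0\<bar> \<le> sqrt (1 - \<eta> v (X n)) * cmod (p (X n)) + \<bar>c / 2\<bar> * \<bar>\<eta> v (X n)\<bar>" for n
  proof -
    have "b 0 = (\<i> * v (X n)) \<bullet> p (X n) - c / 2 * \<eta> v (X n)"
      using bconst[of "X n"] by (simp add: b_def X(2) TW_algebra(2))
    moreover have "cmod (v (X n)) = sqrt (1 - \<eta> v (X n))"
      using D[of "X n"] by (metis norm_ge_zero real_sqrt_unique)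
    then have "\<bar>(\<i> * v (X n)) \<bullet> p (X n)\<bar> \<le> sqrt (1 - \<eta> v (X n)) * cmod (p (X n))"
      using Cauchy_Schwarz_ineq2[of "\<i> * v (X n)" "p (X n)"] by (simp add: norm_mult)
    moreover have "\<bar>c / 2 * \<eta> v (X n)\<bar> = \<bar>c / 2\<bar> * \<bar>\<eta> v (X n)\<bar>" by (rule abs_mult)
    ultimately show ?thesis by linarith
  qed
  then have "\<bar>b 0\<bar> \<le> sqrt (1 - 0) * 0 + \<bar>c / 2\<bar> * \<bar>0\<bar>"
    by (intro tendsto_lowerbound[OF lim]) auto
  then have bz: "b x = 0" for x using bconst[of x] by simp
  have "AE x in lborel. TW_scalar c \<kappa> (\<eta> v x) (e x) (m x) (m' x) (cmod (p x)) \<and>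
      complex_of_real (1 - \<eta> v x) * p x = Complex (- e x / 2) (c * \<eta> v x / 2) * v x"
    using Wp
  proof eventually_elim
    case (elim x)
    have a: "v x \<bullet> p x = - e x / 2" by (simp add: e_def)
    have ib: "(\<i> * v x) \<bullet> p x = c * \<eta> v x / 2"
      using bz[of x] by (simp add: b_def elim TW_algebra(2))
    note alg = TW_algebra[where z = "v x" and p = "p x", unfolded D a ib]
    show ?case unfolding TW_scalar_def
    proof (intro conjI)
      show "m x = (1 - 2 * \<kappa> * (1 - \<eta> v x)) * e x" unfolding m_def elim alg(1) by simp
      show "4 * (1 - \<eta> v x) * (cmod (p x))\<^sup>2 = (e x)\<^sup>2 + c\<^sup>2 * (\<eta> v x)\<^sup>2"
        using alg(4) by (simp add: power2_eq_square field_simps)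
      show "m' x = - 2 * (cmod (p x))\<^sup>2 + 2 * \<kappa> * (e x)\<^sup>2 - c\<^sup>2 * \<eta> v x + 2 * (1 - \<eta> v x) * \<eta> v x"
        unfolding m'_def elim alg(6) by (simp add: power_divide power2_eq_square algebra_simps)
      show "complex_of_real (1 - \<eta> v x) * p x = Complex (- e x / 2) (c * \<eta> v x / 2) * v x" by (rule alg(5))
    qed
  qed
  then show ?thesis using that[OF vp ye mm int] by blast
qed


section \<open>Uniqueness of the profile on a half line\<close>

lemma (in TW_profile) weight_eq: "1 - 2 * \<kappa> * (1 - z) = 2 * \<kappa> * (z - edge)"
  using edge_\<kappa> by (simp add: algebra_simps)

lemma (in TW_profile) continuous_on_pos_diff:
  assumes "continuous_on S t"
  shows "continuous_on S (\<lambda>x. pos (t x) - x)"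
proof -
  have "continuous_on UNIV pos" using continuous_pos by (simp add: continuous_at_imp_continuous_on)
  from continuous_on_compose2[OF this assms subset_UNIV] show ?thesis
    by (intro continuous_on_diff continuous_on_id)
qed

text \<open>X runs to plus infinity only: the argument covers x \<ge> 0, and the other half line is
  reached by applying it to the reflected function. \<open>no_plateau\<close> is the algebraic
  condition that keeps the constant value \<open>edge\<close> from satisfying the equations.\<close>

locale TW_candidate = TW_profile +
  fixes y e m m' l :: "real \<Rightarrow> real" and X :: "nat \<Rightarrow> real"
  assumes ac_y: "has_ac_derivative y e" and ac_m: "has_ac_derivative m m'"
    and sys: "AE x in lborel. TW_scalar c \<kappa> (y x) (e x) (m x) (m' x) (l x)"
    and X_large: "\<And>n. real n < X n" and X_sys: "\<And>n. m (X n) = (1 - 2 * \<kappa> * (1 - y (X n))) * e (X n)"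
    and y_X: "(\<lambda>n. y (X n)) \<longlonglongrightarrow> 0" and e_X: "(\<lambda>n. e (X n)) \<longlonglongrightarrow> 0"
    and y_0: "y 0 = \<eta>\<^sub>0" and extremum_0: "local_extremum y 0"
    and only_extremum: "\<And>x. y x \<noteq> edge \<Longrightarrow> local_extremum y x \<Longrightarrow> x = 0"
    and no_plateau: "edge \<noteq> 0 \<Longrightarrow> 4 * (1 - edge)\<^sup>2 - c\<^sup>2 * (1 - edge) - c\<^sup>2 \<noteq> 0"
begin

text \<open>The first integral solved for its constant K. The term m^2 divided by the weight
  replaces the weight times y'^2, because m is continuous while e is known only almost
  everywhere.\<close>

definition "first_integral x =
  ((m x)\<^sup>2 / (1 - 2 * \<kappa> * (1 - y x)) - (y x)\<^sup>2 * (2 - c\<^sup>2 - 2 * y x)) / (1 - y x)"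

text \<open>The continuous representative of y' off the level \<open>edge\<close>, obtained from
  m.\<close>

definition "dy x = m x / (1 - 2 * \<kappa> * (1 - y x))"

lemma continuous_y: "continuous_on S y" and continuous_m: "continuous_on S m"
  using has_ac_derivative_continuous_on ac_y ac_m by auto

lemma weight_nonzero: "y x \<noteq> edge \<Longrightarrow> 1 - 2 * \<kappa> * (1 - y x) \<noteq> 0"
  using \<kappa>_pos by (simp add: weight_eq)

lemma continuous_dy: "\<forall>x\<in>S. y x \<noteq> edge \<Longrightarrow> continuous_on S dy"
  unfolding dy_def using weight_nonzero by (intro continuous_intros continuous_y continuous_m) auto

lemma y_has_derivative:
  assumes S: "open S" "x \<in> S" "\<forall>x\<in>S. y x \<noteq> edge"
  shows "(y has_real_derivative dy x) (at x)"
proof -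
  have "(y has_vector_derivative dy x) (at x)"
  proof (rule has_ac_derivative_has_vector_derivative[OF ac_y S(1,2) continuous_dy[OF S(3)]])
    show "AE x in lborel. x \<in> S \<longrightarrow> e x = dy x"
      using sys by eventually_elim (use S(3) weight_nonzero in \<open>auto simp: dy_def TW_scalar_def\<close>)
  qed
  then show ?thesis by (simp add: has_real_derivative_iff_has_vector_derivative)
qed

lemma m_has_derivative:
  assumes S: "open S" "x \<in> S" "\<forall>x\<in>S. y x \<noteq> edge \<and> y x < 1"
  shows "(m has_real_derivative TW_rhs c \<kappa> (y x) (dy x)) (at x)"
proof -
  have S': "\<forall>x\<in>S. y x \<noteq> edge" using S by blast
  have "continuous_on S (\<lambda>x. TW_rhs c \<kappa> (y x) (dy x))"
    unfolding TW_rhs_def using S(3)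
    by (intro continuous_intros continuous_y continuous_dy[OF S']) auto
  then have "(m has_vector_derivative TW_rhs c \<kappa> (y x) (dy x)) (at x)"
  proof (rule has_ac_derivative_has_vector_derivative[OF ac_m S(1,2)])
    show "AE x in lborel. x \<in> S \<longrightarrow> m' x = TW_rhs c \<kappa> (y x) (dy x)"
      using sys
    proof eventually_elim
      case (elim x)
      note elim = elim[unfolded TW_scalar_def]
      show ?case
      proof
        assume x: "x \<in> S"
        then have "e x = dy x" using elim S weight_nonzero[of x] by (auto simp: dy_def)
        moreover have "2 * (l x)\<^sup>2 = ((e x)\<^sup>2 + c\<^sup>2 * (y x)\<^sup>2) / (2 * (1 - y x))"
        proof (rule eq_divide_imp)
          show "2 * (1 - y x) \<noteq> 0" using S(3) x by auto
          have "2 * (l x)\<^sup>2 * (2 * (1 - y x)) = 4 * (1 - y x) * (l x)\<^sup>2" by simp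
          also have "\<dots> = (e x)\<^sup>2 + c\<^sup>2 * (y x)\<^sup>2" using elim by blast
          finally show "2 * (l x)\<^sup>2 * (2 * (1 - y x)) = (e x)\<^sup>2 + c\<^sup>2 * (y x)\<^sup>2" .
        qed
        ultimately show "m' x = TW_rhs c \<kappa> (y x) (dy x)" using elim
          by (simp add: TW_rhs_def) (simp add: minus_divide_left)
      qed
    qed
  qed
  then show ?thesis by (simp add: has_real_derivative_iff_has_vector_derivative)
qed

text \<open>With m = g y', where g is the weight, the derivative of m^2/g is 2 y' m' - 2\<kappa>
  y'^3. Inserting \<open>TW_rhs\<close> for m' makes all terms cancel.\<close>

lemma first_integral_has_derivative:
  assumes S: "open S" "x \<in> S" "\<forall>x\<in>S. y x \<noteq> edge \<and> y x < 1"
  shows "(first_integral has_real_derivative 0) (at x)"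
proof -
  define R D g Z where "R = TW_rhs c \<kappa> (y x) (dy x)" and "D = 1 - y x" and "g = 1 - 2 * \<kappa> * D" and "Z = dy x"
  have dyx: "(y has_real_derivative Z) (at x)" unfolding Z_def by (rule y_has_derivative[OF S(1,2)]) (use S in blast)
  have dm: "(m has_real_derivative R) (at x)" unfolding R_def by (rule m_has_derivative[OF S])
  have g: "g \<noteq> 0" using weight_nonzero S by (simp add: g_def D_def)
  have D: "D > 0" using S by (simp add: D_def)
  have mx: "m x = g * Z" using g by (simp add: Z_def dy_def g_def D_def)
  have "((\<lambda>x. 1 - y x) has_real_derivative - Z) (at x)"
    using DERIV_diff[OF DERIV_const dyx, of 1] by simp
  note d1 = this
  have dg: "((\<lambda>x. 1 - 2 * \<kappa> * (1 - y x)) has_real_derivative 2 * \<kappa> * Z) (at x)"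
    using DERIV_diff[OF DERIV_const DERIV_cmult[OF d1, of "2 * \<kappa>"], of 1] by simp
  have dm2: "((\<lambda>x. (m x)\<^sup>2) has_real_derivative 2 * m x * R) (at x)"
    using DERIV_power[OF dm, of 2] by (simp add: ac_simps)
  have "((\<lambda>x. (m x)\<^sup>2 / (1 - 2 * \<kappa> * (1 - y x))) has_real_derivative
      (2 * m x * R * g - (m x)\<^sup>2 * (2 * \<kappa> * Z)) / (g * g)) (at x)"
    using DERIV_divide[OF dm2 dg] g by (simp add: g_def D_def)
  moreover have "(2 * m x * R * g - (m x)\<^sup>2 * (2 * \<kappa> * Z)) / (g * g) = 2 * Z * R - 2 * \<kappa> * Z ^ 3"
    unfolding mx using g by (simp add: field_simps power2_eq_square power3_eq_cube)
  ultimately have A: "((\<lambda>x. (m x)\<^sup>2 / (1 - 2 * \<kappa> * (1 - y x))) has_real_derivative 2 * Z * R - 2 * \<kappa> * Z ^ 3) (at x)"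
    by simp
  have dy2: "((\<lambda>x. (y x)\<^sup>2) has_real_derivative 2 * y x * Z) (at x)"
    using DERIV_power[OF dyx, of 2] by (simp add: ac_simps)
  have da: "((\<lambda>x. 2 - c\<^sup>2 - 2 * y x) has_real_derivative - (2 * Z)) (at x)"
    using DERIV_diff[OF DERIV_const DERIV_cmult[OF dyx, of 2], of "2 - c\<^sup>2"] by simp
  have B: "((\<lambda>x. (y x)\<^sup>2 * (2 - c\<^sup>2 - 2 * y x)) has_real_derivative
      2 * y x * Z * (2 - c\<^sup>2 - 2 * y x) + - (2 * Z) * (y x)\<^sup>2) (at x)"
    by (rule DERIV_mult[OF dy2 da])
  define N where "N = (m x)\<^sup>2 / (1 - 2 * \<kappa> * (1 - y x)) - (y x)\<^sup>2 * (2 - c\<^sup>2 - 2 * y x)"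
  have N: "N = g * Z\<^sup>2 - (y x)\<^sup>2 * (2 - c\<^sup>2 - 2 * y x)"
    unfolding N_def mx using g by (simp add: g_def D_def power2_eq_square)
  have nz: "1 - y x \<noteq> 0" using D by (simp add: D_def)
  have "(first_integral has_real_derivative ((2 * Z * R - 2 * \<kappa> * Z ^ 3 - (2 * y x * Z * (2 - c\<^sup>2 - 2 * y x) + - (2 * Z) * (y x)\<^sup>2)) * (1 - y x)
      - N * - Z) / ((1 - y x) * (1 - y x))) (at x)"
    unfolding first_integral_def[abs_def] N_def by (rule DERIV_divide[OF DERIV_diff[OF A B] d1 nz])
  moreover have "(2 * Z * R - 2 * \<kappa> * Z ^ 3 - (2 * y x * Z * (2 - c\<^sup>2 - 2 * y x) + - (2 * Z) * (y x)\<^sup>2)) * (1 - y x) - N * - Z = 0"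
  proof -
    have yx: "y x = 1 - D" by (simp add: D_def)
    have "(2 * Z * R - 2 * \<kappa> * Z ^ 3 - (2 * y x * Z * (2 - c\<^sup>2 - 2 * y x) + - (2 * Z) * (y x)\<^sup>2)) * (1 - y x) - N * - Z =
      Z * (2 * D * R - 2 * \<kappa> * Z\<^sup>2 * D - (2 * y x * (2 - c\<^sup>2 - 2 * y x) - 2 * (y x)\<^sup>2) * D + N)"
      unfolding yx by (simp add: algebra_simps power2_eq_square power3_eq_cube)
    also have "2 * D * R = - (Z\<^sup>2 + c\<^sup>2 * (y x)\<^sup>2) + 2 * D * (2 * \<kappa> * Z\<^sup>2 - c\<^sup>2 * y x + 2 * D * y x)"
      using TW_rhs_cleared[of Z "Z\<^sup>2" 1 "y x" c \<kappa>] D by (simp add: D_def R_def Z_def)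
    finally show ?thesis unfolding N g_def yx by (simp add: algebra_simps power2_eq_square)
  qed
  ultimately show ?thesis by simp
qed

lemma first_integral_const:
  assumes S: "open S" "convex S" "\<forall>x\<in>S. y x \<noteq> edge \<and> y x < 1" and x: "a \<in> S" "x \<in> S"
  shows "first_integral x = first_integral a"
proof -
  have "\<exists>k. \<forall>x\<in>S. first_integral x = k"
    using S first_integral_has_derivative[OF S(1) _ S(3)]
    by (intro has_field_derivative_zero_constant) (auto intro: has_field_derivative_at_within)
  then show ?thesis using x by auto
qed

lemma first_integral_eq:
  assumes "y x \<noteq> edge" "y x < 1"
  shows "(1 - 2 * \<kappa> * (1 - y x)) * (dy x)\<^sup>2 = (y x)\<^sup>2 * (2 - c\<^sup>2 - 2 * y x) + first_integral x * (1 - y x)"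
proof -
  have "first_integral x * (1 - y x) = (m x)\<^sup>2 / (1 - 2 * \<kappa> * (1 - y x)) - (y x)\<^sup>2 * (2 - c\<^sup>2 - 2 * y x)"
    using assms by (simp add: first_integral_def)
  moreover have "(1 - 2 * \<kappa> * (1 - y x)) * (dy x)\<^sup>2 = (m x)\<^sup>2 / (1 - 2 * \<kappa> * (1 - y x))"
    using weight_nonzero[OF assms(1)] by (simp add: dy_def power_divide power2_eq_square)
  ultimately show ?thesis by simp
qed

lemma X_eventually_gt: "\<forall>\<^sub>F n in sequentially. p < X n"
proof -
  obtain k where k: "p < real k" using reals_Archimedean2 by blast
  have "p < X n" if "n \<ge> k" for n
    using k X_large[of n] that by (meson less_trans of_nat_mono order_less_le_trans)
  then show ?thesis by (auto simp: eventually_sequentially)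
qed

text \<open>The first integral is constant on the half line, so its value may be read off along X,
  where y and e tend to 0.\<close>

lemma first_integral_outer:
  assumes S: "\<forall>x\<in>{p<..}. y x \<noteq> edge \<and> y x < 1" and x: "p < x"
  shows "first_integral x = 0"
proof -
  have "(\<lambda>n. ((1 - 2 * \<kappa> * (1 - y (X n))) * (e (X n))\<^sup>2 - (y (X n))\<^sup>2 * (2 - c\<^sup>2 - 2 * y (X n))) / (1 - y (X n)))
     \<longlonglongrightarrow> ((1 - 2 * \<kappa> * (1 - 0)) * 0\<^sup>2 - 0\<^sup>2 * (2 - c\<^sup>2 - 2 * 0)) / (1 - 0)"
    by (intro tendsto_intros y_X e_X) simp
  moreover have "\<forall>\<^sub>F n in sequentially. ((1 - 2 * \<kappa> * (1 - y (X n))) * (e (X n))\<^sup>2 - (y (X n))\<^sup>2 * (2 - c\<^sup>2 - 2 * y (X n))) / (1 - y (X n)) = first_integral x"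
    using X_eventually_gt[of p]
  proof eventually_elim
    case (elim n)
    then have "first_integral x = first_integral (X n)"
      by (intro first_integral_const[OF _ _ S]) (use x in auto)
    then show ?case
      using weight_nonzero[of "X n"] S elim
      by (simp add: first_integral_def X_sys power_mult_distrib power2_eq_square)
  qed
  ultimately have "(\<lambda>n. first_integral x) \<longlonglongrightarrow> 0"
    by (simp add: tendsto_cong)
  then show ?thesis by (simp add: LIMSEQ_const_iff)
qed

lemma near_0: obtains \<delta> where "\<delta> > 0" "\<And>x. \<bar>x\<bar> < \<delta> \<Longrightarrow> y x < edge"
proof -
  have "open {x. y x < edge}" using continuous_y[of UNIV] by (intro open_Collect_less) auto
  moreover have "0 \<in> {x. y x < edge}" using y_0 \<eta>\<^sub>0_neg by simp
  ultimately obtain \<delta> where "\<delta> > 0" "ball 0 \<delta> \<subseteq> {x. y x < edge}" by (rule openE)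
  then show ?thesis using that[of \<delta>] by (auto simp: dist_real_def subset_iff)
qed

lemma first_integral_0: "first_integral 0 = K\<^sub>0"
proof -
  obtain \<delta> where \<delta>: "\<delta> > 0" "\<And>x. \<bar>x\<bar> < \<delta> \<Longrightarrow> y x < edge" by (rule near_0) (rule that; assumption)
  have "y x \<noteq> edge" if "x \<in> {-\<delta><..<\<delta>}" for x
  proof -
    have "\<bar>x\<bar> < \<delta>" using that by auto
    then show ?thesis using \<delta>(2) by force
  qed
  then have "(y has_real_derivative dy 0) (at 0)"
    by (intro y_has_derivative[of "{-\<delta><..<\<delta>}"]) (use \<delta>(1) in auto)
  then have "dy 0 = 0" by (rule local_extremum_deriv[OF extremum_0])
  then have "m 0 = 0" using weight_nonzero[of 0] \<eta>\<^sub>0_neg y_0 by (simp add: dy_def)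
  then show ?thesis by (simp add: first_integral_def y_0 K\<^sub>0_def)
qed

text \<open>Otherwise y stays below \<open>edge\<close> on an unbounded interval that contains 0 in
  its interior. There the first integral is zero by decay, but at 0 it is the negative number
  \<open>K\<^sub>0\<close>.\<close>

lemma reaches_edge: "\<exists>x>0. y x = edge"
proof (rule ccontr)
  assume "\<not> ?thesis"
  then have ne: "\<And>x. 0 < x \<Longrightarrow> y x \<noteq> edge" by auto
  obtain \<delta> where \<delta>: "\<delta> > 0" "\<And>x. \<bar>x\<bar> < \<delta> \<Longrightarrow> y x < edge" by (rule near_0) (rule that; assumption)
  have lt: "y x < edge" if "- \<delta> < x" for x
  proof (rule ccontr)
    assume "\<not> y x < edge"
    then have x: "x \<ge> \<delta>" using \<delta>(2)[of x] that by linarith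
    have "\<exists>z\<ge>0. z \<le> x \<and> y z = edge"
      using \<open>\<not> y x < edge\<close> x \<delta> \<eta>\<^sub>0_neg y_0 continuous_y by (intro IVT') auto
    then obtain z where "0 \<le> z" "y z = edge" by blast
    then show False using ne[of z] y_0 \<eta>\<^sub>0_neg by (cases "z = 0") auto
  qed
  have "first_integral 0 = 0"
  proof (rule first_integral_outer)
    show "\<forall>x\<in>{- \<delta><..}. y x \<noteq> edge \<and> y x < 1" using lt edge_less_1 by fastforce
  qed (use \<delta> in simp)
  then show False using first_integral_0 K\<^sub>0_neg by simp
qed

lemma first_hit: obtains b where "0 < b" "y b = edge" "\<And>x. 0 \<le> x \<Longrightarrow> x < b \<Longrightarrow> y x < edge"
proof -
  define T where "T = {x. 0 \<le> x} \<inter> {x. y x = edge}"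
  obtain x0 where "x0 > 0" "y x0 = edge" using reaches_edge by blast
  then have "x0 \<in> T" by (simp add: T_def)
  then have T1: "T \<noteq> {}" by blast
  have T2: "bdd_below T" by (rule bdd_belowI[of _ 0]) (simp add: T_def)
  have T3: "closed T" unfolding T_def
    by (intro closed_Int closed_Collect_le closed_Collect_eq continuous_intros continuous_y)
  note T = T1 T2 T3
  define b where "b = Inf T"
  have b: "b \<in> T" unfolding b_def by (rule closed_contains_Inf[OF T])
  have "b \<noteq> 0" using b y_0 \<eta>\<^sub>0_neg by (auto simp: T_def)
  have min: "y x \<noteq> edge" if "0 \<le> x" "x < b" for x
    using cInf_lower[of x T] T(2) that by (auto simp: b_def T_def)
  have "y x < edge" if x: "0 \<le> x" "x < b" for x
  proof (rule ccontr)
    assume "\<not> y x < edge"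
    then have "\<exists>z\<ge>0. z \<le> x \<and> y z = edge"
      using x \<eta>\<^sub>0_neg y_0 continuous_y by (intro IVT') auto
    then show False using min x by force
  qed
  then show ?thesis using that[of b] b \<open>b \<noteq> 0\<close> by (auto simp: T_def)
qed

text \<open>The quadrature of the first integral: \<open>pos\<close> composed with the parameter \<open>t = sqrt (y - \<eta>\<^sub>0)\<close> has
  derivative one.\<close>

lemma inner_unique:
  assumes b: "0 < b" "y b = edge" "\<And>x. 0 \<le> x \<Longrightarrow> x < b \<Longrightarrow> y x < edge"
  shows "b = core" and "\<And>x. 0 \<le> x \<Longrightarrow> x \<le> b \<Longrightarrow> y x = prof x"
proof -
  obtain \<delta> where \<delta>: "\<delta> > 0" "\<And>x. \<bar>x\<bar> < \<delta> \<Longrightarrow> y x < edge" by (rule near_0) (rule that; assumption)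
  have S: "\<forall>x\<in>{-\<delta><..<b}. y x \<noteq> edge \<and> y x < 1"
  proof
    fix x assume x: "x \<in> {-\<delta><..<b}"
    have "y x < edge"
    proof (cases "0 \<le> x")
      case True then show ?thesis using b(3)[of x] x by simp
    next
      case False then show ?thesis using \<delta>(2)[of x] x by simp
    qed
    then show "y x \<noteq> edge \<and> y x < 1" using edge_less_1 by simp
  qed
  have FI: "first_integral x = K\<^sub>0" if "x \<in> {0<..<b}" for x
    using first_integral_const[OF _ _ S, of 0 x] that \<delta>(1) b(1) by (simp add: first_integral_0)
  \<comment> \<open>Extrema off \<open>edge\<close> are excluded between 0 and b, so y is injective
    and hence increases strictly to its value \<open>edge\<close> at b.\<close>
  have inj: "inj_on y {0..b}"
  proof (rule no_extremum_inj_on[OF continuous_y])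
    fix x assume x: "x \<in> {0<..<b}"
    then have "y x \<noteq> edge" using b(3)[of x] by simp
    then show "\<not> local_extremum y x" using only_extremum[of x] x by auto
  qed
  have mono: "y x < y z" if "0 \<le> x" "x < z" "z \<le> b" for x z
  proof -
    have yz: "y x < y b" if "0 \<le> x" "x < b" for x using b that by simp
    show ?thesis
    proof (cases "z = b")
      case False
      have i: "inj_on y {x..b}" using inj that by (auto elim: inj_on_subset)
      show ?thesis
        using continuous_inj_imp_mono[OF \<open>x < z\<close> _ continuous_y i] yz[of x] that False by auto
    qed (use that yz in simp)
  qed
  have gt: "\<eta>\<^sub>0 < y x" if "x \<in> {0<..<b}" for x
    using mono[of 0 x] that y_0 by simp
  define t where "t x = sqrt (y x - \<eta>\<^sub>0)" for x
  have t_props: "0 < t x" "t x < radius" "y x = \<eta>\<^sub>0 + (t x)\<^sup>2" if "x \<in> {0<..<b}" for x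
    using gt[OF that] b(3)[of x] that by (auto simp: t_def radius_def)
  have der: "((\<lambda>x. pos (t x) - x) has_real_derivative 0) (at x)" if x: "x \<in> {0<..<b}" for x
  proof -
    note tp = t_props[OF x]
    have tr: "\<bar>t x\<bar> < radius" using tp by simp
    have yx: "y x < edge" using b(3) x by simp
    have d: "(y has_real_derivative dy x) (at x)"
      by (rule y_has_derivative[of "{-\<delta><..<b}"]) (use S x \<delta>(1) in auto)
    \<comment> \<open>The first integral determines only the square of y'; monotonicity selects the
      root.\<close>
    have nonneg: "0 \<le> dy x"
    proof (rule ccontr)
      assume "\<not> 0 \<le> dy x"
      then obtain h where h: "h > 0" "\<And>k. 0 < k \<Longrightarrow> k < h \<Longrightarrow> y (x + k) < y x"
        using DERIV_neg_dec_right[OF d] by auto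
      define k where "k = min (h / 2) (b - x)"
      have "0 < k" "k < h" "x + k \<le> b" using h x by (auto simp: k_def min_def)
      then show False using h(2)[of k] mono[of x "x + k"] x by simp
    qed
    note cf = core_facts[OF tr]
    have Et: "E (t x) = y x" using tr tp(3) by (simp add: core_simps)
    have "(1 - 2 * \<kappa> * (1 - y x)) * (dy x)\<^sup>2 = - ((t x)\<^sup>2 * Q (y x))"
      using first_integral_eq[of x] yx edge_less_1 core_first_integral[OF tp(3)] by (simp add: FI[OF x])
    then have "2 * \<kappa> * (radius\<^sup>2 - (t x)\<^sup>2) * (dy x)\<^sup>2 = (t x)\<^sup>2 * Q (\<eta>\<^sub>0 + (t x)\<^sup>2)"
      using cf(3) unfolding Et tp(3)[symmetric] by simp
    then have "(dy x)\<^sup>2 * (2 * \<kappa> * (radius\<^sup>2 - (t x)\<^sup>2)) = (t x)\<^sup>2 * Q (\<eta>\<^sub>0 + (t x)\<^sup>2)"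
      by (metis mult.commute)
    then have "(dy x)\<^sup>2 = (E' (t x) / speed (t x))\<^sup>2"
      unfolding cf(6) using cf(1) by (intro eq_divide_imp) auto
    moreover have E't: "E' (t x) = 2 * t x" using tr tp by (simp add: E'_def)
    moreover have sp: "speed (t x) > 0" using tr by (simp add: speed_pos_iff)
    ultimately have dyx: "dy x = 2 * t x / speed (t x)"
      using nonneg tp(1) by (simp add: power2_eq_iff_nonneg)
    have "((\<lambda>x. y x - \<eta>\<^sub>0) has_real_derivative dy x) (at x)"
      using DERIV_diff[OF d DERIV_const] by simp
    then have "(t has_real_derivative inverse (sqrt (y x - \<eta>\<^sub>0)) / 2 * dy x) (at x)"
      unfolding t_def[abs_def] using gt[OF x]
      by (intro DERIV_chain2[where f = sqrt and g = "\<lambda>x. y x - \<eta>\<^sub>0"] DERIV_real_sqrt) auto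
    then have dt: "(t has_real_derivative 1 / speed (t x)) (at x)"
      using tp(1) unfolding t_def[symmetric] dyx by (simp add: field_simps)
    have "((\<lambda>x. pos (t x) - x) has_real_derivative speed (t x) * (1 / speed (t x)) - 1) (at x)"
      by (intro DERIV_diff DERIV_ident DERIV_chain2[OF pos_has_derivative dt])
    then show ?thesis using sp by simp
  qed
  \<comment> \<open>At 0 the argument of the square root in t vanishes, and at b the slope is
    infinite. The derivative is therefore used in the open interval only, and continuity supplies
    the ends.\<close>
  have cont: "continuous_on {0..b} (\<lambda>x. pos (t x) - x)"
    unfolding t_def by (intro continuous_on_pos_diff continuous_intros continuous_y)
  have pt: "pos (t x) = x" if "0 \<le> x" "x \<le> b" for x
  proof -
    have "pos (t x) - x = pos (t 0) - 0"
      by (rule DERIV_isconst2[OF b(1) cont _ that]) (use der in auto)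
    then show ?thesis by (simp add: t_def y_0 pos_0)
  qed
  have "t b = radius" by (simp add: t_def b(2) radius_def)
  then show bc: "b = core" using pt[of b] b(1) by (simp add: core_def)
  show "y x = prof x" if x: "0 \<le> x" "x \<le> b" for x
  proof -
    have "\<eta>\<^sub>0 \<le> y x"
      using mono[of 0 x] x y_0 by (cases "x = 0") auto
    moreover have "y x \<le> edge" using b(2) b(3)[of x] x by (cases "x = b") auto
    ultimately have "\<bar>t x\<bar> \<le> radius" "(t x)\<^sup>2 = y x - \<eta>\<^sub>0" by (auto simp: t_def radius_def)
    moreover have "par x = t x" using par_pos[of "t x"] pt[OF x] by simp
    ultimately show ?thesis by (simp add: prof_def core_simps)
  qed
qed

lemma y_core: "y core = edge" and inner_eq: "0 \<le> x \<Longrightarrow> x \<le> core \<Longrightarrow> y x = prof x"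
proof -
  obtain b where b: "0 < b" "y b = edge" "\<And>x. 0 \<le> x \<Longrightarrow> x < b \<Longrightarrow> y x < edge"
    by (rule first_hit) (rule that; assumption)
  show "y core = edge" "0 \<le> x \<Longrightarrow> x \<le> core \<Longrightarrow> y x = prof x"
    using inner_unique[OF b] b(2) by auto
qed

text \<open>Here y vanishes at core and is arbitrarily small at points X n. A nonzero value in
  between would force an extremum of y with nonzero value, hence off \<open>edge\<close> and away
  from 0.\<close>

lemma compacton_unique:
  assumes "edge = 0" "core < x"
  shows "y x = 0"
proof (rule ccontr)
  assume ne: "y x \<noteq> 0"
  have "\<forall>\<^sub>F n in sequentially. \<bar>y (X n)\<bar> < \<bar>y x\<bar>"
    using order_tendstoD(2)[OF tendsto_rabs_zero[OF y_X], of "\<bar>y x\<bar>"] ne by simp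
  then have "\<forall>\<^sub>F n in sequentially. \<bar>y (X n)\<bar> < \<bar>y x\<bar> \<and> x < X n"
    using X_eventually_gt[of x] by (rule eventually_conj)
  then obtain n where n: "\<bar>y (X n)\<bar> < \<bar>y x\<bar>" "x < X n"
    by (auto simp: eventually_sequentially)
  \<comment> \<open>Multiplication by the sign reduces both cases to a positive maximum.\<close>
  define s where "s = sgn (y x)"
  have s: "s * y x = \<bar>y x\<bar>" "s * y (X n) \<le> \<bar>y (X n)\<bar>" "s * y core = 0" "s \<noteq> 0"
    using ne y_core assms by (auto simp: s_def sgn_if)
  have c: "continuous_on {core..X n} (\<lambda>x. s * y x)" by (intro continuous_intros continuous_y)
  obtain z where z: "z \<in> {core<..<X n}" "local_extremum (\<lambda>x. s * y x) z" "s * y x \<le> s * y z"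
    by (rule interior_local_max[OF c, of x]) (use s n assms(2) ne in auto)
  have "s = 1 \<or> s = - 1" using ne by (auto simp: s_def sgn_if)
  then have "local_extremum y z" using z(2) by (auto simp: local_extremum_uminus)
  moreover have "y z \<noteq> edge"
  proof
    assume "y z = edge"
    then have "\<bar>y x\<bar> \<le> 0" using z(3) s(1) assms(1) by simp
    then show False using ne by simp
  qed
  ultimately have "z = 0" by (rule only_extremum[rotated])
  then show False using z(1) core_pos by simp
qed

text \<open>A value \<open>edge\<close> at x > core forces y to be constant on [core, x]. There y'
  and m' vanish, and eliminating \<bar>v'\<bar> from the two remaining scalar equations gives the
  polynomial relation excluded by \<open>no_plateau\<close>.\<close>

lemma leaves_edge:
  assumes "edge \<noteq> 0" "core < x"
  shows "y x \<noteq> edge"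
proof -
  define T where "T = {x. core < x \<and> y x \<noteq> edge}"
  \<comment> \<open>Once y has left the level it cannot return, since the return would create an
    extremum off the level.\<close>
  have up: "z \<in> T" if xT: "x \<in> T" and xz: "x < z" for x z
  proof (rule ccontr)
    assume "z \<notin> T"
    then have z: "y z = edge" using xT xz by (auto simp: T_def)
    obtain w where "w \<in> {core<..<z}" "local_extremum y w" "y w \<noteq> edge"
      by (rule interior_local_extremum[OF continuous_y, where a = core and b = z and x = x]) (use xT xz y_core z in \<open>auto simp: T_def\<close>)
    then show False using only_extremum[of w] core_pos by simp
  qed
  have "\<forall>\<^sub>F n in sequentially. y (X n) \<noteq> edge"
    using tendsto_imp_eventually_ne[OF y_X, of edge] assms(1) by simp
  then have "\<forall>\<^sub>F n in sequentially. y (X n) \<noteq> edge \<and> core < X n"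
    using X_eventually_gt[of core] by (rule eventually_conj)
  then obtain n where "X n \<in> T" by (auto simp: eventually_sequentially T_def)
  have "y x \<noteq> edge"
  proof
    assume yx: "y x = edge"
    have flat: "y z = edge" if "z \<in> {core..x}" for z
      using up[of z x] that yx y_core by (cases "z = core"; cases "z = x") (auto simp: T_def)
    have e0: "AE z in lborel. z \<in> {core..x} \<longrightarrow> e z = 0"
      by (rule has_ac_derivative_const_on_imp_zero[OF ac_y flat])
    have m0: "m z = 0" if "z \<in> {core<..<x}" for z
    proof (rule continuous_AE_eq_on[OF _ that continuous_m continuous_on_const])
      show "AE z in lborel. z \<in> {core<..<x} \<longrightarrow> m z = 0"
        using sys e0 by eventually_elim (auto simp: TW_scalar_def)
    qed simp
    \<comment> \<open>The middle third of the plateau: m is known to vanish in the open interval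
      only, and \<open>has_ac_derivative_const_on_imp_zero\<close> needs a closed one.\<close>
    define p q where "p = (2 * core + x) / 3" and "q = (core + 2 * x) / 3"
    have pq: "core < p" "p < q" "q < x" using assms(2) by (auto simp: p_def q_def)
    have m'0: "AE z in lborel. z \<in> {p..q} \<longrightarrow> m' z = 0"
      by (rule has_ac_derivative_const_on_imp_zero[OF ac_m]) (use m0 pq in auto)
    have "AE z in lborel. z \<notin> {p<..<q}"
      using sys e0 m'0
    proof eventually_elim
      case (elim z)
      note elim = elim[unfolded TW_scalar_def]
      show ?case
      proof
        assume z: "z \<in> {p<..<q}"
        then have *: "e z = 0" "m' z = 0" "y z = edge" using elim pq flat by auto
        define d where "d = 1 - edge"
        have yz: "y z = 1 - d" using * by (simp add: d_def)
        have "4 * d * (l z)\<^sup>2 = c\<^sup>2 * (1 - d)\<^sup>2" "2 * (l z)\<^sup>2 = - (c\<^sup>2 * (1 - d)) + 2 * d * (1 - d)"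
        proof -
          have c1: "4 * (1 - y z) * (l z)\<^sup>2 = (e z)\<^sup>2 + c\<^sup>2 * (y z)\<^sup>2"
            and c2: "m' z = - 2 * (l z)\<^sup>2 + 2 * \<kappa> * (e z)\<^sup>2 - c\<^sup>2 * y z + 2 * (1 - y z) * y z"
            using elim by blast+
          show "4 * d * (l z)\<^sup>2 = c\<^sup>2 * (1 - d)\<^sup>2" using c1 unfolding yz *(1) by simp
          show "2 * (l z)\<^sup>2 = - (c\<^sup>2 * (1 - d)) + 2 * d * (1 - d)" using c2 unfolding yz *(1,2) by simp
        qed
        moreover have "4 * d * (l z)\<^sup>2 = 2 * d * (2 * (l z)\<^sup>2)" by simp
        ultimately have "2 * d * (- (c\<^sup>2 * (1 - d)) + 2 * d * (1 - d)) = c\<^sup>2 * (1 - d)\<^sup>2" by (simp only:)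
        then have "(1 - d) * (4 * d\<^sup>2 - c\<^sup>2 * d - c\<^sup>2) = 0"
          by (simp add: algebra_simps power2_eq_square)
        then show False using no_plateau assms(1) by (simp add: d_def)
      qed
    qed
    then have "{p<..<q} \<in> null_sets lborel" by (subst AE_iff_null_sets) auto
    then show False using pq by (simp add: null_sets_def)
  qed
  then show ?thesis .
qed

text \<open>The ratio z = y / edge treats both signs of \<open>edge\<close> at once. It decreases
  strictly from 1 towards 0, and t = radius - ln z composed with \<open>pos\<close> again has
  derivative one.\<close>

lemma outer_unique:
  assumes ed: "edge \<noteq> 0" and x: "core < x"
  shows "y x = prof x"
proof -
  define z where "z x = y x / edge" for x
  have yz: "y x = edge * z x" for x using ed by (simp add: z_def)
  have zc: "continuous_on S z" for S unfolding z_def by (intro continuous_intros continuous_y) (use ed in auto)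
  have z_core: "z core = 1" using y_core ed by (simp add: z_def)
  have z_ne: "z x \<noteq> 1" if "core < x" for x using leaves_edge[OF ed that] ed by (simp add: z_def)
  have zX: "(\<lambda>n. z (X n)) \<longlonglongrightarrow> 0"
    unfolding z_def using tendsto_divide[OF y_X tendsto_const, of edge] ed by simp
  have inj: "inj_on z {core..b}" for b
  proof (rule inj_onI)
    fix u w assume uw: "u \<in> {core..b}" "w \<in> {core..b}" "z u = z w"
    have "inj_on y {core..b}"
    proof (rule no_extremum_inj_on[OF continuous_y])
      fix u assume "u \<in> {core<..<b}"
      then show "\<not> local_extremum y u" using only_extremum[OF leaves_edge[OF ed], of u] core_pos by auto
    qed
    then show "u = w" using uw ed by (auto simp: z_def inj_on_def)
  qed
  \<comment> \<open>If z exceeded 1 somewhere, it would have to cross 1 again on its way to small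
    values along X.\<close>
  have z_less: "z u < 1" if u: "core < u" for u
  proof (rule ccontr)
    assume "\<not> z u < 1"
    then have gt: "1 < z u" using z_ne[OF u] by linarith
    have "\<forall>\<^sub>F n in sequentially. z (X n) < 1 \<and> u < X n"
      using order_tendstoD(2)[OF zX, of 1] X_eventually_gt[of u] by (auto intro: eventually_conj)
    then obtain n where n: "z (X n) < 1" "u < X n" by (auto simp: eventually_sequentially)
    have "\<exists>w\<ge>u. w \<le> X n \<and> z w = 1"
      using n gt zc by (intro IVT2') auto
    then show False using z_ne u by force
  qed
  have mono: "z w < z u" if "core \<le> u" "u < w" for u w
  proof -
    have w: "z w < 1" using z_less that by simp
    show ?thesis
    proof (cases "u = core")
      case False
      then show ?thesis
        using continuous_inj_imp_mono[of core u w z, OF _ _ zc inj] that w z_core by auto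
    qed (use w z_core in simp)
  qed
  \<comment> \<open>A decreasing function with a sequence of values tending to 0 is nonnegative, and
    by strictness positive.\<close>
  have z_pos: "0 < z u" if "core \<le> u" for u
  proof -
    have "\<forall>\<^sub>F n in sequentially. z (X n) \<le> z (u + 1)"
      using X_eventually_gt[of "u + 1"] by eventually_elim (use mono[of "u + 1"] that in force)
    then have "0 \<le> z (u + 1)" using tendsto_upperbound[OF zX] by simp
    then show ?thesis using mono[of u "u + 1"] that by simp
  qed
  have y1: "y u < 1" if "core < u" for u
  proof (cases "edge \<le> 0")
    case True
    then have "edge * z u \<le> 0" using z_pos[of u] that by (intro mult_nonpos_nonneg) auto
    then show ?thesis by (simp add: yz)
  next
    case False
    then have "edge * z u < edge * 1" using z_less[OF that] by (intro mult_strict_left_mono) auto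
    then show ?thesis using edge_less_1 by (simp add: yz)
  qed
  have S: "\<forall>x\<in>{core<..}. y x \<noteq> edge \<and> y x < 1" using leaves_edge[OF ed] y1 by simp
  define t where "t u = radius - ln (z u)" for u
  have t_core: "t core = radius" by (simp add: t_def z_core)
  have t_outer: "radius < t u" "tail (t u) = z u" if "core < u" for u
  proof -
    show "radius < t u" using z_pos[of u] z_less[OF that] that by (simp add: t_def)
    then show "tail (t u) = z u" using z_pos[of u] that by (simp add: outer_simps t_def)
  qed
  have der: "((\<lambda>x. pos (t x) - x) has_real_derivative 0) (at u)" if u: "core < u" for u
  proof -
    have d: "(y has_real_derivative dy u) (at u)"
      by (rule y_has_derivative[of "{core<..}"]) (use S u in auto)
    then have dz: "(z has_real_derivative dy u / edge) (at u)"
      unfolding z_def[abs_def] by (rule DERIV_cdivide)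
    have zu: "0 < z u" "z u < 1" using z_pos z_less u by auto
    have neg: "dy u / edge \<le> 0"
    proof (rule ccontr)
      assume "\<not> dy u / edge \<le> 0"
      then obtain h where h: "h > 0" "\<And>k. 0 < k \<Longrightarrow> k < h \<Longrightarrow> z u < z (u + k)"
        using DERIV_pos_inc_right[OF dz] by auto
      have "z u < z (u + h / 2)" by (rule h(2)) (use h(1) in auto)
      moreover have "z (u + h / 2) < z u" by (rule mono) (use u h(1) in auto)
      ultimately show False by simp
    qed
    note tu = t_outer[OF u]
    note o = outer_facts[OF tu(1), unfolded tu(2)]
    have k: "1 - 2 * \<kappa> \<noteq> 0" using edge_\<kappa> ed by auto
    have rel: "(1 - 2 * \<kappa>) * r (z u) = 2 - c\<^sup>2 - 2 * y u" using edge_ratio[of "z u"] ed by (simp add: yz)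
    have g: "1 - 2 * \<kappa> * (1 - y u) = (1 - 2 * \<kappa>) * (1 - z u)"
    proof -
      have "1 - 2 * \<kappa> * (1 - y u) = 1 - 2 * \<kappa> + 2 * \<kappa> * edge * z u" by (simp add: yz algebra_simps)
      then show ?thesis unfolding edge_\<kappa> by (simp add: algebra_simps)
    qed
    have "first_integral u = 0" by (rule first_integral_outer[OF S u])
    then have "(1 - 2 * \<kappa>) * ((1 - z u) * (dy u)\<^sup>2) = (1 - 2 * \<kappa>) * ((y u)\<^sup>2 * r (z u))"
      using first_integral_eq[of u] leaves_edge[OF ed u] y1[OF u] rel unfolding g by (simp add: ac_simps)
    then have "(1 - z u) * (dy u)\<^sup>2 = (y u)\<^sup>2 * r (z u)" using k by simp
    then have sq: "(dy u)\<^sup>2 = (E' (t u) / speed (t u))\<^sup>2"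
      unfolding o(6) using zu by (simp add: yz power_mult_distrib field_simps)
    have sp: "speed (t u) > 0" using tu(1) radius_pos by (simp add: speed_pos_iff)
    have E't: "E' (t u) = - (edge * z u)" using tu radius_pos by (simp add: E'_def)
    have "(- (dy u / edge))\<^sup>2 = (z u / speed (t u))\<^sup>2"
      using sq ed unfolding E't by (simp add: power_divide power_mult_distrib)
    then have "- (dy u / edge) = z u / speed (t u)"
      using neg zu sp by (subst (asm) power2_eq_iff_nonneg) auto
    then have dz': "(z has_real_derivative - (z u / speed (t u))) (at u)"
      using dz by (metis minus_minus)
    have "((\<lambda>u. ln (z u)) has_real_derivative (1 / z u) * - (z u / speed (t u))) (at u)"
      using DERIV_chain2[OF DERIV_ln_divide[OF zu(1)] dz'] by simp
    from DERIV_diff[OF DERIV_const this, of radius]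
    have dt: "(t has_real_derivative 1 / speed (t u)) (at u)"
      unfolding t_def[abs_def] using zu by (simp add: t_def)
    have "((\<lambda>x. pos (t x) - x) has_real_derivative speed (t u) * (1 / speed (t u)) - 1) (at u)"
      by (intro DERIV_diff DERIV_ident DERIV_chain2[OF pos_has_derivative dt])
    then show ?thesis using sp by simp
  qed
  have tc: "continuous_on {core..x} t"
    unfolding t_def by (intro continuous_intros zc) (use z_pos in force)
  have cont: "continuous_on {core..x} (\<lambda>x. pos (t x) - x)"
    by (rule continuous_on_pos_diff[OF tc])
  have "pos (t x) - x = pos (t core) - core"
    by (rule DERIV_isconst2[OF x cont]) (use der x in auto)
  then have "pos (t x) = x" unfolding t_core using core_def by simp
  then have "par x = t x" using par_pos[of "t x"] by simp
  then show ?thesis using t_outer[OF x] by (simp add: prof_def outer_simps(4) yz)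
qed

lemma half_line_unique:
  assumes "0 \<le> x" shows "y x = prof x"
proof -
  consider "x \<le> core" | "core < x" "edge = 0" | "core < x" "edge \<noteq> 0" by linarith
  then show ?thesis
  proof cases
    case 1 then show ?thesis using inner_eq assms by simp
  next
    case 2 then show ?thesis using compacton_unique[of x] prof_outer_zero[of x] core_pos by simp
  next
    case 3 then show ?thesis using outer_unique by simp
  qed
qed

end


context TW_profile
begin

text \<open>Square integrability of y and l provides the sequence X, and 4(1 - y) l^2 = e^2 + c^2
  y^2 transfers the decay to e along it.\<close>

lemma \<eta>_unique_nonneg:
  assumes ac_y: "has_ac_derivative y e" and ac_m: "has_ac_derivative m m'"
    and int: "integrable lborel (\<lambda>x. (y x)\<^sup>2 + (l x)\<^sup>2)"
    and sys: "AE x in lborel. TW_scalar c \<kappa> (y x) (e x) (m x) (m' x) (l x)"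
    and y: "y 0 = \<eta>\<^sub>0" "local_extremum y 0" "\<And>x. y x \<noteq> edge \<Longrightarrow> local_extremum y x \<Longrightarrow> x = 0"
    and no_plateau: "edge \<noteq> 0 \<Longrightarrow> 4 * (1 - edge)\<^sup>2 - c\<^sup>2 * (1 - edge) - c\<^sup>2 \<noteq> 0"
    and x: "0 \<le> x"
  shows "y x = prof x"
proof -
  obtain X where X: "\<And>n. real n < X n"
    "\<And>n. TW_scalar c \<kappa> (y (X n)) (e (X n)) (m (X n)) (m' (X n)) (l (X n))"
    "(\<lambda>n. (y (X n))\<^sup>2 + (l (X n))\<^sup>2) \<longlonglongrightarrow> 0"
    by (rule small_sequence[OF int sum_power2_ge_zero sys]) (rule that; assumption)
  have y2: "(\<lambda>n. (y (X n))\<^sup>2) \<longlonglongrightarrow> 0" and l2: "(\<lambda>n. (l (X n))\<^sup>2) \<longlonglongrightarrow> 0"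
    by (rule tendsto_sandwich[OF _ _ tendsto_const X(3)]; simp)+
  have yX: "(\<lambda>n. y (X n)) \<longlonglongrightarrow> 0" by (rule tendsto_zero_of_power2[OF y2])
  have e2: "(e (X n))\<^sup>2 = 4 * (1 - y (X n)) * (l (X n))\<^sup>2 - c\<^sup>2 * (y (X n))\<^sup>2" for n
    using X(2)[of n] unfolding TW_scalar_def by linarith
  have "(\<lambda>n. 4 * (1 - y (X n)) * (l (X n))\<^sup>2 - c\<^sup>2 * (y (X n))\<^sup>2) \<longlonglongrightarrow> 4 * (1 - 0) * 0 - c\<^sup>2 * 0"
    by (intro tendsto_diff tendsto_mult tendsto_const yX l2 y2)
  then have "(\<lambda>n. (e (X n))\<^sup>2) \<longlonglongrightarrow> 0" unfolding e2 by simp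
  then have eX: "(\<lambda>n. e (X n)) \<longlonglongrightarrow> 0" by (rule tendsto_zero_of_power2)
  interpret TW_candidate c \<kappa> \<eta>\<^sub>0 y e m m' l X
    by unfold_locales (fact ac_y ac_m sys X(1) X(2)[unfolded TW_scalar_def, THEN conjunct1] yX eX y no_plateau)+
  show ?thesis by (rule half_line_unique[OF x])
qed

text \<open>Under x \<mapsto> -x the quantities e and m change sign while m' does not, and the
  scalar system is invariant under this change.\<close>

lemma \<eta>_unique:
  assumes ac_y: "has_ac_derivative y e" and ac_m: "has_ac_derivative m m'"
    and int: "integrable lborel (\<lambda>x. (y x)\<^sup>2 + (l x)\<^sup>2)"
    and sys: "AE x in lborel. TW_scalar c \<kappa> (y x) (e x) (m x) (m' x) (l x)"
    and y: "y 0 = \<eta>\<^sub>0" "local_extremum y 0" "\<And>x. y x \<noteq> edge \<Longrightarrow> local_extremum y x \<Longrightarrow> x = 0"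
    and no_plateau: "edge \<noteq> 0 \<Longrightarrow> 4 * (1 - edge)\<^sup>2 - c\<^sup>2 * (1 - edge) - c\<^sup>2 \<noteq> 0"
  shows "y x = prof x"
proof (cases "0 \<le> x")
  case True
  show ?thesis by (rule \<eta>_unique_nonneg[OF ac_y ac_m int sys y no_plateau True])
next
  case False
  have "y (- (- x)) = prof (- x)"
  proof (rule \<eta>_unique_nonneg[where y = "\<lambda>x. y (- x)" and l = "\<lambda>x. l (- x)"])
    show "has_ac_derivative (\<lambda>x. y (- x)) (\<lambda>x. - e (- x))" by (rule has_ac_derivative_reflect[OF ac_y])
    show "has_ac_derivative (\<lambda>x. - m (- x)) (\<lambda>x. m' (- x))"
      using has_ac_derivative_bounded_linear[OF bounded_linear_minus[OF bounded_linear_ident]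
          has_ac_derivative_reflect[OF ac_m]] by simp
    show "integrable lborel (\<lambda>x. (y (- x))\<^sup>2 + (l (- x))\<^sup>2)"
      using lborel_integrable_real_affine[OF int, of "- 1" 0] by simp
    show "AE x in lborel. TW_scalar c \<kappa> (y (- x)) (- e (- x)) (- m (- x)) (m' (- x)) (l (- x))"
      using AE_lborel_reflect[OF sys] by eventually_elim (simp add: TW_scalar_def)
    show "y (- 0) = \<eta>\<^sub>0" using y(1) by simp
    show "local_extremum (\<lambda>x. y (- x)) 0"
      using local_extremum_reflect[of "\<lambda>x. y (- x)" 0] y(2) by simp
    show "x = 0" if "y (- x) \<noteq> edge" "local_extremum (\<lambda>x. y (- x)) x" for x
      using y(3)[OF that(1) local_extremum_reflect[OF that(2)]] by simp
    show "4 * (1 - edge)\<^sup>2 - c\<^sup>2 * (1 - edge) - c\<^sup>2 \<noteq> 0" if "edge \<noteq> 0" using no_plateau[OF that] .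
    show "0 \<le> - x" using False by simp
  qed
  then show ?thesis by (simp add: prof_minus)
qed

lemma has_ac_derivative_prof: "has_ac_derivative prof slope"
proof (rule has_ac_derivativeI[of "{core, - core}"])
  show "slope \<in> L1_loc"
    by (rule L2_imp_L1_loc) (simp_all add: integrable_profile measurable_slope)
  show "(prof has_vector_derivative slope x) (at x)" if "x \<notin> {core, - core}" for x
    unfolding has_real_derivative_iff_has_vector_derivative[symmetric]
    by (rule prof_has_derivative) (use that in auto)
qed (simp_all add: continuous_prof)

text \<open>\<open>v / wave\<close> is absolutely continuous with vanishing derivative.\<close>

lemma wave_unique:
  assumes TW: "TW_weak_solution c \<kappa> v" and Z: "\<Z> \<kappa> v = {0}" and v0: "\<eta> v 0 = \<eta>\<^sub>0"
    and no_plateau: "edge \<noteq> 0 \<Longrightarrow> 4 * (1 - edge)\<^sup>2 - c\<^sup>2 * (1 - edge) - c\<^sup>2 \<noteq> 0"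
  obtains \<theta> where "\<And>x. v x = cis \<theta> * wave x"
proof -
  obtain p e m m' where vp: "has_ac_derivative v p" and ye: "has_ac_derivative (\<eta> v) e"
    and mm: "has_ac_derivative m m'"
    and int: "integrable lborel (\<lambda>x. (\<eta> v x)\<^sup>2 + (cmod (p x))\<^sup>2)"
    and sys: "AE x in lborel. TW_scalar c \<kappa> (\<eta> v x) (e x) (m x) (m' x) (cmod (p x)) \<and>
      complex_of_real (1 - \<eta> v x) * p x = Complex (- e x / 2) (c * \<eta> v x / 2) * v x"
    by (rule TW_scalar_system[OF TW]) (rule that; assumption)
  have \<Gamma>: "x \<in> \<Gamma> \<kappa> v \<longleftrightarrow> \<eta> v x = edge" for x by (auto simp: \<Gamma>_def \<eta>_def edge_def)
  have ext: "\<eta> v x \<noteq> edge \<and> local_extremum (\<eta> v) x \<longleftrightarrow> x = 0" for x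
    using Z unfolding \<Z>_def \<Gamma> by blast
  have \<eta>v: "\<eta> v x = prof x" for x
  proof (rule \<eta>_unique[OF ye mm int _ v0 _ _ no_plateau])
    show "AE x in lborel. TW_scalar c \<kappa> (\<eta> v x) (e x) (m x) (m' x) (cmod (p x))"
      using sys by eventually_elim blast
  qed (use ext in auto)
  then have \<eta>v': "\<eta> v = prof" by blast
  have eslope: "AE x in lborel. e x = slope x"
    by (rule has_ac_derivative_unique[OF ye[unfolded \<eta>v'] has_ac_derivative_prof])
  have D: "0 < 1 - prof x" for x using prof_bounds(3)[of x] by simp
  have pv: "AE x in lborel. p x = wave_ratio x * v x"
    using sys eslope
  proof eventually_elim
    case (elim x)
    have "complex_of_real (1 - prof x) * p x = Complex (- slope x / 2) (c * prof x / 2) * v x"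
      using elim by (simp add: \<eta>v)
    also have "Complex (- slope x / 2) (c * prof x / 2) = complex_of_real (1 - prof x) * wave_ratio x"
    proof -
      define d where "d = 1 - prof x"
      then have "d \<noteq> 0" using D[of x] by simp
      then show ?thesis by (simp add: complex_eq_iff wave_ratio_def d_def[symmetric] del: of_real_diff)
    qed
    finally show ?case using D[of x] by (simp add: mult.assoc del: of_real_diff)
  qed
  have invD: "has_ac_derivative (\<lambda>x. 1 / (1 - prof x)) (\<lambda>x. 1 / (1 - prof x)\<^sup>2 * slope x)"
  proof (rule has_ac_derivativeI[of "{core, - core}"])
    have nz: "prof x \<noteq> 1" for x using D[of x] by simp
    have "continuous_on UNIV (\<lambda>x. 1 / (1 - prof x)\<^sup>2)"
      by (intro continuous_intros continuous_prof) (simp add: nz)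
    then show "(\<lambda>x. 1 / (1 - prof x)\<^sup>2 * slope x) \<in> L1_loc"
      by (rule L1_loc_bilinear[OF bounded_bilinear_mult _ has_ac_derivativeD(1)[OF has_ac_derivative_prof]])
    show "continuous_on UNIV (\<lambda>x. 1 / (1 - prof x))"
      by (intro continuous_intros continuous_prof) (simp add: nz)
    show "((\<lambda>x. 1 / (1 - prof x)) has_vector_derivative 1 / (1 - prof x)\<^sup>2 * slope x) (at x)"
      if "x \<notin> {core, - core}" for x
    proof -
      have "(prof has_real_derivative slope x) (at x)" by (rule prof_has_derivative) (use that in auto)
      then have "((\<lambda>x. 1 / (1 - prof x)) has_real_derivative (0 * (1 - prof x) - 1 * (0 - slope x)) / ((1 - prof x) * (1 - prof x))) (at x)"
        by (intro DERIV_divide DERIV_diff DERIV_const) (simp_all add: nz)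
      then show ?thesis by (simp add: has_real_derivative_iff_has_vector_derivative[symmetric] power2_eq_square)
    qed
  qed simp
  \<comment> \<open>This is v / wave, because the squared modulus of the wave is 1 - prof. In this
    form it is built from products of absolutely continuous functions.\<close>
  define s where "s x = (1 / (1 - prof x)) *\<^sub>R (v x * cnj (wave x))" for x
  note ac_s = has_ac_derivative_scaleR[OF invD has_ac_derivative_mult[OF vp
      has_ac_derivative_bounded_linear[OF bounded_linear_cnj has_ac_derivative_wave]], folded s_def]
  have "s x = s 0" for x
  proof (rule has_ac_derivative_zero_imp_const[OF ac_s])
    show "AE x in lborel. (1 / (1 - prof x)) *\<^sub>R (v x * cnj (wave_ratio x * wave x) + p x * cnj (wave x)) +
        (1 / (1 - prof x)\<^sup>2 * slope x) *\<^sub>R (v x * cnj (wave x)) = 0"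
      using pv
    proof eventually_elim
      case (elim x)
      have "v x * cnj (wave_ratio x * wave x) + p x * cnj (wave x) = (wave_ratio x + cnj (wave_ratio x)) * (v x * cnj (wave x))"
        by (simp add: elim algebra_simps)
      also have "wave_ratio x + cnj (wave_ratio x) = complex_of_real (- slope x / (1 - prof x))"
        using D[of x] by (simp add: complex_add_cnj wave_ratio_def field_simps)
      finally have num: "v x * cnj (wave_ratio x * wave x) + p x * cnj (wave x) = (- slope x / (1 - prof x)) *\<^sub>R (v x * cnj (wave x))"
        by (simp add: scaleR_conv_of_real)
      show ?case unfolding num scaleR_scaleR scaleR_add_left[symmetric]
        by (simp add: power2_eq_square)
    qed
  qed
  then have sconst: "s x = s 0" for x .
  have v_eq: "v x = s 0 * wave x" for x
  proof -
    have "s x * wave x = (1 / (1 - prof x)) *\<^sub>R (v x * (wave x * cnj (wave x)))"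
      by (simp add: s_def ac_simps)
    also have "wave x * cnj (wave x) = complex_of_real (1 - prof x)"
      by (simp add: complex_norm_square[symmetric] cmod_wave del: of_real_diff)
    finally have "s x * wave x = v x" using D[of x] by (simp add: scaleR_conv_of_real del: of_real_diff)
    then show ?thesis using sconst[of x] by simp
  qed
  \<comment> \<open>The quotient is constant, and both functions have the prescribed modulus at 0,
    so it is a pure phase.\<close>
  have "(cmod (v 0))\<^sup>2 = (cmod (wave 0))\<^sup>2" using v0 by (simp add: cmod_wave \<eta>_def prof_0)
  then have "cmod (v 0) = cmod (wave 0)" by (simp add: power2_eq_iff_nonneg)
  then have "cmod (s 0) = 1" using v_eq[of 0] wave_nonzero[of 0] by (simp add: norm_mult)
  moreover from this have "s 0 \<noteq> 0" by auto
  ultimately have "cis (Arg (s 0)) = s 0" using cis_Arg[of "s 0"] by (simp add: sgn_div_norm)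
  then show ?thesis using v_eq by (intro that[of "Arg (s 0)"]) simp
qed

end

section \<open>Parameter ranges and assembly\<close>

lemma \<D>_tilde_cases:
  assumes "(c, \<kappa>) \<in> \<D>_tilde"
  obtains "0 \<le> c" "c \<le> sqrt 2" "0 < \<kappa>" "\<kappa> < 1/2" | "sqrt 2 \<le> c" "1/2 < \<kappa>"
proof -
  have "0 \<le> c \<and> c \<le> sqrt 2 \<and> 0 < \<kappa> \<and> \<kappa> < 1/2 \<or> sqrt 2 \<le> c \<and> 1/2 < \<kappa>"
    using assms by (auto simp: \<D>_tilde_def \<D>\<^sub>1_def \<D>\<^sub>3_def \<B>_minus_def \<B>_plus_def)
  then show ?thesis using that by blast
qed

text \<open>In the rewritten form the signs of d - 1 and 2 - c^2 decide. They agree throughout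
  \<open>\<D>_tilde\<close>, and d - 1 is nonzero even where c^2 = 2.\<close>

lemma no_plateau:
  fixes c \<kappa> :: real
  assumes "(c, \<kappa>) \<in> \<D>_tilde"
  defines "d \<equiv> 1 / (2 * \<kappa>)"
  shows "4 * d\<^sup>2 - c\<^sup>2 * d - c\<^sup>2 \<noteq> 0"
proof -
  have split: "4 * d\<^sup>2 - c\<^sup>2 * d - c\<^sup>2 = 2 * (2 * d + 1) * (d - 1) + (2 - c\<^sup>2) * (d + 1)"
    by (simp add: algebra_simps power2_eq_square)
  from assms(1) show ?thesis
  proof (cases rule: \<D>_tilde_cases)
    case 1
    then have d: "1 < d" by (simp add: d_def)
    have "c\<^sup>2 \<le> 2" using power_mono[OF 1(2,1), of 2] by simp
    then have "0 \<le> (2 - c\<^sup>2) * (d + 1)" using d by simp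
    moreover have "0 < 2 * (2 * d + 1) * (d - 1)" using d by simp
    ultimately show ?thesis unfolding split by linarith
  next
    case 2
    then have d: "0 < d" "d < 1" by (auto simp: d_def)
    have "2 \<le> c\<^sup>2" using power_mono[OF 2(1), of 2] by simp
    then have "(2 - c\<^sup>2) * (d + 1) \<le> 0" using d by (simp add: mult_nonpos_nonneg)
    moreover have "2 * (2 * d + 1) * (d - 1) < 0" using d by (simp add: mult_pos_neg)
    ultimately show ?thesis unfolding split by linarith
  qed
qed

theorem proposition1p8:
  fixes c \<kappa> :: real
  assumes "(c, \<kappa>) \<in> \<D>_tilde \<union> \<C>"
  shows "\<exists>A::real. A < 0 \<and> A < 1 - 1 / (2 * \<kappa>) \<and>
    (\<forall>\<eta>\<^sub>0 \<in> {..<A}. \<exists>u.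
        TW_weak_solution c \<kappa> u \<and> \<Z> \<kappa> u = {0} \<and> \<eta> u 0 = \<eta>\<^sub>0 \<and>
        (\<forall>v. TW_weak_solution c \<kappa> v \<and> \<Z> \<kappa> v = {0} \<and> \<eta> v 0 = \<eta>\<^sub>0 \<longrightarrow>
          (\<exists>\<theta>::real. \<forall>x. v x = cis \<theta> * u x)) \<and>
        u \<in> nonvanishing_energy_space \<and>
        (\<forall>x. \<eta>\<^sub>0 \<le> \<eta> u x) \<and>
        card (\<N> u) = 2 \<and>
        ((c, \<kappa>) \<in> \<D>_tilde \<longrightarrow> \<Gamma> \<kappa> u = \<N> u) \<and>
        ((c, \<kappa>) \<in> \<C> \<longrightarrow> compactly_supported (\<eta> u)))"
proof -
  have D: "0 < \<kappa>" "0 \<le> (2 - c\<^sup>2) / (1 - 2 * \<kappa>)" "\<kappa> \<noteq> 1 / 2" if "(c, \<kappa>) \<in> \<D>_tilde"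
  proof -
    from that have "0 < \<kappa> \<and> 0 \<le> (2 - c\<^sup>2) / (1 - 2 * \<kappa>) \<and> \<kappa> \<noteq> 1 / 2"
    proof (cases rule: \<D>_tilde_cases)
      case 1
      have "c\<^sup>2 \<le> 2" using power_mono[OF 1(2,1), of 2] by simp
      then show ?thesis using 1 by simp
    next
      case 2
      have "2 \<le> c\<^sup>2" using power_mono[OF 2(1), of 2] by simp
      then show ?thesis using 2 by (simp add: divide_nonpos_nonpos)
    qed
    then show "0 < \<kappa>" "0 \<le> (2 - c\<^sup>2) / (1 - 2 * \<kappa>)" "\<kappa> \<noteq> 1 / 2" by auto
  qed
  have C: "\<kappa> = 1 / 2" if "(c, \<kappa>) \<in> \<C>" using that by (simp add: \<C>_def)
  have \<kappa>: "0 < \<kappa>" and ratio: "0 \<le> (2 - c\<^sup>2) / (1 - 2 * \<kappa>)"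
  proof -
    have "0 < \<kappa> \<and> 0 \<le> (2 - c\<^sup>2) / (1 - 2 * \<kappa>)"
    proof (cases "(c, \<kappa>) \<in> \<D>_tilde")
      case False
      then have "\<kappa> = 1 / 2" using assms C by blast
      \<comment> \<open>The denominator is 0 at \<kappa> = 1/2, and the quotient takes the default
        value 0.\<close>
      then have "0 < \<kappa>" "1 - 2 * \<kappa> = 0" by simp_all
      then show ?thesis by simp
    qed (use D in blast)
    then show "0 < \<kappa>" "0 \<le> (2 - c\<^sup>2) / (1 - 2 * \<kappa>)" by auto
  qed
  \<comment> \<open>One convenient bound for several needs: c^2 makes 2 - c^2 -
    2\<open>\<eta>\<^sub>0\<close> positive and hence \<open>K\<^sub>0\<close> negative, 2\<kappa>
    yields 1 - \<open>\<eta>\<^sub>0\<close> > 2\<kappa> for the positivity of \<open>Q\<close>, and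
    1/(2\<kappa>) puts \<open>\<eta>\<^sub>0\<close> below \<open>edge\<close>.\<close>
  define A where "A = - (1 + 2 * \<kappa> + c\<^sup>2 + 1 / (2 * \<kappa>))"
  have inv: "0 < 1 / (2 * \<kappa>)" using \<kappa> by simp
  have A: "A < 0" "A < 1 - 1 / (2 * \<kappa>)"
    using \<kappa> inv zero_le_power2[of c] unfolding A_def by linarith+
  have "\<exists>u. TW_weak_solution c \<kappa> u \<and> \<Z> \<kappa> u = {0} \<and> \<eta> u 0 = \<eta>\<^sub>0 \<and>
        (\<forall>v. TW_weak_solution c \<kappa> v \<and> \<Z> \<kappa> v = {0} \<and> \<eta> v 0 = \<eta>\<^sub>0 \<longrightarrow>
          (\<exists>\<theta>::real. \<forall>x. v x = cis \<theta> * u x)) \<and>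
        u \<in> nonvanishing_energy_space \<and>
        (\<forall>x. \<eta>\<^sub>0 \<le> \<eta> u x) \<and>
        card (\<N> u) = 2 \<and>
        ((c, \<kappa>) \<in> \<D>_tilde \<longrightarrow> \<Gamma> \<kappa> u = \<N> u) \<and>
        ((c, \<kappa>) \<in> \<C> \<longrightarrow> compactly_supported (\<eta> u))" if "\<eta>\<^sub>0 \<in> {..<A}" for \<eta>\<^sub>0
  proof -
    interpret TW_profile c \<kappa> \<eta>\<^sub>0
      using \<kappa> ratio that by unfold_locales (auto simp: A_def)
    have edge0: "edge = 0 \<longleftrightarrow> \<kappa> = 1 / 2" using \<kappa> by (auto simp: edge_def field_simps)
    have np: "4 * (1 - edge)\<^sup>2 - c\<^sup>2 * (1 - edge) - c\<^sup>2 \<noteq> 0" if "edge \<noteq> 0"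
    proof -
      have "(c, \<kappa>) \<in> \<D>_tilde" using assms C edge0 that by blast
      from no_plateau[OF this] show ?thesis by (simp add: edge_def)
    qed
    show ?thesis
    proof (intro exI[of _ wave] conjI allI impI)
      show "TW_weak_solution c \<kappa> wave" by (rule TW_weak_solution_wave)
      show "\<Z> \<kappa> wave = {0}" by (rule \<Z>_wave)
      show "\<eta> wave 0 = \<eta>\<^sub>0" by (simp add: \<eta>_wave prof_0)
      show "\<exists>\<theta>::real. \<forall>x. v x = cis \<theta> * wave x"
        if v: "TW_weak_solution c \<kappa> v \<and> \<Z> \<kappa> v = {0} \<and> \<eta> v 0 = \<eta>\<^sub>0" for v
        by (rule wave_unique[of v]) (use v np in auto)
      show "wave \<in> nonvanishing_energy_space" by (rule nonvanishing_wave)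
      show "\<eta>\<^sub>0 \<le> \<eta> wave x" for x by (simp add: \<eta>_wave prof_bounds)
      show "card (\<N> wave) = 2" using core_pos by (simp add: \<N>_wave)
      show "\<Gamma> \<kappa> wave = \<N> wave" if "(c, \<kappa>) \<in> \<D>_tilde"
      proof -
        have ne: "edge \<noteq> 0" using D(3)[OF that] edge0 by simp
        have "prof x = edge \<longleftrightarrow> \<bar>x\<bar> = core" for x
          using prof_core[of x] prof_inner[of x] prof_outer[OF _ ne, of x] by (cases "\<bar>x\<bar>" core rule: linorder_cases) auto
        then show ?thesis using core_pos by (auto simp: \<Gamma>_wave \<N>_wave abs_if)
      qed
      show "compactly_supported (\<eta> wave)" if "(c, \<kappa>) \<in> \<C>"
      proof (rule compactly_supportedI[of "- core" core])
        fix x assume "x \<notin> {- core..core}"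
        then have "core \<le> \<bar>x\<bar>" by auto
        moreover have "edge = 0" using edge0 C[OF that] by blast
        ultimately show "\<eta> wave x = 0" unfolding \<eta>_wave by (rule prof_outer_zero)
      qed
    qed
  qed
  then show ?thesis using A by blast
qed

end
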